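(* Let $\rho\in\mathcal P^-$ with $\|\rho\|>1/N$, and let $\rho_1,\dots,\rho_N\in\mathcal P^-$ satisfy $\sum_{k=1}^N\frac kN\rho_k=\rho$ and $\sum_{k=1}^N\|\rho_k\|\le1$. (a) Let $\varphi\in C_0$. Then $\{\rho_k\}$ is optimal in (S) and $\varphi$ is optimal in (D) if and only if the following three conditions hold: i) $\sum_{k=1}^N\|\rho_k\|=1$; ii) for all $k\in\{1,\dots,N\}$, $\frac{k\varphi}{N}$ is optimal in (D$_k$); iii) $M_k\big(\frac{k\varphi}N\big)=M_N(\varphi)$ holds whenever there exists $l\le k$ such that $\|\rho_l\|>0$. (b) Let $(\varphi_n)$ be a sequence in $C_0$. Then $\{\rho_k\}$ is optimal in (S) and $(\varphi_n)$ is a maximizing sequence for (D) if and only if the following three conditions hold: i) $\sum_{k=1}^N\|\rho_k\|=1$; ii) for all $k\in\{1,\dots,N\}$, $\big(\frac{k\varphi_n}{N}\big)_n$ is a maximizing sequence for (D$_k$); iii) $M_N(\varphi_n)-M_k\big(\frac{k\varphi_n}N\big)\to0$ as $n\to\infty$ holds whenever there exists $l\le k$ such that $\|\rho_l\|>0$.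
   Context: Let $d\ge1$ and $N\ge 2$ be integers. $\mathcal P$ is the set of Borel probability measures on $\mathbb R^d$; $\mathcal P^-$ is the set of nonnegative Borel measures $\rho$ on $\mathbb R^d$ with total mass $\|\rho\|=\rho(\mathbb R^d)\le 1$. $C_0$ is the space of real continuous functions on $\mathbb R^d$ vanishing at infinity, and $\stackrel{*}{\rightharpoonup}$ is weak* convergence in duality with $C_0$. For $k\ge1$, $c_k(x_1,\dots,x_k)=\sum_{1\le i<j\le k}\frac1{|x_i-x_j|}$ for $x_i\in\mathbb R^d$ (with $1/0=+\infty$, $c_1=0$). For $\rho\in\mathcal P$, $C(\rho)=\inf\{\int c_N\,dP : P \text{ Borel probability on }(\mathbb R^d)^N \text{ with all marginals equal to } \rho\}$; for $\rho\in\mathcal P^-$, $\overline C(\rho)=\inf\{\liminf_n C(\rho_n) : \rho_n\in\mathcal P,\ \rho_n\stackrel{*}{\rightharpoonup}\rho\}$. For $2\le k\le N$ and $\mu\in\mathcal P^-$, $\mathcal C_k(\mu)=\inf\int_{(\mathbb R^d)^k}c_k\,dP$ over nonnegative Borel measures $P$ on $(\mathbb R^d)^k$ with all $k$ marginals equal to $\mu$; $\mathcal C_1\equiv0$. For $\varphi\in C_0$ and $1\le k\le N$, $M_k(\varphi)=\sup\{\frac1k\sum_{i=1}^k\varphi(x_i)-c_k(x_1,\dots,x_k) : x_1,\dots,x_k\in\mathbb R^d\}$. The three representations involved (stated for all $\rho,\rho_k\in\mathcal P^-$) are: (S) $\overline C(\rho)=\inf\{\sum_{k=1}^N\mathcal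 C_k(\rho_k) : \rho_k\in\mathcal P^-,\ \sum_{k=1}^N\frac kN\rho_k=\rho,\ \sum_{k=1}^N\|\rho_k\|\le1\}$; (D) $\overline C(\rho)=\sup_{\varphi\in C_0}\{\int\varphi\,d\rho-M_N(\varphi)\}$; (D$_k$) $\mathcal C_k(\rho_k)=\sup_{\varphi\in C_0}\{\int\varphi\,d\rho_k-M_k(\varphi)\|\rho_k\|\}$. "Optimal" means attaining the infimum (resp. supremum); a "maximizing sequence" is one along which the maximized expression converges to the supremum.
   Formalization: In (b), a maximizing sequence is required to have a finite supremum (convergence in the reals); if the value +∞ were allowed, (b) fails, e.g. N=4, ρ=δ_0/2, ρ_4=δ_0/2, other ρ_k=0, where every family has infinite cost. *)

theory Defs
  imports "HOL-Probability.Probability"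
begin

definition C0 :: "((real ^ 'd) \<Rightarrow> real) set" where
  "C0 = {\<phi>. continuous_on UNIV \<phi> \<and> (\<phi> \<longlongrightarrow> 0) at_infinity}"

definition mass :: "(real ^ 'd) measure \<Rightarrow> real" where
  "mass \<mu> = measure \<mu> UNIV"

definition subprob_measures :: "(real ^ 'd) measure set" where
  "subprob_measures = {\<mu>. sets \<mu> = sets borel \<and> emeasure \<mu> UNIV \<le> 1}"

text \<open>
  A point of the \<open>k\<close>-fold product is a function on \<open>nat\<close> of which only the values at
  \<open>1, \<dots>, k\<close> matter.  In \<^typ>\<open>ennreal\<close> one has \<open>1 / 0 = \<infinity>\<close>.
\<close>

definition coulomb :: "nat \<Rightarrow> (nat \<Rightarrow> real ^ 'd) \<Rightarrow> ennreal" where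
  "coulomb k x = (\<Sum>(i, j) | 1 \<le> i \<and> i < j \<and> j \<le> k. 1 / ennreal (norm (x i - x j)))"

definition transport_plans :: "nat \<Rightarrow> (real ^ 'd) measure \<Rightarrow> (nat \<Rightarrow> real ^ 'd) measure set" where
  "transport_plans k \<mu> =
     {P. sets P = sets (PiM {1..k} (\<lambda>_. borel)) \<and> (\<forall>i\<in>{1..k}. distr P borel (\<lambda>x. x i) = \<mu>)}"

definition partial_cost :: "nat \<Rightarrow> (real ^ 'd) measure \<Rightarrow> ennreal" where
  "partial_cost k \<mu> =
     (if k = 1 then 0 else (INF P \<in> transport_plans k \<mu>. \<integral>\<^sup>+ x. coulomb k x \<partial>P))"

definition M :: "nat \<Rightarrow> (real ^ 'd \<Rightarrow> real) \<Rightarrow> ereal" where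
  "M k \<phi> = (SUP x. ereal (1 / real k * (\<Sum>i = 1..k. \<phi> (x i))) - enn2ereal (coulomb k x))"

definition admissible :: "nat \<Rightarrow> (real ^ 'd) measure \<Rightarrow> (nat \<Rightarrow> (real ^ 'd) measure) \<Rightarrow> bool" where
  "admissible N \<rho> \<sigma> \<longleftrightarrow>
     (\<forall>k\<in>{1..N}. \<sigma> k \<in> subprob_measures) \<and>
     (\<forall>A\<in>sets borel. measure \<rho> A = (\<Sum>k = 1..N. real k / real N * measure (\<sigma> k) A)) \<and>
     (\<Sum>k = 1..N. mass (\<sigma> k)) \<le> 1"

definition stratified_cost :: "nat \<Rightarrow> (nat \<Rightarrow> (real ^ 'd) measure) \<Rightarrow> ennreal" where
  "stratified_cost N \<sigma> = (\<Sum>k = 1..N. partial_cost k (\<sigma> k))"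

definition optimal_S :: "nat \<Rightarrow> (real ^ 'd) measure \<Rightarrow> (nat \<Rightarrow> (real ^ 'd) measure) \<Rightarrow> bool" where
  "optimal_S N \<rho> \<sigma> \<longleftrightarrow>
     admissible N \<rho> \<sigma> \<and> stratified_cost N \<sigma> = (INF \<tau> \<in> {\<tau>. admissible N \<rho> \<tau>}. stratified_cost N \<tau>)"

definition dual :: "nat \<Rightarrow> (real ^ 'd) measure \<Rightarrow> (real ^ 'd \<Rightarrow> real) \<Rightarrow> ereal" where
  "dual N \<rho> \<phi> = ereal (\<integral>x. \<phi> x \<partial>\<rho>) - M N \<phi>"

definition partial_dual :: "nat \<Rightarrow> (real ^ 'd) measure \<Rightarrow> (real ^ 'd \<Rightarrow> real) \<Rightarrow> ereal" where
  "partial_dual k \<mu> \<phi> = ereal (\<integral>x. \<phi> x \<partial>\<mu>) - M k \<phi> * ereal (mass \<mu>)"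

definition maximizer :: "('b \<Rightarrow> ereal) \<Rightarrow> 'b set \<Rightarrow> 'b \<Rightarrow> bool" where
  "maximizer F S x \<longleftrightarrow> x \<in> S \<and> F x = (SUP y\<in>S. F y)"

text \<open>
  Convergence to the supremum is convergence of real numbers, so a functional whose
  supremum is infinite has no maximizing sequence.  Allowing \<open>+\<infinity>\<close> as a limit would make
  the characterisation of maximizing sequences false: if \<open>N \<ge> 3\<close> and \<open>\<rho>\<close> is half of a
  Dirac measure, then every admissible family, also one of total mass less than 1, has
  infinite cost and so attains the infimum.
\<close>

definition maximizing_seq :: "('b \<Rightarrow> ereal) \<Rightarrow> 'b set \<Rightarrow> (nat \<Rightarrow> 'b) \<Rightarrow> bool" where
  "maximizing_seq F S x \<longleftrightarrow>
     (\<forall>n. x n \<in> S) \<and> \<bar>SUP y\<in>S. F y\<bar> \<noteq> \<infinity> \<and> (\<lambda>n. F (x n)) \<longlonglongrightarrow> (SUP y\<in>S. F y)"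

end

theory Submission
  imports Defs
begin

text \<open>
  With \<open>k \<phi> / N\<close> as test function in (D\<open>\<^sub>k\<close>), the dual value at \<open>\<phi>\<close> is the sum of the partial dual
  values minus \<open>(M\<^sub>N \<phi> - M\<^sub>k (k \<phi> / N)) \<parallel>\<rho>\<^sub>k\<parallel>\<close> summed over \<open>k\<close>, minus \<open>M\<^sub>N \<phi> (1 - \<Sum> \<parallel>\<rho>\<^sub>k\<parallel>)\<close>.
  The subtracted terms are nonnegative because points may be sent to infinity.  In the absence of
  a duality gap, optimality means that all slack vanishes; \<open>M\<^sub>N \<phi> \<longrightarrow> 0\<close> is excluded because some
  \<open>\<rho>\<^sub>k\<close> with \<open>k \<ge> 2\<close> has positive mass, hence positive cost.  Part (a) is part (b) for constant
  sequences.

  Absence of a gap is shown on the one-point compactification, where the stratified problem is a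
  transport problem with \<open>N\<close> marginals and interaction zero with the point at infinity.  A plan is
  the image of a probability measure on \<open>[0, 1]\<close> under a space-filling curve, so Helly's theorem
  supplies all compactness.  For finitely many marginal constraints and a bounded continuous cost
  the squared violation has a minimiser; if it is positive, its first-order condition is a
  potential violating the assumed dual bound.  Then the cost increases to the true one.  The
  partial problem is the stratified problem for a probability measure with \<open>N = k\<close>, since then all
  mass has to lie on the top stratum.
\<close>

section \<open>A space-filling curve\<close>

text \<open>Optimality in (S) and in (D) refers only to an infimum and a supremum, so everything
  hinges on the equality of these two numbers. The obstacle is escape of mass: a limit of plans may
  lose some of its N points to infinity. On the sphere that compactifies the space such points are
  kept, the deficit 1 - \<open>mass \<rho>\<close> becomes an atom, and a configuration with k
  finite points is what stratum k records. Only the average of the N marginals is prescribed,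
  because the average of \<phi> over the points is all that M_N sees; equal marginals are restored
  afterwards by symmetrising each stratum. The curve is needed since Helly's theorem speaks about
  the line: one real parameter encodes all N points, and continuous functions of the points become
  continuous functions of the parameter. The regularised costs are bounded, continuous and
  increasing in m, so one limit serves all constraints and all levels m at once. The threshold 1/N
  is the largest mass that stratum 1, which costs nothing, can supply alone.\<close>

definition trit :: "real \<Rightarrow> real" where
  "trit t = max 0 (min 1 (1 / 2 - cos (pi * t)))"

lemma trit_bounds: "0 \<le> trit t" "trit t \<le> 1"
  by (auto simp: trit_def)

lemma continuous_on_trit: "continuous_on UNIV trit"
  unfolding trit_def by (intro continuous_intros)

lemma trit_periodic: "trit (t + 2 * of_int k) = trit t"
proof -
  have "cos (pi * (t + 2 * of_int k)) = cos (pi * t + of_int k * (2 * pi))"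
    by (simp add: algebra_simps)
  also have "\<dots> = cos (pi * t)"
    using cos_int_2pin[of k] sin_int_2pin[of k] by (simp add: cos_add mult_ac)
  finally show ?thesis by (simp add: trit_def)
qed

text \<open>The plateaus come from cos (pi / 3) = 1 / 2: clamping 1 / 2 - cos (pi t) to [0, 1] makes
  it constant on [0, 1/3] and on [2/3, 1], the intervals selected by a first ternary digit 0 or
  2.\<close>

lemma trit_left:
  assumes "0 \<le> t" "t \<le> 1 / 3"
  shows "trit t = 0"
proof -
  have "pi * t \<le> pi * (1 / 3)" using assms by (intro mult_left_mono) auto
  hence "cos (pi / 3) \<le> cos (pi * t)"
    using assms by (intro cos_monotone_0_pi_le) auto
  thus ?thesis by (simp add: trit_def cos_60)
qed

lemma trit_right:
  assumes "2 / 3 \<le> t" "t \<le> 1"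
  shows "trit t = 1"
proof -
  have "trit t = max 0 (min 1 (1 / 2 + cos (pi * (1 - t))))"
    by (simp add: trit_def right_diff_distrib cos_diff)
  moreover have "pi * (1 - t) \<le> pi * (1 / 3)" using assms by (intro mult_left_mono) auto
  hence "cos (pi / 3) \<le> cos (pi * (1 - t))"
    using assms by (intro cos_monotone_0_pi_le) auto
  ultimately show ?thesis by (simp add: cos_60)
qed

text \<open>The address is a point of the Cantor set with ternary digits \<open>2 * a n\<close>.
  Multiplication by 3 shifts the digits, and the leading digit decides which plateau of
  \<open>trit\<close> is met.\<close>

lemma exists_ternary_address:
  fixes a :: "nat \<Rightarrow> real"
  assumes a: "\<And>n. a n \<in> {0, 1}"
  shows "\<exists>t\<in>{0..1}. \<forall>n. trit (3 ^ n * t) = a n"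
proof -
  define g where "g n i = 2 * a (n + i) / 3 ^ Suc i" for n i
  define T where "T n = (\<Sum>i. g n i)" for n
  have geo: "(\<lambda>i. 2 / 3 ^ Suc i :: real) sums 1"
    using sums_mult[OF geometric_sums[of "1 / 3 :: real"], of "2 / 3"]
    by (simp add: power_divide)
  have g: "0 \<le> g n i" "g n i \<le> 2 / 3 ^ Suc i" for n i
    using a[of "n + i"] by (auto simp: g_def)
  have summ: "summable (g n)" for n
    by (rule summable_comparison_test'[OF sums_summable[OF geo], of 0]) (use g in auto)
  have T: "0 \<le> T n" "T n \<le> 1" for n
  proof -
    show "0 \<le> T n" unfolding T_def by (intro suminf_nonneg summ g)
    have "T n \<le> (\<Sum>i. 2 / 3 ^ Suc i)" unfolding T_def
      by (intro suminf_le g summ sums_summable[OF geo])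
    thus "T n \<le> 1" using sums_unique[OF geo] by simp
  qed
  have rec: "3 * T n = 2 * a n + T (Suc n)" for n
  proof -
    have "T n = g n 0 + (\<Sum>i. g n (Suc i))"
      unfolding T_def using suminf_split_head[OF summ[of n]] by simp
    also have "(\<lambda>i. g n (Suc i)) = (\<lambda>i. g (Suc n) i / 3)"
      by (auto simp: g_def)
    also have "(\<Sum>i. g (Suc n) i / 3) = T (Suc n) / 3"
      unfolding T_def by (rule suminf_divide[OF summ])
    finally show ?thesis by (simp add: g_def)
  qed
  \<comment> \<open>The part split off by each shift is even since every digit is 0 or 2; this is
    why \<open>trit\<close> has period 2.\<close>
  have shift: "\<exists>k::int. 3 ^ n * T 0 = T n + 2 * of_int k" for n
  proof (induction n)
    case 0
    show ?case by (rule exI[of _ 0]) simp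
  next
    case (Suc n)
    then obtain k :: int where k: "3 ^ n * T 0 = T n + 2 * of_int k" by auto
    obtain b :: int where b: "a n = of_int b"
      using a[of n] by (metis insertE of_int_0 of_int_1 singletonD)
    have "3 ^ Suc n * T 0 = T (Suc n) + 2 * of_int (b + 3 * k)"
      using k rec[of n] b by (simp add: algebra_simps)
    thus ?case by blast
  qed
  have "trit (3 ^ n * T 0) = a n" for n
  proof -
    obtain k :: int where k: "3 ^ n * T 0 = T n + 2 * of_int k" using shift by blast
    have "trit (3 ^ n * T 0) = trit (T n)" unfolding k by (rule trit_periodic)
    also have "\<dots> = a n"
      using a[of n] rec[of n] T[of n] T[of "Suc n"] by (auto intro!: trit_left trit_right)
    finally show ?thesis .
  qed
  thus ?thesis using T[of 0] by (intro bexI[of _ "T 0"]) auto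
qed

lemma exists_binary_expansion:
  fixes y :: real
  assumes "0 \<le> y" "y \<le> 1"
  shows "\<exists>a. (\<forall>m. a m \<in> {0, 1}) \<and> (\<lambda>m. a m / 2 ^ Suc m) sums y"
proof -
  \<comment> \<open>Greedy digits of the doubling map. The remainder 1 is a fixed point, so 1 is
    expanded as 0.111... and the remainders never leave [0, 1].\<close>
  define d where "d x = (if x \<ge> 1 / 2 then 1 else 0 :: real)" for x :: real
  define r where "r = rec_nat y (\<lambda>_ x. 2 * x - d x)"
  have r0: "r 0 = y" and rS: "r (Suc n) = 2 * r n - d (r n)" for n
    by (simp_all add: r_def)
  have rb: "0 \<le> r n \<and> r n \<le> 1" for n
    by (induction n) (use assms in \<open>auto simp: r0 rS d_def\<close>)
  have part: "(\<Sum>m<n. d (r m) / 2 ^ Suc m) = y - r n / 2 ^ n" for n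
    by (induction n) (auto simp: r0 rS field_simps)
  have "(\<lambda>n. r n / 2 ^ n) \<longlonglongrightarrow> 0"
  proof (rule tendsto_sandwich[of "\<lambda>_. 0" _ _ "\<lambda>n. (1 / 2) ^ n"])
    show "(\<lambda>n. (1 / 2 :: real) ^ n) \<longlonglongrightarrow> 0" by (rule LIMSEQ_realpow_zero) auto
  qed (use rb in \<open>auto simp: power_divide divide_right_mono\<close>)
  hence "(\<lambda>n. y - r n / 2 ^ n) \<longlonglongrightarrow> y - 0" by (intro tendsto_intros)
  hence "(\<lambda>m. d (r m) / 2 ^ Suc m) sums y"
    unfolding sums_def part by simp
  thus ?thesis by (intro exI[of _ "\<lambda>m. d (r m)"]) (auto simp: d_def)
qed

text \<open>Schoenberg's space-filling curve, with countably many coordinates.\<close>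

definition peano :: "nat \<Rightarrow> real \<Rightarrow> real" where
  "peano n t = (\<Sum>m. trit (3 ^ prod_encode (n, m) * t) / 2 ^ Suc m)"

lemma sums_half_powers: "(\<lambda>m. 1 / 2 ^ Suc m :: real) sums 1"
  using power_half_series by (simp add: power_divide)

lemma continuous_on_peano: "continuous_on UNIV (peano n)"
proof (rule uniform_limit_theorem)
  show "uniform_limit UNIV (\<lambda>k t. \<Sum>m<k. trit (3 ^ prod_encode (n, m) * t) / 2 ^ Suc m)
      (peano n) sequentially"
    unfolding peano_def
    by (rule Weierstrass_m_test[OF _ sums_summable[OF sums_half_powers]])
       (auto simp: trit_bounds divide_right_mono)
  show "\<forall>\<^sub>F k in sequentially.
      continuous_on UNIV (\<lambda>t. \<Sum>m<k. trit (3 ^ prod_encode (n, m) * t) / 2 ^ Suc m)"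
    by (intro always_eventually allI continuous_intros continuous_on_compose2[OF continuous_on_trit])
       auto
qed auto

text \<open>One sequence of ternary digits holds the binary digits of all coordinates: digit m of
  \<open>y n\<close> is stored at position \<open>prod_encode (n, m)\<close>.\<close>

lemma peano_surj:
  assumes "\<And>n. 0 \<le> y n" "\<And>n. y n \<le> 1"
  shows "\<exists>t\<in>{0..1}. \<forall>n. peano n t = y n"
proof -
  have "\<forall>n. \<exists>a. (\<forall>m. a m \<in> {0, 1}) \<and> (\<lambda>m. a m / 2 ^ Suc m) sums y n"
    using exists_binary_expansion assms by blast
  then obtain A where A: "\<And>n m. A n m \<in> {0, 1 :: real}" "\<And>n. (\<lambda>m. A n m / 2 ^ Suc m) sums y n"
    by metis
  define a where "a i = case_prod A (prod_decode i)" for i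
  have "a i \<in> {0, 1}" for i
    using A(1) by (cases "prod_decode i") (simp add: a_def)
  from exists_ternary_address[of a, OF this]
  obtain t where t: "t \<in> {0..1}" "\<And>i. trit (3 ^ i * t) = a i" by auto
  have "peano n t = y n" for n
    using sums_unique[OF A(2)[of n]] by (simp add: peano_def t(2) a_def)
  thus ?thesis using t(1) by blast
qed

section \<open>Moment problems on the unit interval\<close>

text \<open>The measures live on the whole line, where tightness and weak convergence are
  formulated; the interval only carries their mass.\<close>

definition unit_dist :: "real measure \<Rightarrow> bool" where
  "unit_dist \<nu> \<longleftrightarrow> real_distribution \<nu> \<and> measure \<nu> {0..1} = 1"

lemma unit_dist_integrable:
  fixes f :: "real \<Rightarrow> real"
  assumes "unit_dist \<nu>" "continuous_on UNIV f" "\<And>x. \<bar>f x\<bar> \<le> B"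
  shows "integrable \<nu> f"
proof -
  interpret real_distribution \<nu> using assms(1) by (simp add: unit_dist_def)
  show ?thesis
    using borel_measurable_continuous_onI[OF assms(2)] assms(3)
    by (intro integrable_const_bound[where B = B]) auto
qed

lemma unit_dist_weak_compact:
  assumes "\<And>n. unit_dist (\<mu> n)"
  obtains r \<nu> where "strict_mono (r :: nat \<Rightarrow> nat)" "unit_dist \<nu>"
    "\<And>f B. continuous_on UNIV f \<Longrightarrow> (\<And>x. \<bar>f x\<bar> \<le> B) \<Longrightarrow>
       (\<lambda>n. \<integral>x. f x \<partial>\<mu> (r n)) \<longlonglongrightarrow> (\<integral>x. f x \<partial>\<nu> :: real)"
proof -
  have rd: "real_distribution (\<mu> n)" for n using assms by (simp add: unit_dist_def)
  have tight: "tight \<mu>"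
    unfolding tight_def
  proof (intro conjI allI impI rd)
    fix \<epsilon> :: real assume "\<epsilon> > 0"
    \<comment> \<open>The intervals in the definition of tightness are open on the left, so the left
      end is taken below 0.\<close>
    have "measure (\<mu> n) {-1<..1} \<ge> 1" for n
    proof -
      interpret real_distribution "\<mu> n" by (rule rd)
      have "measure (\<mu> n) {0..1} \<le> measure (\<mu> n) {-1<..1}"
        by (intro finite_measure_mono) auto
      thus ?thesis using assms[of n] by (simp add: unit_dist_def)
    qed
    hence "1 - \<epsilon> < measure (\<mu> n) {-1<..1}" for n
      using \<open>\<epsilon> > 0\<close> by (smt (verit))
    thus "\<exists>a b. a < b \<and> (\<forall>n. 1 - \<epsilon> < measure (\<mu> n) {a<..b})"
      by (intro exI[of _ "-1"] exI[of _ 1]) auto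
  qed
  obtain r \<nu> where r: "strict_mono r" and \<nu>: "real_distribution \<nu>"
    and wc: "weak_conv_m (\<mu> \<circ> id \<circ> r) \<nu>"
    using tight_imp_convergent_subsubsequence[OF tight strict_mono_id] by blast
  have conv: "(\<lambda>n. \<integral>x. f x \<partial>\<mu> (r n)) \<longlonglongrightarrow> (\<integral>x. f x \<partial>\<nu>)"
    if "continuous_on UNIV f" "\<And>x. \<bar>f x\<bar> \<le> B" for f :: "real \<Rightarrow> real" and B
    using weak_conv_imp_integral_bdd_continuous_conv[OF _ \<nu> wc, of f B] rd that
    by (auto simp: continuous_on_eq_continuous_at)
  interpret \<nu>: real_distribution \<nu> by (rule \<nu>)
  \<comment> \<open>A bounded continuous function that vanishes exactly on [0, 1]: its zero
    integrals pass to the limit measure, which is therefore carried by the same interval.\<close>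
  define g where "g x = min 1 (infdist x {0..1})" for x :: real
  have g_cont: "continuous_on UNIV g" unfolding g_def by (intro continuous_intros)
  have g_bound: "\<bar>g x\<bar> \<le> 1" for x by (auto simp: g_def infdist_nonneg)
  have g_zero: "g x = 0 \<longleftrightarrow> x \<in> {0..1}" for x
    using in_closed_iff_infdist_zero[of "{0..1::real}" x] by (auto simp: g_def min_def)
  have [measurable]: "g \<in> borel_measurable borel"
    using g_cont by (rule borel_measurable_continuous_onI)
  have "(\<integral>x. g x \<partial>\<mu> n) = 0" for n
  proof -
    interpret real_distribution "\<mu> n" by (rule rd)
    have "AE x in \<mu> n. x \<in> {0..1}"
      using assms[of n] by (intro AE_prob_1) (simp add: unit_dist_def)
    hence "AE x in \<mu> n. g x = 0" by (simp add: g_zero)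
    thus ?thesis by (intro integral_eq_zero_AE)
  qed
  with conv[OF g_cont g_bound] have "(\<integral>x. g x \<partial>\<nu>) = 0"
    by (simp add: LIMSEQ_const_iff)
  moreover have "integrable \<nu> g"
    by (rule \<nu>.integrable_const_bound[of _ 1]) (use g_bound in auto)
  ultimately have "AE x in \<nu>. g x = 0"
    by (subst (asm) integral_nonneg_eq_0_iff_AE) (auto simp: g_def infdist_nonneg)
  hence "AE x in \<nu>. x \<in> {0..1}" by (simp add: g_zero)
  hence "measure \<nu> {0..1} = 1" by (subst (asm) \<nu>.AE_in_set_eq_1) auto
  hence "unit_dist \<nu>" using \<nu> by (simp add: unit_dist_def)
  thus thesis using that r conv by blast
qed

text \<open>The mixture of \<nu> and the Dirac measure at t, obtained as the law of a random choice:
  a coin with success probability e decides between t and a sample of \<nu>.\<close>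

lemma unit_dist_mixture:
  assumes "unit_dist \<nu>" "0 \<le> e" "e \<le> 1" "t \<in> {0..1}"
  obtains \<nu>' where "unit_dist \<nu>'"
    "\<And>f B. continuous_on UNIV f \<Longrightarrow> (\<And>x. \<bar>f x\<bar> \<le> B) \<Longrightarrow>
       (\<integral>x. f x \<partial>\<nu>') = (1 - e) * (\<integral>x. f x \<partial>\<nu>) + e * (f t :: real)"
proof -
  interpret \<nu>: real_distribution \<nu> using assms by (simp add: unit_dist_def)
  let ?B = "measure_pmf (bernoulli_pmf e)"
  let ?g = "\<lambda>(b, x). if b then t else x"
  interpret P: pair_prob_space ?B \<nu> ..
  define \<nu>' where "\<nu>' = distr (?B \<Otimes>\<^sub>M \<nu>) borel ?g"
  have g[measurable]: "?g \<in> borel_measurable (?B \<Otimes>\<^sub>M \<nu>)" by measurable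
  have int: "(\<integral>x. f x \<partial>\<nu>') = (1 - e) * (\<integral>x. f x \<partial>\<nu>) + e * f t"
    if [measurable]: "f \<in> borel_measurable borel" and bd: "\<And>x. \<bar>f x\<bar> \<le> B"
    for f :: "real \<Rightarrow> real" and B
  proof -
    have "(\<integral>x. f x \<partial>\<nu>') = (\<integral>z. f (?g z) \<partial>(?B \<Otimes>\<^sub>M \<nu>))"
      unfolding \<nu>'_def by (rule integral_distr) measurable
    also have "\<dots> = (\<integral>b. \<integral>x. f (?g (b, x)) \<partial>\<nu> \<partial>?B)"
      by (rule P.integral_fst'[symmetric], rule P.P.integrable_const_bound[of _ B])
         (use bd in auto)
    also have "\<dots> = (1 - e) * (\<integral>x. f x \<partial>\<nu>) + e * f t"
      using assms \<nu>.prob_space by simp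
    finally show ?thesis .
  qed
  have rd: "real_distribution \<nu>'"
    unfolding \<nu>'_def by (rule P.P.real_distribution_distr) measurable
  interpret \<nu>': real_distribution \<nu>' by (rule rd)
  have "measure \<nu>' {0..1} = (\<integral>x. indicator {0..1} x \<partial>\<nu>')" by simp
  also have "\<dots> = (1 - e) * (\<integral>x. indicator {0..1} x \<partial>\<nu>) + e * indicator {0..1} t"
    by (rule int[of _ 1]) auto
  also have "\<dots> = 1" using assms by (simp add: unit_dist_def)
  finally have "unit_dist \<nu>'" using rd by (simp add: unit_dist_def)
  thus thesis using that int borel_measurable_continuous_onI by blast
qed

text \<open>
  A theorem of the alternative for moment problems.  The multipliers are the values of the
  constraint functionals at a minimiser of the squared violation, and the inequality is the
  first-order condition in the direction of a Dirac measure.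
\<close>

lemma moment_alternative:
  fixes F :: "nat \<Rightarrow> real \<Rightarrow> real" and C :: "real \<Rightarrow> real"
  assumes F: "\<And>j. continuous_on UNIV (F j)" "\<And>j x. \<bar>F j x\<bar> \<le> B j"
    and C: "continuous_on UNIV C" "\<And>x. \<bar>C x\<bar> \<le> B'"
  shows "(\<exists>\<nu>. unit_dist \<nu> \<and> (\<forall>j<J. (\<integral>x. F j x \<partial>\<nu>) = 0) \<and> (\<integral>x. C x \<partial>\<nu>) \<le> 0) \<or>
    (\<exists>l s \<delta>. s \<ge> 0 \<and> \<delta> > 0 \<and> (\<forall>t\<in>{0..1}. (\<Sum>j<J. l j * F j t) + s * C t \<ge> \<delta>))"
proof -
  \<comment> \<open>The equality constraints are penalised on both sides, the cost bound only where
    it is exceeded. Every term is continuous under weak convergence, so a minimiser exists.\<close>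
  define G where "G \<nu> = (\<Sum>j<J. (\<integral>x. F j x \<partial>\<nu>)\<^sup>2) + (max 0 (\<integral>x. C x \<partial>\<nu>))\<^sup>2" for \<nu>
  have G_nonneg: "0 \<le> G \<nu>" for \<nu> unfolding G_def by (intro add_nonneg_nonneg sum_nonneg) auto
  define I where "I = Inf (G ` Collect unit_dist)"
  have bdd: "bdd_below (G ` Collect unit_dist)"
    by (rule bdd_belowI[of _ 0]) (auto simp: G_nonneg)
  have ne: "unit_dist (return borel 0)"
  proof -
    have "real_distribution (return borel (0::real))"
      by (intro real_distribution.intro prob_space_return real_distribution_axioms.intro) auto
    thus ?thesis by (simp add: unit_dist_def measure_return)
  qed
  have "\<exists>\<nu>. unit_dist \<nu> \<and> G \<nu> < I + 1 / real (Suc n)" for n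
  proof -
    have "I < I + 1 / real (Suc n)" by simp
    then obtain y where "y \<in> G ` Collect unit_dist" "y < I + 1 / real (Suc n)"
      unfolding I_def using ne cInf_lessD[of "G ` Collect unit_dist"] by blast
    thus ?thesis by auto
  qed
  then obtain \<mu> where \<mu>: "\<And>n. unit_dist (\<mu> n)" "\<And>n. G (\<mu> n) < I + 1 / real (Suc n)"
    by metis
  obtain r \<nu> where r: "strict_mono r" and \<nu>: "unit_dist \<nu>"
    and conv: "\<And>f B. continuous_on UNIV f \<Longrightarrow> (\<And>x. \<bar>f x\<bar> \<le> B) \<Longrightarrow>
       (\<lambda>n. \<integral>x. f x \<partial>\<mu> (r n)) \<longlonglongrightarrow> (\<integral>x. f x \<partial>\<nu> :: real)"
    using unit_dist_weak_compact[of \<mu>, OF \<mu>(1)] by blast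
  have "(\<lambda>n. G (\<mu> (r n))) \<longlonglongrightarrow> G \<nu>"
    unfolding G_def by (intro tendsto_intros conv[OF F] conv[OF C])
  moreover have "(\<lambda>n. I + 1 / real (Suc (r n))) \<longlonglongrightarrow> I + 0"
    by (intro tendsto_intros LIMSEQ_subseq_LIMSEQ[OF lim_1_over_n[THEN LIMSEQ_Suc] r, unfolded comp_def])
  ultimately have "G \<nu> \<le> I"
    using \<mu>(2) by (intro LIMSEQ_le) (auto intro!: exI[of _ 0] less_imp_le)
  hence min: "G \<nu> \<le> G \<nu>'" if "unit_dist \<nu>'" for \<nu>'
    using that cInf_lower[OF _ bdd, of "G \<nu>'"] by (auto simp: I_def)
  define l where "l j = (\<integral>x. F j x \<partial>\<nu>)" for j
  define c where "c = (\<integral>x. C x \<partial>\<nu>)"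
  define s where "s = max 0 c"
  have G\<nu>: "G \<nu> = (\<Sum>j<J. (l j)\<^sup>2) + s\<^sup>2" by (simp add: G_def l_def s_def c_def)
  show ?thesis
  proof (cases "G \<nu> = 0")
    case True
    hence "(\<Sum>j<J. (l j)\<^sup>2) = 0" "s = 0"
      using sum_nonneg[of "{..<J}" "\<lambda>j. (l j)\<^sup>2"] unfolding G\<nu>
      by (auto simp: add_nonneg_eq_0_iff)
    hence "\<forall>j<J. l j = 0" "c \<le> 0"
      by (auto simp: sum_nonneg_eq_0_iff s_def max_def split: if_splits)
    thus ?thesis using \<nu> by (auto simp: l_def c_def)
  next
    case False
    \<comment> \<open>The separation constant \<delta> is the minimal violation
      \<open>G \<nu>\<close> itself.\<close>
    have "(\<Sum>j<J. l j * F j t) + s * C t \<ge> G \<nu>" if t: "t \<in> {0..1}" for t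
    proof (rule ccontr)
      \<comment> \<open>Along the segment from \<nu> to the Dirac measure at t the violation is at
        most \<open>G \<nu> + 2 * e * A + e\<^sup>2 * D\<close>; the negated claim makes the linear
        coefficient negative.\<close>
      define A where "A = (\<Sum>j<J. l j * (F j t - l j)) + s * (C t - s)"
      define D where "D = (\<Sum>j<J. (F j t - l j)\<^sup>2) + (C t - s)\<^sup>2"
      have D: "D \<ge> 0" unfolding D_def by (intro add_nonneg_nonneg sum_nonneg) auto
      assume "\<not> ?thesis"
      hence A: "A < 0"
        unfolding A_def G\<nu> by (simp add: algebra_simps sum_subtractf power2_eq_square)
      have key: "0 \<le> 2 * e * A + e\<^sup>2 * D" if e: "0 \<le> e" "e \<le> 1" for e
      proof -
        obtain \<nu>' where \<nu>': "unit_dist \<nu>'"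
          and int: "\<And>f B. continuous_on UNIV f \<Longrightarrow> (\<And>x. \<bar>f x\<bar> \<le> B) \<Longrightarrow>
            (\<integral>x. f x \<partial>\<nu>') = (1 - e) * (\<integral>x. f x \<partial>\<nu>) + e * (f t :: real)"
          using unit_dist_mixture[OF \<nu> e t] by blast
        \<comment> \<open>The positive part of the new cost is at most the modulus of the
          interpolation between s and \<open>C t\<close>, because s is at least c.\<close>
        have cb: "(max 0 ((1 - e) * c + e * C t))\<^sup>2 \<le> (s + e * (C t - s))\<^sup>2"
        proof (cases "(1 - e) * c + e * C t \<le> 0")
          case False
          have "(1 - e) * c \<le> (1 - e) * s" using e by (intro mult_left_mono) (auto simp: s_def)
          thus ?thesis using False by (intro power_mono) (auto simp: algebra_simps)
        qed (simp add: max_def)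
        have "G \<nu> \<le> G \<nu>'" by (rule min[OF \<nu>'])
        also have "G \<nu>' = (\<Sum>j<J. (l j + e * (F j t - l j))\<^sup>2) + (max 0 ((1 - e) * c + e * C t))\<^sup>2"
          unfolding G_def int[OF F] int[OF C] by (simp add: l_def c_def algebra_simps)
        also have "\<dots> \<le> (\<Sum>j<J. (l j + e * (F j t - l j))\<^sup>2) + (s + e * (C t - s))\<^sup>2"
          using cb by simp
        also have "\<dots> = G \<nu> + 2 * e * A + e\<^sup>2 * D"
        proof -
          have sq: "(a + e * b)\<^sup>2 = a\<^sup>2 + 2 * e * (a * b) + e\<^sup>2 * b\<^sup>2" for a b :: real
            by (simp add: power2_eq_square algebra_simps)
          show ?thesis
            unfolding G\<nu> A_def D_def sq sum.distrib sum_distrib_left[symmetric]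
            by (simp add: distrib_left)
        qed
        finally show ?thesis by simp
      qed
      \<comment> \<open>Small enough that \<open>e * D\<close> is at most \<open>- A\<close>, so the
        linear term dominates; the summand 1 keeps the denominator positive when D is 0.\<close>
      define e where "e = min 1 (- A / (D + 1))"
      have e: "0 < e" "e \<le> 1" using A D divide_neg_pos[of A "D + 1"] by (auto simp: e_def)
      have "e * D \<le> (- A / (D + 1)) * D" using D by (intro mult_right_mono) (auto simp: e_def)
      also have "\<dots> \<le> - A" using A D by (simp add: field_simps)
      finally have "2 * A + e * D < 0" using A by simp
      hence "e * (2 * A + e * D) < 0" using e by (simp add: mult_pos_neg)
      with key[of e] e show False by (simp add: algebra_simps power2_eq_square)
    qed
    moreover have "G \<nu> > 0" using False G_nonneg[of \<nu>] by simp
    moreover have "s \<ge> 0" by (simp add: s_def)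
    ultimately show ?thesis by blast
  qed
qed

text \<open>A diagonal limit: the n-th measure satisfies the first n constraints at cost level n. A
  fixed constraint holds from some index on, and a fixed level m is dominated by all later
  levels.\<close>

lemma moment_limit:
  fixes F C :: "nat \<Rightarrow> real \<Rightarrow> real"
  assumes F: "\<And>j. continuous_on UNIV (F j)" "\<And>j x. \<bar>F j x\<bar> \<le> B j"
    and C: "\<And>m. continuous_on UNIV (C m)" "\<And>m x. \<bar>C m x\<bar> \<le> B' m"
    and mono: "\<And>x. incseq (\<lambda>m. C m x)"
    and ex: "\<And>n. \<exists>\<nu>. unit_dist \<nu> \<and> (\<forall>j<n. (\<integral>x. F j x \<partial>\<nu>) = 0) \<and> (\<integral>x. C n x \<partial>\<nu>) \<le> 0"
  obtains \<nu> where "unit_dist \<nu>" "\<And>j. (\<integral>x. F j x \<partial>\<nu>) = 0" "\<And>m. (\<integral>x. C m x \<partial>\<nu>) \<le> 0"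
proof -
  obtain \<mu> where \<mu>: "\<And>n. unit_dist (\<mu> n)" "\<And>n j. j < n \<Longrightarrow> (\<integral>x. F j x \<partial>\<mu> n) = 0"
    "\<And>n. (\<integral>x. C n x \<partial>\<mu> n) \<le> 0"
    using ex by metis
  obtain r \<nu> where r: "strict_mono r" and \<nu>: "unit_dist \<nu>"
    and conv: "\<And>f B. continuous_on UNIV f \<Longrightarrow> (\<And>x. \<bar>f x\<bar> \<le> B) \<Longrightarrow>
       (\<lambda>n. \<integral>x. f x \<partial>\<mu> (r n)) \<longlonglongrightarrow> (\<integral>x. f x \<partial>\<nu> :: real)"
    using unit_dist_weak_compact[of \<mu>, OF \<mu>(1)] by blast
  have "(\<integral>x. F j x \<partial>\<nu>) = 0" for j
  proof (rule LIMSEQ_unique[OF conv[OF F]])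
    have "(\<integral>x. F j x \<partial>\<mu> (r n)) = 0" if "n > j" for n
      using that seq_suble[OF r, of n] by (intro \<mu>(2)) simp
    thus "(\<lambda>n. \<integral>x. F j x \<partial>\<mu> (r n)) \<longlonglongrightarrow> 0"
      by (intro tendsto_eventually eventually_mono[OF eventually_gt_at_top[of j]])
  qed
  moreover have "(\<integral>x. C m x \<partial>\<nu>) \<le> 0" for m
  proof (rule LIMSEQ_le_const2[OF conv[OF C]], intro exI[of _ m] allI impI)
    fix n assume "m \<le> n"
    hence "m \<le> r n" using seq_suble[OF r, of n] by simp
    hence "(\<integral>x. C m x \<partial>\<mu> (r n)) \<le> (\<integral>x. C (r n) x \<partial>\<mu> (r n))"
      by (intro integral_mono unit_dist_integrable[OF \<mu>(1) C] incseqD[OF mono])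
    thus "(\<integral>x. C m x \<partial>\<mu> (r n)) \<le> 0" using \<mu>(3)[of "r n"] by simp
  qed
  ultimately show thesis using that \<nu> by blast
qed

section \<open>Compactification and regularised cost\<close>

text \<open>
  The one-point compactification as a sphere: \<open>emb\<close> is an inverse stereographic projection and
  the point at infinity is \<open>0\<close>.
\<close>

definition emb :: "'a::euclidean_space \<Rightarrow> 'a \<times> real" where
  "emb x = (x /\<^sub>R (1 + (norm x)\<^sup>2), 1 / (1 + (norm x)\<^sup>2))"

definition unemb :: "'a::euclidean_space \<times> real \<Rightarrow> 'a" where
  "unemb z = fst z /\<^sub>R snd z"

text \<open>The sphere of radius 1/2 about (0, 1/2); it passes through the origin and lies in the
  closed unit ball.\<close>

definition compactified :: "('a::euclidean_space \<times> real) set" where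
  "compactified = {z. (norm (fst z))\<^sup>2 + (snd z)\<^sup>2 = snd z}"

lemma one_plus_norm_pos: "0 < 1 + (norm x)\<^sup>2"
  by (simp add: add_pos_nonneg)

lemma snd_emb: "snd (emb x) = 1 / (1 + (norm x)\<^sup>2)"
  by (simp add: emb_def)

lemma snd_emb_pos: "0 < snd (emb x)"
  using one_plus_norm_pos[of x] by (simp add: snd_emb)

lemma snd_emb_le: "snd (emb x) \<le> 1"
  by (simp add: snd_emb divide_le_eq one_plus_norm_pos)

lemma unemb_emb: "unemb (emb x) = x"
  using one_plus_norm_pos[of x] by (simp add: unemb_def emb_def)

lemma emb_compactified: "emb x \<in> compactified"
proof -
  define a where "a = 1 + (norm x)\<^sup>2"
  have a: "a > 0" by (simp add: a_def one_plus_norm_pos)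
  have "(norm x / a)\<^sup>2 + (1 / a)\<^sup>2 = a / a\<^sup>2"
    by (simp add: power_divide a_def add_divide_distrib)
  also have "\<dots> = 1 / a" by (simp add: power2_eq_square)
  finally show ?thesis
    using a by (simp add: compactified_def emb_def divide_inverse mult.commute flip: a_def)
qed

lemma zero_compactified: "0 \<in> compactified"
  by (simp add: compactified_def)

lemma emb_unemb:
  assumes "z \<in> compactified" "snd z \<noteq> 0"
  shows "emb (unemb z) = z"
proof -
  obtain u s where z: "z = (u, s)" by (cases z)
  from assms have s: "(norm u)\<^sup>2 = s - s\<^sup>2" "s \<noteq> 0" by (auto simp: z compactified_def)
  have "1 + (norm u / \<bar>s\<bar>)\<^sup>2 = 1 / s"
    using s by (simp add: power_divide field_simps power2_eq_square)
  thus ?thesis using s(2)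
    by (simp add: emb_def unemb_def z divide_inverse mult.commute)
qed

lemma norm_compactified_le:
  assumes "z \<in> compactified"
  shows "norm z \<le> 1"
proof -
  from assms have s: "(norm (fst z))\<^sup>2 + (snd z)\<^sup>2 = snd z" by (simp add: compactified_def)
  have "(snd z)\<^sup>2 \<le> snd z" using s zero_le_power2[of "norm (fst z)"] by linarith
  have "snd z \<le> 1"
  proof (rule ccontr)
    assume "\<not> ?thesis"
    hence "1 * snd z < snd z * snd z" by (intro mult_strict_right_mono) auto
    thus False using \<open>(snd z)\<^sup>2 \<le> snd z\<close> by (simp add: power2_eq_square)
  qed
  moreover have "(norm z)\<^sup>2 = (norm (fst z))\<^sup>2 + (snd z)\<^sup>2" by (simp add: norm_prod_def)
  ultimately show ?thesis using s by (intro power2_le_imp_le[of "norm z" 1]) simp_all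
qed

lemma closed_compactified: "closed compactified"
  unfolding compactified_def by (intro closed_Collect_eq continuous_intros)

text \<open>The two square roots are the conformal factors of the stereographic projection at x and
  y. Since \<open>snd (emb x)\<close> is the inverse square of the factor at x, the Coulomb kernel
  can be expressed on the sphere.\<close>

lemma norm_emb_diff:
  "norm (emb x - emb y) = norm (x - y) / (sqrt (1 + (norm x)\<^sup>2) * sqrt (1 + (norm y)\<^sup>2))"
proof -
  define a b where "a = 1 + (norm x)\<^sup>2" and "b = 1 + (norm y)\<^sup>2"
  have ab: "a > 0" "b > 0" unfolding a_def b_def by (rule one_plus_norm_pos)+
  have xy: "x \<bullet> x = a - 1" "y \<bullet> y = b - 1"
    by (simp_all add: a_def b_def power2_norm_eq_inner)
  have "(norm (emb x - emb y))\<^sup>2 = (x /\<^sub>R a - y /\<^sub>R b) \<bullet> (x /\<^sub>R a - y /\<^sub>R b) + (1 / a - 1 / b)\<^sup>2"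
    by (simp add: emb_def norm_prod_def a_def b_def power2_norm_eq_inner)
  also have "\<dots> = ((x - y) \<bullet> (x - y)) / (a * b)"
    using ab by (simp add: inner_diff_left inner_diff_right inner_commute[of y x] xy field_simps
        power2_eq_square)
  also have "\<dots> = (norm (x - y) / (sqrt a * sqrt b))\<^sup>2"
    using ab by (simp add: power_divide power_mult_distrib power2_norm_eq_inner)
  finally show ?thesis
    using ab by (simp add: a_def b_def)
qed

lemma continuous_on_emb: "continuous_on A emb"
proof -
  have "1 + (norm x)\<^sup>2 \<noteq> 0" for x :: 'a using one_plus_norm_pos[of x] by simp
  thus ?thesis unfolding emb_def by (intro continuous_intros) auto
qed

lemma emb_at_infinity: "(emb \<longlongrightarrow> 0) at_infinity"
proof (rule Lim_null_comparison)
  have n: "norm (emb x) = 1 / sqrt (1 + (norm x)\<^sup>2)" for x :: 'a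
  proof -
    have "norm (emb x) = sqrt (snd (emb x))"
      using emb_compactified[of x] by (simp add: compactified_def norm_prod_def)
    thus ?thesis by (simp add: snd_emb real_sqrt_divide)
  qed
  show "\<forall>\<^sub>F x in at_infinity. norm (emb x) \<le> 1 / norm (x :: 'a)"
    unfolding eventually_at_infinity n
  proof (intro exI[of _ 1] allI impI)
    fix x :: 'a assume x: "1 \<le> norm x"
    have "norm x \<le> sqrt (1 + (norm x)\<^sup>2)" by (rule real_le_rsqrt) simp
    moreover have "0 < norm x" using x by linarith
    ultimately show "1 / sqrt (1 + (norm x)\<^sup>2) \<le> 1 / norm x"
      by (intro divide_left_mono mult_pos_pos) (auto simp: one_plus_norm_pos)
  qed
  show "((\<lambda>x :: 'a. 1 / norm x) \<longlongrightarrow> 0) at_infinity"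
    by (rule real_tendsto_divide_at_top[OF tendsto_const filterlim_norm_at_top])
qed

text \<open>On the sphere 1 / |x - y| reads sqrt (snd z) * sqrt (snd z') / |z - z'|, which vanishes
  as soon as one of two distinct points is at infinity. Truncating the denominator at 1 / (m + 1)
  removes the singularity, and clamping \<open>snd\<close> to [0, 1] gives a bounded continuous
  function off the sphere too.\<close>

definition regularized :: "nat \<Rightarrow> 'a::euclidean_space \<times> real \<Rightarrow> 'a \<times> real \<Rightarrow> real" where
  "regularized m z z' =
     sqrt (max 0 (min 1 (snd z))) * sqrt (max 0 (min 1 (snd z'))) / max (norm (z - z')) (1 / real (Suc m))"

lemma max_norm_pos: "0 < max a (1 / real (Suc m))"
  by (simp add: less_max_iff_disj)

lemma regularized_nonneg: "0 \<le> regularized m z z'"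
  unfolding regularized_def by (intro divide_nonneg_pos mult_nonneg_nonneg max_norm_pos) auto

lemma regularized_le: "regularized m z z' \<le> real (Suc m)"
proof -
  have "regularized m z z' \<le> (1 * 1) / (1 / real (Suc m))"
    unfolding regularized_def by (intro frac_le mult_mono) auto
  thus ?thesis by simp
qed

lemma incseq_regularized: "incseq (\<lambda>m. regularized m z z')"
  unfolding regularized_def
  by (intro incseq_SucI divide_left_mono mult_pos_pos max_norm_pos max.mono frac_le) auto

lemma continuous_on_regularized:
  assumes "continuous_on A f" "continuous_on A g"
  shows "continuous_on A (\<lambda>t. regularized m (f t) (g t))"
  unfolding regularized_def using max_norm_pos[of _ m]
  by (intro continuous_intros assms) (metis less_irrefl)

lemma regularized_emb:
  "regularized m (emb x) (emb y) =
     1 / max (norm (x - y)) (sqrt (1 + (norm x)\<^sup>2) * sqrt (1 + (norm y)\<^sup>2) / real (Suc m))"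
proof -
  define a b where "a = sqrt (1 + (norm x)\<^sup>2)" and "b = sqrt (1 + (norm y)\<^sup>2)"
  have ab: "a > 0" "b > 0" by (simp_all add: a_def b_def one_plus_norm_pos)
  have r: "sqrt (max 0 (min 1 (snd (emb x)))) = 1 / sqrt (1 + (norm x)\<^sup>2)" for x :: 'a
    using snd_emb_pos[of x] snd_emb_le[of x] by (simp add: snd_emb real_sqrt_divide)
  have "regularized m (emb x) (emb y) = 1 / (a * b * max (norm (x - y) / (a * b)) (1 / real (Suc m)))"
    by (simp add: regularized_def r norm_emb_diff a_def b_def)
  also have "a * b * max (norm (x - y) / (a * b)) (1 / real (Suc m)) =
      max (norm (x - y)) (a * b / real (Suc m))"
    using ab by (simp add: max_mult_distrib_left)
  finally show ?thesis by (simp add: a_def b_def)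
qed

lemma regularized_emb_le: "ennreal (regularized m (emb x) (emb y)) \<le> 1 / ennreal (norm (x - y))"
proof (cases "x = y")
  case False
  hence "1 / max (norm (x - y)) (sqrt (1 + (norm x)\<^sup>2) * sqrt (1 + (norm y)\<^sup>2) / real (Suc m))
     \<le> 1 / norm (x - y)"
    by (intro divide_left_mono) (auto simp: less_max_iff_disj)
  moreover have "1 / ennreal (norm (x - y)) = ennreal (1 / norm (x - y))"
    using divide_ennreal[of 1 "norm (x - y)"] False by simp
  ultimately show ?thesis unfolding regularized_emb by (simp only: ennreal_leI)
qed (simp add: ennreal_divide_zero)

lemma SUP_regularized_emb:
  "(SUP m. ennreal (regularized m (emb x) (emb y))) = 1 / ennreal (norm (x - y))"
proof (rule LIMSEQ_unique[OF LIMSEQ_SUP])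
  show "incseq (\<lambda>m. ennreal (regularized m (emb x) (emb y)))"
    using incseq_regularized[of "emb x" "emb y"] by (auto simp: incseq_def intro!: ennreal_leI)
  define q where "q = sqrt (1 + (norm x)\<^sup>2) * sqrt (1 + (norm y)\<^sup>2)"
  have q: "q > 0" unfolding q_def by (intro mult_pos_pos) (simp_all add: one_plus_norm_pos)
  show "(\<lambda>m. ennreal (regularized m (emb x) (emb y))) \<longlonglongrightarrow> 1 / ennreal (norm (x - y))"
  proof (cases "x = y")
    case True
    \<comment> \<open>Coinciding points: the truncated kernel is (m + 1) / q, which diverges as the
      convention 1 / 0 = \<infinity> demands.\<close>
    have "filterlim (\<lambda>m. (1 / q) * real (Suc m)) at_top sequentially"
      using q by (intro filterlim_tendsto_pos_mult_at_top[OF tendsto_const]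
          filterlim_compose[OF filterlim_real_sequentially filterlim_Suc]) auto
    hence "(\<lambda>m. ennreal ((1 / q) * real (Suc m))) \<longlonglongrightarrow> top"
      by (rule ennreal_tendsto_top_eq_at_top[THEN iffD2])
    moreover have "regularized m (emb x) (emb y) = (1 / q) * real (Suc m)" for m
      unfolding regularized_emb q_def[symmetric] using True q by simp
    ultimately show ?thesis using True by (simp add: ennreal_divide_zero)
  next
    case False
    have "(\<lambda>m. q / real (Suc m)) \<longlonglongrightarrow> 0"
      by (rule real_tendsto_divide_at_top[OF tendsto_const
          filterlim_compose[OF filterlim_real_sequentially filterlim_Suc]])
    hence "(\<lambda>m. 1 / max (norm (x - y)) (q / real (Suc m))) \<longlonglongrightarrow> 1 / max (norm (x - y)) 0"
      using False by (intro tendsto_intros) auto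
    hence "(\<lambda>m. ennreal (regularized m (emb x) (emb y))) \<longlonglongrightarrow> ennreal (1 / norm (x - y))"
      unfolding regularized_emb q_def[symmetric] by (intro tendsto_ennrealI) simp
    moreover have "1 / ennreal (norm (x - y)) = ennreal (1 / norm (x - y))"
      using divide_ennreal[of 1 "norm (x - y)"] False by simp
    ultimately show ?thesis by simp
  qed
qed

section \<open>Energies of configurations on the sphere\<close>

definition off_diag :: "nat set \<Rightarrow> (nat \<times> nat) set" where
  "off_diag S = {(i, j). i \<in> S \<and> j \<in> S \<and> i \<noteq> j}"

lemma finite_off_diag: "finite S \<Longrightarrow> finite (off_diag S)"
  by (rule finite_subset[of _ "S \<times> S"]) (auto simp: off_diag_def)

text \<open>Ordered pairs count each interaction twice, but their index set is invariant under
  relabelling of the points, unlike the pairs with i < j. Later the finite points of a configuration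
  are listed in shifted orders.\<close>

lemma coulomb_off_diag:
  "2 * coulomb k x = (\<Sum>(i, j)\<in>off_diag {1..k}. 1 / ennreal (norm (x i - x j)))"
proof -
  define U where "U = {(i, j). 1 \<le> i \<and> i < j \<and> j \<le> k}"
  let ?f = "\<lambda>(i, j). 1 / ennreal (norm (x i - x j))"
  have fin: "finite U" by (rule finite_subset[of _ "{1..k} \<times> {1..k}"]) (auto simp: U_def)
  have "off_diag {1..k} = U \<union> prod.swap ` U"
    by (auto simp: off_diag_def U_def image_iff)
  moreover have "U \<inter> prod.swap ` U = {}" by (auto simp: U_def)
  ultimately have "sum ?f (off_diag {1..k}) = sum ?f U + sum ?f (prod.swap ` U)"
    using fin by (simp add: sum.union_disjoint)
  also have "sum ?f (prod.swap ` U) = sum ?f U"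
    by (subst sum.reindex) (auto simp: inj_on_def split_beta norm_minus_commute intro!: sum.cong)
  finally show ?thesis
    by (simp add: coulomb_def U_def mult_2)
qed

definition regularized_cost :: "nat \<Rightarrow> nat \<Rightarrow> (nat \<Rightarrow> 'a::euclidean_space \<times> real) \<Rightarrow> real" where
  "regularized_cost N m z = (\<Sum>(i, j)\<in>off_diag {1..N}. regularized m (z i) (z j)) / 2"

lemma regularized_cost_nonneg: "0 \<le> regularized_cost N m z"
  unfolding regularized_cost_def by (intro divide_nonneg_pos sum_nonneg) (auto simp: regularized_nonneg)

lemma regularized_cost_le:
  "regularized_cost N m z \<le> real (card (off_diag {1..N})) * real (Suc m) / 2"
  unfolding regularized_cost_def
  by (intro divide_right_mono sum_bounded_above) (auto simp: regularized_le simp del: of_nat_Suc)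

lemma incseq_regularized_cost: "incseq (\<lambda>m. regularized_cost N m z)"
  unfolding regularized_cost_def split_beta
  by (intro incseq_SucI divide_right_mono sum_mono incseq_SucD[OF incseq_regularized]) simp

lemma continuous_on_regularized_cost:
  assumes "\<And>i. continuous_on A (Z i)"
  shows "continuous_on A (\<lambda>t. regularized_cost N m (\<lambda>i. Z i t))"
  unfolding regularized_cost_def split_beta
  by (intro continuous_intros continuous_on_regularized assms) auto

lemma ennreal_regularized_cost:
  "2 * ennreal (regularized_cost N m z) =
     (\<Sum>(i, j)\<in>off_diag {1..N}. ennreal (regularized m (z i) (z j)))"
proof -
  have "2 * ennreal (regularized_cost N m z) = ennreal (2 * regularized_cost N m z)"
    using regularized_cost_nonneg[of N m z] by (simp add: ennreal_mult)
  also have "\<dots> = (\<Sum>(i, j)\<in>off_diag {1..N}. ennreal (regularized m (z i) (z j)))"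
    by (simp add: regularized_cost_def split_beta sum_ennreal regularized_nonneg)
  finally show ?thesis .
qed

lemma regularized_cost_emb_le: "ennreal (regularized_cost N m (\<lambda>i. emb (x i))) \<le> coulomb N x"
proof -
  have "2 * ennreal (regularized_cost N m (\<lambda>i. emb (x i))) \<le> 2 * coulomb N x"
    unfolding ennreal_regularized_cost coulomb_off_diag
    by (intro sum_mono) (auto simp: regularized_emb_le)
  thus ?thesis by (subst (asm) ennreal_mult_le_mult_iff) auto
qed

text \<open>\<open>h\<close> lists the finite points of a configuration. The pairs inside
  \<open>S\<close> account for the whole Coulomb energy of the list, and the remaining pairs add
  only nonnegative terms.\<close>

lemma coulomb_le_SUP_regularized_cost:
  assumes h: "bij_betw h {1..k} S" and S: "S \<subseteq> {1..N}"
    and z: "\<And>i. i \<in> S \<Longrightarrow> z i \<in> compactified \<and> snd (z i) \<noteq> 0"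
  shows "coulomb k (\<lambda>i. unemb (z (h i))) \<le> (SUP m. ennreal (regularized_cost N m z))"
proof -
  let ?g = "\<lambda>(i, j). SUP m. ennreal (regularized m (z i) (z j))"
  have bij: "bij_betw (map_prod h h) (off_diag {1..k}) (off_diag S)"
  proof -
    note inj = bij_betw_imp_inj_on[OF h]
    have "inj_on (map_prod h h) (off_diag {1..k})"
      by (rule inj_on_subset[OF map_prod_inj_on[OF inj inj]]) (auto simp: off_diag_def)
    moreover have "map_prod h h ` off_diag {1..k} = off_diag S"
    proof (intro equalityI subsetI)
      fix p assume "p \<in> map_prod h h ` off_diag {1..k}"
      then obtain i j where "p = (h i, h j)" "i \<in> {1..k}" "j \<in> {1..k}" "i \<noteq> j"
        by (auto simp: off_diag_def)
      thus "p \<in> off_diag S"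
        using inj_onD[OF inj, of i j] bij_betw_apply[OF h] by (auto simp: off_diag_def)
    next
      fix p assume "p \<in> off_diag S"
      then obtain a b where p: "p = (a, b)" "a \<in> S" "b \<in> S" "a \<noteq> b" by (auto simp: off_diag_def)
      then obtain i j where "i \<in> {1..k}" "j \<in> {1..k}" "a = h i" "b = h j"
        using bij_betw_imp_surj_on[OF h] by blast
      with p show "p \<in> map_prod h h ` off_diag {1..k}"
        by (intro image_eqI[of _ _ "(i, j)"]) (auto simp: off_diag_def)
    qed
    ultimately show ?thesis by (simp add: bij_betw_def)
  qed
  have "2 * coulomb k (\<lambda>i. unemb (z (h i))) = (\<Sum>p\<in>off_diag {1..k}. ?g (map_prod h h p))"
    unfolding coulomb_off_diag
  proof (intro sum.cong refl, clarify)
    fix i j assume "(i, j) \<in> off_diag {1..k}"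
    hence "h i \<in> S" "h j \<in> S" using bij_betw_apply[OF h] by (auto simp: off_diag_def)
    hence "emb (unemb (z (h i))) = z (h i)" "emb (unemb (z (h j))) = z (h j)"
      using z by (auto intro!: emb_unemb)
    thus "1 / ennreal (norm (unemb (z (h i)) - unemb (z (h j)))) = ?g (map_prod h h (i, j))"
      using SUP_regularized_emb[of "unemb (z (h i))" "unemb (z (h j))"] by simp
  qed
  also have "\<dots> = sum ?g (off_diag S)" by (rule sum.reindex_bij_betw[OF bij])
  also have "\<dots> \<le> sum ?g (off_diag {1..N})"
    using S by (intro sum_mono2 finite_off_diag) (auto simp: off_diag_def)
  also have "\<dots> = (SUP m. \<Sum>(i, j)\<in>off_diag {1..N}. ennreal (regularized m (z i) (z j)))"
    unfolding split_beta
    by (rule ennreal_SUP_sum[symmetric])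
       (intro incseq_SucI ennreal_leI incseq_SucD[OF incseq_regularized])
  also have "\<dots> = 2 * (SUP m. ennreal (regularized_cost N m z))"
    unfolding ennreal_regularized_cost[symmetric] by (rule SUP_mult_left_ennreal[symmetric])
  finally show ?thesis by (subst (asm) ennreal_mult_le_mult_iff) auto
qed

section \<open>Dual bounds give couplings\<close>

lemma countable_Int_stable_generator:
  obtains G :: "'a::second_countable_topology set set"
  where "countable G" "\<And>U. U \<in> G \<Longrightarrow> open U" "Int_stable G" "sets borel = sigma_sets UNIV G"
proof -
  obtain B :: "'a set set" where B: "countable B" "topological_basis B"
    using ex_countable_basis by blast
  define G where "G = Inter ` {S. finite S \<and> S \<subseteq> B}"
  have "countable G"
    unfolding G_def by (intro countable_image countable_Collect_finite_subset B)
  moreover have op: "open U" if "U \<in> G" for U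
    using that topological_basis_open[OF B(2)] by (auto simp: G_def intro!: open_Inter)
  moreover have "Int_stable G"
  proof (rule Int_stableI)
    fix a b assume "a \<in> G" "b \<in> G"
    then obtain S T where "a = \<Inter>S" "b = \<Inter>T" "finite S" "finite T" "S \<subseteq> B" "T \<subseteq> B"
      by (auto simp: G_def)
    thus "a \<inter> b \<in> G"
      unfolding G_def by (intro image_eqI[of _ _ "S \<union> T"]) auto
  qed
  moreover have "sets borel = sigma_sets UNIV G"
  proof (rule equalityI)
    have "B \<subseteq> G" unfolding G_def by (auto intro!: image_eqI[of _ Inter "{_}"])
    moreover have "sets borel = sigma_sets UNIV B"
      by (subst borel_eq_countable_basis[OF B]) simp
    ultimately show "sets borel \<subseteq> sigma_sets UNIV G"
      by (simp add: sigma_sets_mono')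
    have "G \<subseteq> sets borel" using op by auto
    thus "sigma_sets UNIV G \<subseteq> sets borel"
      using sets.sigma_sets_subset[of G borel] by simp
  qed
  ultimately show thesis using that by blast
qed

text \<open>Dynkin's argument for a signed combination: the sets where it vanishes are closed under
  complements because its total vanishes, and under countable disjoint unions because the measures
  are finite. The marginal constraint compares several measures at once, with coefficients of both
  signs.\<close>

lemma signed_combination_eq_zero:
  fixes \<mu> :: "'i \<Rightarrow> 'a::topological_space measure" and c :: "'i \<Rightarrow> real"
  assumes I: "finite I" and fin: "\<And>i. i \<in> I \<Longrightarrow> finite_measure (\<mu> i)"
    and sets: "\<And>i. i \<in> I \<Longrightarrow> sets (\<mu> i) = sets borel"
    and G: "Int_stable G" "sets borel = sigma_sets UNIV G"
    and zero: "\<And>U. U \<in> insert UNIV G \<Longrightarrow> (\<Sum>i\<in>I. c i * measure (\<mu> i) U) = 0"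
    and A: "A \<in> sets borel"
  shows "(\<Sum>i\<in>I. c i * measure (\<mu> i) A) = 0"
proof -
  have "G \<subseteq> Pow UNIV" by simp
  from G(1) this A[unfolded G(2)] show ?thesis
  proof (induction rule: sigma_sets_induct_disjoint)
    case (basic A)
    thus ?case using zero by blast
  next
    case (compl A)
    hence "A \<in> sets borel" using G(2) by simp
    hence "measure (\<mu> i) (UNIV - A) = measure (\<mu> i) UNIV - measure (\<mu> i) A" if "i \<in> I" for i
      using finite_measure.finite_measure_compl[OF fin[OF that], of A] sets[OF that]
        sets_eq_imp_space_eq[OF sets[OF that]] by simp
    hence "(\<Sum>i\<in>I. c i * measure (\<mu> i) (UNIV - A)) =
        (\<Sum>i\<in>I. c i * measure (\<mu> i) UNIV) - (\<Sum>i\<in>I. c i * measure (\<mu> i) A)"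
      by (simp add: right_diff_distrib sum_subtractf)
    thus ?case using zero[of UNIV] compl by simp
  next
    case (union A)
    have "(\<lambda>n. \<Sum>i\<in>I. c i * measure (\<mu> i) (A n)) sums (\<Sum>i\<in>I. c i * measure (\<mu> i) (\<Union>n. A n))"
    proof (intro sums_sum sums_mult)
      fix i assume i: "i \<in> I"
      show "(\<lambda>n. measure (\<mu> i) (A n)) sums measure (\<mu> i) (\<Union>n. A n)"
        using union sets[OF i] G(2)
        by (intro finite_measure.finite_measure_UNION[OF fin[OF i]]) auto
    qed
    with union show ?case using sums_unique2[OF _ sums_zero] by simp
  qed simp
qed

text \<open>The integrands increase to the indicator of \<open>U\<close>. The whole space is
  excluded because the distance to the empty set is 0 by convention, so that the integrands would
  vanish.\<close>

lemma measure_open_eq_lim_integral: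
  fixes U :: "'a::metric_space set"
  assumes "finite_measure \<mu>" "sets \<mu> = sets borel" "open U" "U \<noteq> UNIV"
  shows "(\<lambda>n. \<integral>x. min 1 (real n * infdist x (- U)) \<partial>\<mu>) \<longlonglongrightarrow> measure \<mu> U"
proof -
  interpret finite_measure \<mu> by fact
  note [measurable_cong] = assms(2)
  have [measurable]: "U \<in> sets borel" using assms by simp
  have sp: "space \<mu> = UNIV" using sets_eq_imp_space_eq[OF assms(2)] by simp
  have "(\<lambda>n. \<integral>x. min 1 (real n * infdist x (- U)) \<partial>\<mu>) \<longlonglongrightarrow> (\<integral>x. indicator U x \<partial>\<mu>)"
  proof (rule integral_dominated_convergence[where w = "\<lambda>_. 1"])
    show "AE x in \<mu>. (\<lambda>n. min 1 (real n * infdist x (- U))) \<longlonglongrightarrow> indicator U x"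
    proof (intro AE_I2)
      fix x
      show "(\<lambda>n. min 1 (real n * infdist x (- U))) \<longlonglongrightarrow> indicator U x"
      proof (cases "x \<in> U")
        case True
        hence pos: "infdist x (- U) > 0"
          using in_closed_iff_infdist_zero[of "- U" x] assms infdist_nonneg[of x "- U"]
          by (auto simp: closed_Compl less_le)
        obtain n0 :: nat where n0: "1 / infdist x (- U) \<le> real n0"
          using real_arch_simple by blast
        have "min 1 (real n * infdist x (- U)) = 1" if "n \<ge> n0" for n
        proof -
          have "1 / infdist x (- U) \<le> real n" using n0 that by linarith
          thus ?thesis using pos by (simp add: field_simps)
        qed
        thus ?thesis using True
          by (intro tendsto_eventually eventually_mono[OF eventually_ge_at_top[of n0]]) auto
      qed simp
    qed
    have "continuous_on UNIV (\<lambda>x. min 1 (real n * infdist x (- U)))" for n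
      by (intro continuous_intros)
    thus "(\<lambda>x. min 1 (real n * infdist x (- U))) \<in> borel_measurable \<mu>" for n
      unfolding measurable_cong_sets[OF assms(2) refl]
      by (intro borel_measurable_continuous_onI)
  qed (auto simp: infdist_nonneg)
  thus ?thesis by (simp add: sp)
qed

lemma determining_sequence:
  obtains f :: "nat \<Rightarrow> 'a::{metric_space, second_countable_topology} \<Rightarrow> real"
  where "\<And>j. continuous_on UNIV (f j)" "\<And>j x. 0 \<le> f j x" "\<And>j x. f j x \<le> 1"
    "\<forall>(I :: nat set) c \<mu> A. finite I \<longrightarrow> (\<forall>i\<in>I. finite_measure (\<mu> i)) \<longrightarrow>
       (\<forall>i\<in>I. sets (\<mu> i) = sets borel) \<longrightarrow>
       (\<forall>j. (\<Sum>i\<in>I. c i * (\<integral>x. f j x \<partial>\<mu> i)) = 0) \<longrightarrow> A \<in> sets borel \<longrightarrow>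
       (\<Sum>i\<in>I. c i * measure (\<mu> i) A) = 0"
proof -
  obtain G :: "'a set set"
    where G: "countable G" "\<And>U. U \<in> G \<Longrightarrow> open U" "Int_stable G" "sets borel = sigma_sets UNIV G"
    by (rule countable_Int_stable_generator) (rule that)
  \<comment> \<open>Index 0 holds the constant 1, which controls the total mass; the other indices
    run through all pairs of a generating open set and an approximation step.\<close>
  define f :: "nat \<Rightarrow> 'a \<Rightarrow> real" where
    "f j = (case j of 0 \<Rightarrow> (\<lambda>_. 1) | Suc k \<Rightarrow> (case prod_decode k of (a, n) \<Rightarrow>
      (\<lambda>x. min 1 (real n * infdist x (- from_nat_into G a)))))" for j
  have f: "f 0 = (\<lambda>_. 1)"
    "f (Suc (prod_encode (a, n))) = (\<lambda>x. min 1 (real n * infdist x (- from_nat_into G a)))" for a n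
    by (simp_all add: f_def)
  have f_cases: "f j = (\<lambda>_. 1) \<or> (\<exists>n U. f j = (\<lambda>x. min 1 (real n * infdist x U)))" for j
    unfolding f_def by (auto split: nat.split prod.split)
  have cont: "continuous_on UNIV (f j)" for j
  proof -
    have "continuous_on UNIV (\<lambda>x. min 1 (real n * infdist x U))" for n and U :: "'a set"
      by (intro continuous_intros)
    thus ?thesis using f_cases[of j] by auto
  qed
  moreover have "0 \<le> f j x" "f j x \<le> 1" for j x
    using f_cases[of j] by (auto simp: infdist_nonneg)
  moreover have "(\<Sum>i\<in>I. c i * measure (\<mu> i) A) = 0"
    if I: "finite I" "\<And>i. i \<in> I \<Longrightarrow> finite_measure (\<mu> i)" "\<And>i. i \<in> I \<Longrightarrow> sets (\<mu> i) = sets borel"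
      and eq: "\<And>j. (\<Sum>i\<in>I. c i * (\<integral>x. f j x \<partial>\<mu> i)) = 0" and A: "A \<in> sets borel"
    for I :: "nat set" and c \<mu> A
  proof (rule signed_combination_eq_zero[OF I G(3,4) _ A])
    fix U assume U: "U \<in> insert UNIV G"
    show "(\<Sum>i\<in>I. c i * measure (\<mu> i) U) = 0"
    proof (cases "U = UNIV")
      case True
      have "(\<integral>x. f 0 x \<partial>\<mu> i) = measure (\<mu> i) UNIV" if "i \<in> I" for i
        using sets_eq_imp_space_eq[OF I(3)[OF that]] by (simp add: f)
      thus ?thesis using eq[of 0] True by (simp cong: sum.cong)
    next
      case False
      hence UG: "U \<in> G" using U by simp
      obtain a where a: "from_nat_into G a = U" using from_nat_into_surj[OF G(1) UG] by blast
      have "(\<lambda>n. \<Sum>i\<in>I. c i * (\<integral>x. min 1 (real n * infdist x (- U)) \<partial>\<mu> i))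
          \<longlonglongrightarrow> (\<Sum>i\<in>I. c i * measure (\<mu> i) U)"
        by (intro tendsto_sum tendsto_mult tendsto_const measure_open_eq_lim_integral I G(2) UG False)
      moreover have "(\<Sum>i\<in>I. c i * (\<integral>x. min 1 (real n * infdist x (- U)) \<partial>\<mu> i)) = 0" for n
        using eq[of "Suc (prod_encode (a, n))"] by (simp add: f a)
      ultimately show ?thesis by (simp add: LIMSEQ_const_iff)
    qed
  qed
  ultimately show thesis by (intro that[of f] allI impI) auto
qed

section \<open>Encoding sequences of vectors by one real parameter\<close>

definition peano_vec :: "nat \<Rightarrow> real \<Rightarrow> 'a::euclidean_space" where
  "peano_vec i t = (\<Sum>b\<in>Basis. (2 * peano (prod_encode (i, to_nat_on Basis b)) t - 1) *\<^sub>R b)"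

lemma continuous_on_peano_vec: "continuous_on UNIV (peano_vec i)"
  unfolding peano_vec_def by (intro continuous_intros continuous_on_peano)

text \<open>Each component of each vector owns a coordinate of the curve, rescaled from [0, 1] to
  [-1, 1], so a single parameter reaches all vectors at once.\<close>

lemma peano_vec_surj:
  fixes z :: "nat \<Rightarrow> 'a::euclidean_space"
  assumes "\<And>i. norm (z i) \<le> 1"
  shows "\<exists>t\<in>{0..1}. \<forall>i. peano_vec i t = z i"
proof -
  define y where "y n = (case prod_decode n of (i, k) \<Rightarrow> (z i \<bullet> from_nat_into Basis k + 1) / 2)" for n
  have "\<bar>z i \<bullet> b\<bar> \<le> 1" if "b \<in> Basis" for i b
    using Basis_le_norm[OF that, of "z i"] assms[of i] by linarith
  hence "\<bar>z i \<bullet> from_nat_into Basis k\<bar> \<le> 1" for i k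
    by (simp add: from_nat_into)
  hence "0 \<le> y n \<and> y n \<le> 1" for n
    unfolding y_def by (auto simp: abs_le_iff split: prod.split) (smt (verit))+
  then obtain t where t: "t \<in> {0..1}" "\<And>n. peano n t = y n"
    using peano_surj[of y] by auto
  have "peano_vec i t = (\<Sum>b\<in>Basis. (z i \<bullet> b) *\<^sub>R b)" for i
    unfolding peano_vec_def t(2) y_def by (intro sum.cong) (auto simp: countable_finite field_simps)
  thus ?thesis using t(1) unfolding euclidean_representation by blast
qed

text \<open>The prescribed average of the N marginals is the image of \<rho> on the sphere,
  completed to a probability measure by an atom of mass 1 - \<open>mass \<rho>\<close> at infinity.
  Averaging over the coordinates in the constraints matches the average of the potential over the
  points in \<open>M N\<close>.\<close>

lemma dual_bound_imp_coupling:
  fixes \<rho> :: "(real ^ 'd) measure"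
  assumes N: "N \<ge> 1" and \<rho>: "\<rho> \<in> subprob_measures"
    and dual: "\<And>\<phi>. \<phi> \<in> C0 \<Longrightarrow> dual N \<rho> \<phi> \<le> ereal V"
  obtains \<nu> and Z :: "nat \<Rightarrow> real \<Rightarrow> (real ^ 'd) \<times> real" where
    "real_distribution \<nu>" "\<And>i. continuous_on UNIV (Z i)"
    "\<And>A. A \<in> sets borel \<Longrightarrow> (\<Sum>i = 1..N. measure \<nu> (Z i -` A)) / real N =
       measure \<rho> (emb -` A) + (1 - mass \<rho>) * indicator A 0"
    "\<And>m. (\<integral>t. regularized_cost N m (\<lambda>i. Z i t) \<partial>\<nu>) \<le> V"
proof -
  have sets_\<rho>[measurable_cong]: "sets \<rho> = sets borel" using \<rho> by (simp add: subprob_measures_def)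
  have space_\<rho>: "space \<rho> = UNIV" using sets_eq_imp_space_eq[OF sets_\<rho>] by simp
  have em: "emeasure \<rho> UNIV \<le> 1" using \<rho> by (simp add: subprob_measures_def)
  interpret \<rho>: finite_measure \<rho>
    using em by (intro finite_measureI) (auto simp: space_\<rho> top_unique)
  have mass: "0 \<le> mass \<rho>" "mass \<rho> \<le> 1"
    using em by (auto simp: mass_def \<rho>.emeasure_eq_measure)
  have emb_meas[measurable]: "emb \<in> borel_measurable (borel :: (real ^ 'd) measure)"
    by (intro borel_measurable_continuous_onI continuous_on_emb)
  obtain f :: "nat \<Rightarrow> (real ^ 'd) \<times> real \<Rightarrow> real" where
    f: "\<And>j. continuous_on UNIV (f j)" "\<And>j x. 0 \<le> f j x" "\<And>j x. f j x \<le> 1"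
    and det: "\<forall>(I :: nat set) c \<mu> A. finite I \<longrightarrow> (\<forall>i\<in>I. finite_measure (\<mu> i)) \<longrightarrow>
       (\<forall>i\<in>I. sets (\<mu> i) = sets borel) \<longrightarrow>
       (\<forall>j. (\<Sum>i\<in>I. c i * (\<integral>x. f j x \<partial>\<mu> i)) = 0) \<longrightarrow> A \<in> sets borel \<longrightarrow>
       (\<Sum>i\<in>I. c i * measure (\<mu> i) A) = 0"
    by (rule determining_sequence) blast
  have [measurable]: "f j \<in> borel_measurable borel" for j
    by (intro borel_measurable_continuous_onI f)
  define Z :: "nat \<Rightarrow> real \<Rightarrow> (real ^ 'd) \<times> real" where "Z = peano_vec"
  have Z: "continuous_on UNIV (Z i)" for i unfolding Z_def by (rule continuous_on_peano_vec)
  have [measurable]: "Z i \<in> borel_measurable borel" for i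
    by (intro borel_measurable_continuous_onI Z)
  have fZ: "continuous_on UNIV (\<lambda>t. f j (Z i t))" for i j
    by (rule continuous_on_compose2[OF f(1) Z]) auto
  \<comment> \<open>Integration against the completed measure.\<close>
  define L where "L g = (\<integral>x. g (emb x) \<partial>\<rho>) + (1 - mass \<rho>) * g 0" for g
  have int_f: "integrable \<rho> (\<lambda>x. f j (emb x))" for j
    by (rule \<rho>.integrable_const_bound[of _ 1]) (use f in auto)
  define F where "F j t = (\<Sum>i = 1..N. f j (Z i t)) / real N - L (f j)" for j t
  define C where "C m t = regularized_cost N m (\<lambda>i. Z i t) - V" for m t
  have F_cont: "continuous_on UNIV (F j)" for j
    unfolding F_def by (intro continuous_intros fZ) (use N in auto)
  have F_bound: "\<bar>F j t\<bar> \<le> 1 + \<bar>L (f j)\<bar>" for j t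
  proof -
    have "0 \<le> (\<Sum>i = 1..N. f j (Z i t)) / real N" by (intro divide_nonneg_nonneg sum_nonneg f) simp
    moreover have "(\<Sum>i = 1..N. f j (Z i t)) \<le> real N"
      using sum_bounded_above[of "{1..N}" "\<lambda>i. f j (Z i t)" 1] f(3) by simp
    hence "(\<Sum>i = 1..N. f j (Z i t)) / real N \<le> 1" using N by simp
    ultimately show ?thesis unfolding F_def by linarith
  qed
  have C_cont: "continuous_on UNIV (C m)" for m
    unfolding C_def by (intro continuous_intros continuous_on_regularized_cost Z)
  have C_bound: "\<bar>C m t\<bar> \<le> real (card (off_diag {1..N})) * real (Suc m) / 2 + \<bar>V\<bar>" for m t
    using regularized_cost_nonneg[of N m "\<lambda>i. Z i t"] regularized_cost_le[of N m "\<lambda>i. Z i t"]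
    unfolding C_def by linarith
  have C_mono: "incseq (\<lambda>m. C m t)" for t
    using incseqD[OF incseq_regularized_cost] by (auto simp: C_def incseq_def)
  have feasible: "\<exists>\<nu>. unit_dist \<nu> \<and> (\<forall>j<n. (\<integral>x. F j x \<partial>\<nu>) = 0) \<and> (\<integral>x. C n x \<partial>\<nu>) \<le> 0" for n
  proof (rule ccontr)
    assume "\<not> ?thesis"
    moreover have "?thesis \<or>
      (\<exists>l s \<delta>. s \<ge> 0 \<and> \<delta> > 0 \<and> (\<forall>t\<in>{0..1}. (\<Sum>j<n. l j * F j t) + s * C n t \<ge> \<delta>))"
      by (rule moment_alternative[OF F_cont F_bound C_cont C_bound])
    ultimately have "\<exists>l s \<delta>. s \<ge> 0 \<and> \<delta> > 0 \<and>
        (\<forall>t\<in>{0..1}. (\<Sum>j<n. l j * F j t) + s * C n t \<ge> \<delta>)" by satx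
    then obtain l s \<delta> where s: "s \<ge> 0" "\<delta> > 0"
      and sep: "\<forall>t\<in>{0..1}. (\<Sum>j<n. l j * F j t) + s * C n t \<ge> \<delta>" by blast
    \<comment> \<open>The subtracted constants make \<open>L \<Phi>\<close> zero, whatever the
      multipliers are.\<close>
    define \<Phi> where "\<Phi> z = (\<Sum>j<n. l j * (f j z - L (f j)))" for z
    have \<Phi>_cont: "continuous_on UNIV \<Phi>" unfolding \<Phi>_def by (intro continuous_intros f)
    have int_\<Phi>: "integrable \<rho> (\<lambda>x. \<Phi> (emb x))"
      unfolding \<Phi>_def 
      by (intro Bochner_Integration.integrable_sum Bochner_Integration.integrable_mult_right
          Bochner_Integration.integrable_diff int_f) simp
    have L_\<Phi>: "L \<Phi> = 0"
    proof -
      have "(\<integral>x. \<Phi> (emb x) \<partial>\<rho>) = (\<Sum>j<n. l j * ((\<integral>x. f j (emb x) \<partial>\<rho>) - L (f j) * mass \<rho>))"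
        unfolding \<Phi>_def using int_f
        by (simp add: space_\<rho> mass_def mult.commute)
      thus ?thesis
        unfolding L_def \<Phi>_def by (simp add: sum_distrib_left sum.distrib[symmetric] algebra_simps)
    qed
    have sep_\<Phi>: "(\<Sum>i = 1..N. \<Phi> (z i)) / real N + s * (regularized_cost N n z - V) \<ge> \<delta>"
      if z: "\<And>i. z i \<in> compactified" for z
    proof -
      \<comment> \<open>The curve turns the inequality for parameters into one for arbitrary
        configurations on the sphere.\<close>
      obtain t where t: "t \<in> {0..1}" "\<And>i. Z i t = z i"
        using peano_vec_surj[of z] norm_compactified_le[OF z] unfolding Z_def by blast
      have "(\<Sum>i = 1..N. \<Phi> (z i)) / real N = (\<Sum>j<n. l j * F j t)"
      proof -
        have "(\<Sum>i = 1..N. \<Phi> (z i)) = (\<Sum>j<n. \<Sum>i = 1..N. l j * (f j (z i) - L (f j)))"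
          unfolding \<Phi>_def by (rule sum.swap)
        also have "\<dots> = (\<Sum>j<n. l j * F j t * real N)"
          using N by (intro sum.cong refl)
            (simp add: F_def t(2) sum_distrib_left[symmetric] sum_subtractf field_simps)
        finally show ?thesis using N by (simp add: sum_distrib_right[symmetric])
      qed
      thus ?thesis using bspec[OF sep t(1)] by (simp add: C_def t(2))
    qed
    show False
    proof (cases "s = 0")
      case True
      \<comment> \<open>Without a cost multiplier, configurations of N equal points show that \<Phi>
        is at least \<delta> on the whole sphere, against its mean zero.\<close>
      have "\<Phi> z \<ge> \<delta>" if "z \<in> compactified" for z
        using sep_\<Phi>[of "\<lambda>_. z"] that True N by simp
      hence \<Phi>: "\<Phi> (emb x) \<ge> \<delta>" "\<Phi> 0 \<ge> \<delta>" for x :: "real ^ 'd"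
        by (auto simp: emb_compactified zero_compactified)
      have "(\<integral>x. \<delta> \<partial>\<rho>) \<le> (\<integral>x. \<Phi> (emb x) \<partial>\<rho>)"
        by (intro integral_mono int_\<Phi> \<Phi>) simp
      hence "\<delta> * mass \<rho> \<le> (\<integral>x. \<Phi> (emb x) \<partial>\<rho>)" by (simp add: space_\<rho> mass_def mult.commute)
      moreover have "(1 - mass \<rho>) * \<delta> \<le> (1 - mass \<rho>) * \<Phi> 0"
        using mass \<Phi>(2) by (intro mult_left_mono) auto
      ultimately have "\<delta> \<le> L \<Phi>" by (simp add: L_def algebra_simps)
      thus False using L_\<Phi> s by simp
    next
      case False
      hence s0: "s > 0" using s by simp
      \<comment> \<open>Subtracting the value at infinity yields a function in \<open>C0\<close>,
        the division by s gives the cost coefficient 1, and the sign turns the lower bound for the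
        sum into an upper bound for \<open>M N \<psi>\<close>.\<close>
      define \<psi> where "\<psi> x = (\<Phi> 0 - \<Phi> (emb x)) / s" for x :: "real ^ 'd"
      have "\<psi> \<in> C0"
        unfolding C0_def
      proof (intro CollectI conjI)
        show "continuous_on UNIV \<psi>"
          unfolding \<psi>_def using s0
          by (intro continuous_intros continuous_on_compose2[OF \<Phi>_cont continuous_on_emb]) auto
        have "isCont \<Phi> 0" using \<Phi>_cont continuous_on_eq_continuous_at[OF open_UNIV, of \<Phi>] by blast
        hence "((\<lambda>x :: real ^ 'd. \<Phi> (emb x)) \<longlongrightarrow> \<Phi> 0) at_infinity"
          by (rule isCont_tendsto_compose[OF _ emb_at_infinity])
        hence "(\<psi> \<longlongrightarrow> (\<Phi> 0 - \<Phi> 0) / s) at_infinity"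
          unfolding \<psi>_def using s0 by (intro tendsto_intros) auto
        thus "(\<psi> \<longlongrightarrow> 0) at_infinity" by simp
      qed
      hence bound: "dual N \<rho> \<psi> \<le> ereal V" by (rule dual)
      have "M N \<psi> \<le> ereal (\<Phi> 0 / s - V - \<delta> / s)"
        unfolding M_def
      proof (rule SUP_least)
        fix x :: "nat \<Rightarrow> real ^ 'd"
        let ?c = "regularized_cost N n (\<lambda>i. emb (x i))"
        have "\<delta> \<le> (\<Sum>i = 1..N. \<Phi> (emb (x i))) / real N + s * (?c - V)"
          by (rule sep_\<Phi>) (rule emb_compactified)
        hence "\<delta> / s \<le> (\<Sum>i = 1..N. \<Phi> (emb (x i))) / real N / s + (?c - V)"
          using s0 by (simp add: field_simps)
        moreover have "1 / real N * (\<Sum>i = 1..N. \<psi> (x i)) =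
            \<Phi> 0 / s - (\<Sum>i = 1..N. \<Phi> (emb (x i))) / real N / s"
          unfolding \<psi>_def using N s0
          by (simp add: sum_subtractf sum_divide_distrib[symmetric] field_simps)
        ultimately have "1 / real N * (\<Sum>i = 1..N. \<psi> (x i)) \<le> \<Phi> 0 / s - V - \<delta> / s + ?c"
          by linarith
        hence "ereal (1 / real N * (\<Sum>i = 1..N. \<psi> (x i))) \<le> ereal (\<Phi> 0 / s - V - \<delta> / s) + ereal ?c"
          by simp
        also have "ereal ?c \<le> enn2ereal (coulomb N x)"
          using regularized_cost_emb_le[of N n x] regularized_cost_nonneg[of N n "\<lambda>i. emb (x i)"]
          by (simp add: less_eq_ennreal.rep_eq enn2ereal_ennreal)
        finally have "ereal (1 / real N * (\<Sum>i = 1..N. \<psi> (x i))) \<le>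
            ereal (\<Phi> 0 / s - V - \<delta> / s) + enn2ereal (coulomb N x)"
          by (simp add: add_left_mono)
        thus "ereal (1 / real N * (\<Sum>i = 1..N. \<psi> (x i))) - enn2ereal (coulomb N x) \<le>
            ereal (\<Phi> 0 / s - V - \<delta> / s)"
          by (cases "enn2ereal (coulomb N x)") (auto simp: algebra_simps)
      qed
      moreover have "(\<integral>x. \<psi> x \<partial>\<rho>) = \<Phi> 0 / s"
      proof -
        have "(\<integral>x. \<psi> x \<partial>\<rho>) = (\<Phi> 0 * mass \<rho> - (\<integral>x. \<Phi> (emb x) \<partial>\<rho>)) / s"
          unfolding \<psi>_def using int_\<Phi> by (simp add: space_\<rho> mass_def mult.commute)
        also have "(\<integral>x. \<Phi> (emb x) \<partial>\<rho>) = - ((1 - mass \<rho>) * \<Phi> 0)"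
          using L_\<Phi> by (simp add: L_def)
        finally show ?thesis by (simp add: algebra_simps)
      qed
      \<comment> \<open>The integral of \<psi> is \<open>\<Phi> 0 / s\<close> because
        \<open>L \<Phi>\<close> is zero, so the dual value is at least V + \<delta> / s.\<close>
      ultimately have "ereal (\<Phi> 0 / s) - ereal (\<Phi> 0 / s - V - \<delta> / s) \<le> dual N \<rho> \<psi>"
        unfolding dual_def by (intro ereal_minus_mono) auto
      with bound have "V + \<delta> / s \<le> V" by (cases "dual N \<rho> \<psi>") auto
      thus False using s s0 divide_pos_pos[of \<delta> s] by linarith
    qed
  qed
  obtain \<nu> where \<nu>: "unit_dist \<nu>" "\<And>j. (\<integral>x. F j x \<partial>\<nu>) = 0" "\<And>m. (\<integral>x. C m x \<partial>\<nu>) \<le> 0"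
    by (rule moment_limit[OF F_cont F_bound C_cont C_bound C_mono feasible]) (rule that)
  interpret \<nu>: real_distribution \<nu> using \<nu>(1) by (simp add: unit_dist_def)
  show thesis
  proof (rule that)
    show "real_distribution \<nu>" ..
    show "continuous_on UNIV (Z i)" for i by (rule Z)
    show "(\<integral>t. regularized_cost N m (\<lambda>i. Z i t) \<partial>\<nu>) \<le> V" for m
    proof -
      have "integrable \<nu> (\<lambda>t. C m t + V)"
        by (intro Bochner_Integration.integrable_add unit_dist_integrable[OF \<nu>(1) C_cont C_bound]) simp
      hence "(\<integral>t. C m t + V - V \<partial>\<nu>) = (\<integral>t. C m t + V \<partial>\<nu>) - V"
        using \<nu>.prob_space by (subst Bochner_Integration.integral_diff) auto
      thus ?thesis using \<nu>(3)[of m] by (simp add: C_def)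
    qed
    fix A :: "((real ^ 'd) \<times> real) set" assume A[measurable]: "A \<in> sets borel"
    \<comment> \<open>The identity of measures as one signed combination: index 0 is the image of
      \<rho>, the indices 1 to N are the marginals, and index N + 1 is the atom at infinity.\<close>
    define \<mu> where "\<mu> i = (if i = 0 then distr \<rho> borel emb else if i \<le> N then distr \<nu> borel (Z i)
      else return borel 0)" for i
    define c where "c i = (if i = 0 then - 1 else if i \<le> N then 1 / real N else mass \<rho> - 1)" for i
    have split: "(\<Sum>i\<in>{0..Suc N}. g i) = g 0 + (\<Sum>i = 1..N. g i) + g (Suc N)" for g :: "nat \<Rightarrow> real"
      by (simp add: sum.atLeast_Suc_atMost)
    have "(\<Sum>i\<in>{0..Suc N}. c i * measure (\<mu> i) A) = 0"
    proof (rule det[rule_format])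
      show "finite_measure (\<mu> i)" for i
        unfolding \<mu>_def
        by (auto intro!: \<rho>.finite_measure_distr \<nu>.finite_measure_distr
            prob_space.finite_measure[OF prob_space_return])
      show "sets (\<mu> i) = sets borel" for i by (simp add: \<mu>_def)
      fix j
      have int: "integrable \<nu> (\<lambda>t. f j (Z i t))" for i
        by (rule unit_dist_integrable[OF \<nu>(1) fZ, of _ _ 1]) (use f in auto)
      have "(\<integral>t. F j t \<partial>\<nu>) = (\<Sum>i = 1..N. \<integral>t. f j (Z i t) \<partial>\<nu>) / real N - L (f j)"
        unfolding F_def using int \<nu>.prob_space by (subst Bochner_Integration.integral_diff) auto
      hence "(\<Sum>i = 1..N. \<integral>t. f j (Z i t) \<partial>\<nu>) / real N = L (f j)" using \<nu>(2)[of j] by simp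
      moreover have "(\<Sum>i = 1..N. c i * (\<integral>x. f j x \<partial>\<mu> i)) =
          (\<Sum>i = 1..N. \<integral>t. f j (Z i t) \<partial>\<nu>) / real N"
        unfolding sum_divide_distrib by (intro sum.cong) (auto simp: c_def \<mu>_def integral_distr)
      moreover have "(\<integral>x. f j x \<partial>\<mu> 0) = (\<integral>x. f j (emb x) \<partial>\<rho>)"
        by (simp add: \<mu>_def integral_distr)
      moreover have "(\<integral>x. f j x \<partial>\<mu> (Suc N)) = f j 0"
        by (simp add: \<mu>_def integral_return)
      ultimately show "(\<Sum>i\<in>{0..Suc N}. c i * (\<integral>x. f j x \<partial>\<mu> i)) = 0"
        unfolding split L_def by (simp add: c_def algebra_simps)
    qed (use A in auto)
    moreover have "(\<Sum>i = 1..N. c i * measure (\<mu> i) A) = (\<Sum>i = 1..N. measure \<nu> (Z i -` A)) / real N"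
      unfolding sum_divide_distrib by (intro sum.cong) (auto simp: c_def \<mu>_def measure_distr)
    moreover have "measure (\<mu> 0) A = measure \<rho> (emb -` A)"
      by (simp add: \<mu>_def measure_distr space_\<rho>)
    moreover have "measure (\<mu> (Suc N)) A = indicator A 0"
      by (simp add: \<mu>_def measure_return)
    ultimately show "(\<Sum>i = 1..N. measure \<nu> (Z i -` A)) / real N =
        measure \<rho> (emb -` A) + (1 - mass \<rho>) * indicator A 0"
      unfolding split by (simp add: c_def algebra_simps)
  qed
qed

section \<open>From couplings to stratified plans\<close>

text \<open>The roles of i and s are symmetric. With the position i fixed, the shifts s visit every
  entry once, which equalises the marginals; with the shift fixed it is a relabelling, which
  preserves the cost.\<close>

lemma bij_betw_rotate:
  fixes i k :: nat
  assumes "k \<ge> 1"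
  shows "bij_betw (\<lambda>s. (i + s) mod k + 1) {1..k} {1..k}"
proof -
  have le: "s = s'"
    if "s \<le> s'" "s \<in> {1..k}" "s' \<in> {1..k}" "(i + s) mod k = (i + s') mod k" for s s'
  proof (rule ccontr)
    assume "s \<noteq> s'"
    have "k dvd (i + s') - (i + s)"
      using that by (subst mod_eq_dvd_iff_nat[symmetric]) auto
    hence "k dvd s' - s" by simp
    moreover have "0 < s' - s" "s' - s < k" using that \<open>s \<noteq> s'\<close> by auto
    ultimately show False using nat_dvd_not_less by blast
  qed
  have "inj_on (\<lambda>s. (i + s) mod k + 1) {1..k}"
  proof (rule inj_onI)
    fix s s' assume "s \<in> {1..k}" "s' \<in> {1..k}" "(i + s) mod k + 1 = (i + s') mod k + 1"
    thus "s = s'" using le[of s s'] le[of s' s] by (cases "s \<le> s'") auto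
  qed
  moreover have "(\<lambda>s. (i + s) mod k + 1) ` {1..k} \<subseteq> {1..k}"
    using assms by (auto simp: Suc_le_eq)
  ultimately show ?thesis
    by (simp add: bij_betw_def endo_inj_surj)
qed

lemma coulomb_cong: "(\<And>i. i \<in> {1..k} \<Longrightarrow> x i = y i) \<Longrightarrow> coulomb k x = coulomb k y"
  unfolding coulomb_def by (intro sum.cong refl) (auto simp: split_beta)

lemma measurable_coulomb[measurable]:
  "coulomb k \<in> borel_measurable (PiM {1..k} (\<lambda>_. borel))"
  unfolding coulomb_def split_beta
proof (intro borel_measurable_sum)
  fix p :: "nat \<times> nat" assume "p \<in> {p. 1 \<le> fst p \<and> fst p < snd p \<and> snd p \<le> k}"
  hence [measurable]: "(\<lambda>x. x (fst p)) \<in> measurable (PiM {1..k} (\<lambda>_. borel)) borel"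
    "(\<lambda>x. x (snd p)) \<in> measurable (PiM {1..k} (\<lambda>_. borel)) borel"
    by (auto intro!: measurable_component_singleton)
  show "(\<lambda>x. 1 / ennreal (norm (x (fst p) - x (snd p))))
      \<in> borel_measurable (PiM {1..k} (\<lambda>_. borel :: (real ^ 'a) measure))"
    by measurable
qed

lemma measurable_unemb[measurable]: "unemb \<in> borel_measurable borel"
proof -
  have [measurable]: "fst \<in> borel_measurable (borel :: ('a \<times> real) measure)"
    "snd \<in> borel_measurable (borel :: ('a \<times> real) measure)"
    by (intro borel_measurable_continuous_onI continuous_intros)+
  show ?thesis unfolding unemb_def by measurable
qed

text \<open>
  A coupling on the compactification is cut into strata according to the number of coordinates
  that are not at infinity; on each stratum these coordinates are listed in a cyclically shifted
  order, which makes the marginals equal.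
\<close>

lemma coupling_imp_admissible:
  fixes \<rho> :: "(real ^ 'd) measure" and Z :: "nat \<Rightarrow> real \<Rightarrow> (real ^ 'd) \<times> real"
  assumes N: "N \<ge> 1" and \<rho>: "\<rho> \<in> subprob_measures"
    and \<nu>: "real_distribution \<nu>" and Z: "\<And>i. Z i \<in> borel_measurable borel"
    and law: "\<And>A. A \<in> sets borel \<Longrightarrow> (\<Sum>i = 1..N. measure \<nu> (Z i -` A)) / real N =
       measure \<rho> (emb -` A) + (1 - mass \<rho>) * indicator A 0"
  obtains \<tau> where "admissible N \<rho> \<tau>"
    "stratified_cost N \<tau> \<le> (\<integral>\<^sup>+t. (SUP m. ennreal (regularized_cost N m (\<lambda>i. Z i t))) \<partial>\<nu>)"
proof -
  interpret \<nu>: real_distribution \<nu> by (rule \<nu>)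
  note [measurable] = Z
  have snd_meas[measurable]: "snd \<in> borel_measurable (borel :: ((real ^ 'd) \<times> real) measure)"
    by (intro borel_measurable_continuous_onI continuous_intros)
  \<comment> \<open>The prescribed average is carried by the sphere, and the marginals are
    nonnegative, so each of them is carried by the sphere.\<close>
  have compact: "AE t in \<nu>. \<forall>i\<in>{1..N}. Z i t \<in> compactified"
  proof (rule AE_finite_allI)
    fix i assume i: "i \<in> {1..N}"
    have A[measurable]: "- compactified \<in> sets (borel :: ((real ^ 'd) \<times> real) measure)"
      by (rule borel_open[OF open_Compl[OF closed_compactified]])
    have "emb -` (- compactified) = ({} :: (real ^ 'd) set)" using emb_compactified by blast
    hence "(\<Sum>i = 1..N. measure \<nu> (Z i -` (- compactified))) / real N = 0"
      by (subst law[OF A]) (simp add: zero_compactified)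
    hence "(\<Sum>i = 1..N. measure \<nu> (Z i -` (- compactified))) = 0" using N by simp
    hence "measure \<nu> (Z i -` (- compactified)) = 0"
      using i by (subst (asm) sum_nonneg_eq_0_iff) auto
    hence "emeasure \<nu> (Z i -` (- compactified)) = 0" by (simp add: \<nu>.emeasure_eq_measure)
    moreover have "Z i -` (- compactified) \<in> sets \<nu>"
      using measurable_sets[OF Z A, of i] by simp
    ultimately show "AE t in \<nu>. Z i t \<in> compactified"
      by (intro AE_I[of _ _ "Z i -` (- compactified)"]) auto
  qed simp
  \<comment> \<open>On the sphere \<open>snd\<close> vanishes only at infinity, so these are the
    finite points.\<close>
  define S where "S t = {i\<in>{1..N}. snd (Z i t) \<noteq> 0}" for t
  have S_sub: "S t \<subseteq> {1..N}" for t by (auto simp: S_def)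
  have fin_S: "finite (S t)" for t by (rule finite_subset[OF S_sub]) simp
  have card_S: "card (S t) \<le> N" for t using card_mono[OF _ S_sub] by simp
  have S_meas[measurable]: "S \<in> measurable borel (count_space (Pow {1..N}))"
  proof (subst measurable_count_space_eq2)
    have "S -` {T} \<inter> space borel \<in> sets borel" if "T \<in> Pow {1..N}" for T
    proof -
      have "S t = T \<longleftrightarrow> (\<forall>i\<in>{1..N}. (snd (Z i t) \<noteq> 0) = (i \<in> T))" for t
        using that unfolding S_def by blast
      hence "S -` {T} \<inter> space borel = {t \<in> space borel. \<forall>i\<in>{1..N}. (snd (Z i t) \<noteq> 0) = (i \<in> T)}"
        by blast
      also have "\<dots> \<in> sets borel" by measurable
      finally show ?thesis .
    qed
    thus "S \<in> space borel \<rightarrow> Pow {1..N} \<and> (\<forall>T\<in>Pow {1..N}. S -` {T} \<inter> space borel \<in> sets borel)"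
      using S_sub by auto
  qed simp
  have card_meas[measurable]: "(\<lambda>t. card (S t)) \<in> measurable borel (count_space UNIV)"
    by (rule measurable_compose[OF S_meas]) simp
  define e where "e T = (SOME h. bij_betw h {1..card T} T)" for T :: "nat set"
  have e: "bij_betw (e T) {1..card T} T" if "finite T" for T
    unfolding e_def by (rule someI_ex[OF ex_bij_betw_nat_finite_1[OF that]])
  \<comment> \<open>Outside the event that exactly k points are finite the values are meaningless;
    the density of \<open>D k\<close> removes them.\<close>
  define Y where "Y k s t = (\<lambda>i\<in>{1..k}. unemb (Z (e (S t) ((i + s) mod k + 1)) t))" for k s t
  have Y_meas[measurable]: "Y k s \<in> measurable borel (PiM {1..k} (\<lambda>_. borel))" for k s
    unfolding Y_def
  proof (rule measurable_restrict)
    fix i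
    show "(\<lambda>t. unemb (Z (e (S t) ((i + s) mod k + 1)) t)) \<in> borel_measurable borel"
      by (rule measurable_compose_countable'[OF _ S_meas]) (auto intro: countable_finite)
  qed
  \<comment> \<open>A uniformly distributed shift, independent of t, restricted to configurations
    with k finite points.\<close>
  define D where "D k = density (count_space {1..k} \<Otimes>\<^sub>M \<nu>)
      (\<lambda>(s, t). ennreal (1 / real k) * indicator {t. card (S t) = k} t)" for k
  define P where "P k = distr (D k) (PiM {1..k} (\<lambda>_. borel)) (\<lambda>(s, t). Y k s t)" for k
  have card_sets[measurable]: "{t. card (S t) = k} \<in> sets borel" for k
    using measurable_sets[OF card_meas, of "{k}"] by (simp add: vimage_def)
  note to_borel = measurable_cong_sets[OF \<nu>.events_eq_borel refl]
  have Y2[measurable]: "(\<lambda>(s, t). Y k s t) \<in>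
      measurable (count_space {1..k} \<Otimes>\<^sub>M \<nu>) (PiM {1..k} (\<lambda>_. borel))" for k
  proof (rule measurable_pair_measure_countable1)
    show "(\<lambda>t. case (s, t) of (s, t) \<Rightarrow> Y k s t) \<in> measurable \<nu> (PiM {1..k} (\<lambda>_. borel))" for s
      unfolding prod.case to_borel by (rule Y_meas)
  qed simp
  have d_meas[measurable]: "(\<lambda>(s, t). ennreal (1 / real k) * indicator {t. card (S t) = k} t) \<in>
      borel_measurable (count_space {1..k} \<Otimes>\<^sub>M \<nu>)" for k
  proof (rule measurable_pair_measure_countable1)
    show "(\<lambda>t. case (s :: nat, t) of (s, t) \<Rightarrow> ennreal (1 / real k) * indicator {t. card (S t) = k} t)
        \<in> borel_measurable \<nu>" for s
      unfolding prod.case to_borel by measurable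
  qed simp
  have D_sets: "sets (D k) = sets (count_space {1..k} \<Otimes>\<^sub>M \<nu>)" for k
    unfolding D_def by (rule sets_density)
  have P_sets: "sets (P k) = sets (PiM {1..k} (\<lambda>_. borel))" for k
    unfolding P_def by (rule sets_distr)
  have nn_P: "(\<integral>\<^sup>+x. f x \<partial>P k) =
      (\<integral>\<^sup>+t. ennreal (1 / real k) * indicator {t. card (S t) = k} t * (\<Sum>s = 1..k. f (Y k s t)) \<partial>\<nu>)"
    if f[measurable]: "f \<in> borel_measurable (PiM {1..k} (\<lambda>_. borel))" for f k
  proof -
    let ?d = "\<lambda>t. ennreal (1 / real k) * indicator {t. card (S t) = k} t"
    have "(\<integral>\<^sup>+x. f x \<partial>P k) = (\<integral>\<^sup>+z. f (case z of (s, t) \<Rightarrow> Y k s t) \<partial>D k)"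
      unfolding P_def
    proof (rule nn_integral_distr)
      show "(\<lambda>(s, t). Y k s t) \<in> measurable (D k) (PiM {1..k} (\<lambda>_. borel))"
        unfolding measurable_cong_sets[OF D_sets refl] by (rule Y2)
      show "f \<in> borel_measurable (distr (D k) (PiM {1..k} (\<lambda>_. borel)) (\<lambda>(s, t). Y k s t))"
        unfolding measurable_distr_eq1 by (rule f)
    qed
    also have "\<dots> = (\<integral>\<^sup>+z. (case z of (s, t) \<Rightarrow> ?d t) * f (case z of (s, t) \<Rightarrow> Y k s t)
        \<partial>(count_space {1..k} \<Otimes>\<^sub>M \<nu>))"
      unfolding D_def by (rule nn_integral_density[OF d_meas measurable_compose[OF Y2 f]])
    also have "\<dots> = (\<integral>\<^sup>+s. \<integral>\<^sup>+t. (case (s, t) of (s, t) \<Rightarrow> ?d t) * f (case (s, t) of (s, t) \<Rightarrow> Y k s t)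
        \<partial>\<nu> \<partial>count_space {1..k})"
      by (rule \<nu>.nn_integral_fst[symmetric],
          rule borel_measurable_times_ennreal[OF d_meas measurable_compose[OF Y2 f]])
    also have "\<dots> = (\<Sum>s = 1..k. \<integral>\<^sup>+t. ?d t * f (Y k s t) \<partial>\<nu>)"
      unfolding prod.case by (rule nn_integral_count_space_finite) simp
    also have "\<dots> = (\<integral>\<^sup>+t. (\<Sum>s = 1..k. ?d t * f (Y k s t)) \<partial>\<nu>)"
    proof (rule nn_integral_sum[symmetric])
      have "?d \<in> borel_measurable borel" by measurable
      thus "(\<lambda>t. ?d t * f (Y k s t)) \<in> borel_measurable \<nu>" for s
        unfolding to_borel by (rule borel_measurable_times_ennreal) (rule measurable_compose[OF Y_meas f])
    qed
    finally show ?thesis by (simp add: sum_distrib_left)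
  qed
  \<comment> \<open>The number of finite points in A; divided by k and integrated over stratum k it
    becomes the common marginal.\<close>
  define W :: "(real ^ 'd) set \<Rightarrow> real \<Rightarrow> ennreal" where
    "W A t = (\<Sum>l = 1..N. indicator {z. snd z \<noteq> 0 \<and> unemb z \<in> A} (Z l t))" for A t
  have W_S: "W A t = (\<Sum>l\<in>S t. indicator A (unemb (Z l t)))" for A t
    unfolding W_def S_def
    by (rule sum.mono_neutral_cong_right) (auto simp: indicator_def)
  have cell: "{z. snd z \<noteq> 0 \<and> unemb z \<in> A} \<in> sets borel" if A: "A \<in> sets borel"
    for A :: "(real ^ 'd) set"
  proof -
    have "{z. snd z \<noteq> 0 \<and> unemb z \<in> A} = snd -` (- {0}) \<inter> unemb -` A" by auto
    moreover have "snd -` (- {0}) \<in> sets (borel :: ((real ^ 'd) \<times> real) measure)"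
      using measurable_sets[OF snd_meas, of "- {0}"] by simp
    moreover have "unemb -` A \<in> sets borel" using measurable_sets[OF measurable_unemb A] by simp
    ultimately show ?thesis by simp
  qed
  have W_meas[measurable]: "W A \<in> borel_measurable borel" if "A \<in> sets borel" for A
    unfolding W_def
    by (intro borel_measurable_sum measurable_compose[OF Z borel_measurable_indicator[OF cell]] that)
  have marg: "emeasure (distr (P k) borel (\<lambda>x. x i)) A =
      (\<integral>\<^sup>+t. ennreal (1 / real k) * indicator {t. card (S t) = k} t * W A t \<partial>\<nu>)"
    if k: "k \<ge> 1" and i: "i \<in> {1..k}" and A[measurable]: "A \<in> sets borel" for k i A
  proof -
    have comp[measurable]: "(\<lambda>x. x i) \<in> measurable (PiM {1..k} (\<lambda>_. borel :: (real ^ 'd) measure)) borel"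
      using i by (rule measurable_component_singleton)
    have "emeasure (distr (P k) borel (\<lambda>x. x i)) A = (\<integral>\<^sup>+x. indicator A x \<partial>distr (P k) borel (\<lambda>x. x i))"
      by simp
    also have "\<dots> = (\<integral>\<^sup>+x. indicator A (x i) \<partial>P k)"
    proof (rule nn_integral_distr)
      show "(\<lambda>x. x i) \<in> measurable (P k) borel"
        unfolding measurable_cong_sets[OF P_sets refl] by (rule comp)
      show "indicator A \<in> borel_measurable (distr (P k) borel (\<lambda>x. x i))"
        unfolding measurable_distr_eq1 by (rule borel_measurable_indicator[OF A])
    qed
    also have "\<dots> = (\<integral>\<^sup>+t. ennreal (1 / real k) * indicator {t. card (S t) = k} t *
        (\<Sum>s = 1..k. indicator A (Y k s t i)) \<partial>\<nu>)"
      by (rule nn_P) (rule measurable_compose[OF comp borel_measurable_indicator[OF A]])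
    also have "\<dots> = (\<integral>\<^sup>+t. ennreal (1 / real k) * indicator {t. card (S t) = k} t * W A t \<partial>\<nu>)"
    proof (rule nn_integral_cong)
      fix t
      show "ennreal (1 / real k) * indicator {t. card (S t) = k} t * (\<Sum>s = 1..k. indicator A (Y k s t i)) =
          ennreal (1 / real k) * indicator {t. card (S t) = k} t * W A t"
      proof (cases "card (S t) = k")
        case True
        \<comment> \<open>As the shift varies, position i meets each finite point exactly once, so i
          disappears from the sum.\<close>
        have "bij_betw (e (S t) \<circ> (\<lambda>s. (i + s) mod k + 1)) {1..k} (S t)"
          using bij_betw_trans[OF bij_betw_rotate[OF k] e[OF fin_S, of t, unfolded True]] .
        hence "(\<Sum>s = 1..k. indicator A (unemb (Z ((e (S t) \<circ> (\<lambda>s. (i + s) mod k + 1)) s) t))) = W A t"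
          unfolding W_S by (rule sum.reindex_bij_betw)
        thus ?thesis using i by (simp add: Y_def)
      qed simp
    qed
    finally show ?thesis .
  qed
  define \<tau> where "\<tau> k = distr (P k) borel (\<lambda>x. x 1)" for k
  have \<tau>: "emeasure (\<tau> k) A =
      (\<integral>\<^sup>+t. ennreal (1 / real k) * indicator {t. card (S t) = k} t * W A t \<partial>\<nu>)"
    if "k \<ge> 1" "A \<in> sets borel" for k A
    unfolding \<tau>_def using that by (intro marg) auto
  have plan: "P k \<in> transport_plans k (\<tau> k)" if k: "k \<ge> 1" for k
    unfolding transport_plans_def
  proof (intro CollectI conjI ballI)
    show "sets (P k) = sets (PiM {1..k} (\<lambda>_. borel))" by (simp add: P_def)
    fix i assume i: "i \<in> {1..k}"
    show "distr (P k) borel (\<lambda>x. x i) = \<tau> k"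
    proof (rule measure_eqI)
      show "sets (distr (P k) borel (\<lambda>x. x i)) = sets (\<tau> k)" by (simp add: \<tau>_def)
      fix A assume "A \<in> sets (distr (P k) borel (\<lambda>x. x i))"
      hence A: "A \<in> sets borel" by simp
      show "emeasure (distr (P k) borel (\<lambda>x. x i)) A = emeasure (\<tau> k) A"
        unfolding marg[OF k i A] \<tau>[OF k A] ..
    qed
  qed
  have \<tau>_mass: "emeasure (\<tau> k) UNIV = emeasure \<nu> {t. card (S t) = k}" if k: "k \<ge> 1" for k
  proof -
    have "(UNIV :: (real ^ 'd) set) \<in> sets borel" by simp
    hence "emeasure (\<tau> k) UNIV =
        (\<integral>\<^sup>+t. ennreal (1 / real k) * indicator {t. card (S t) = k} t * W UNIV t \<partial>\<nu>)"
      by (rule \<tau>[OF k])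
    also have "\<dots> = (\<integral>\<^sup>+t. indicator {t. card (S t) = k} t \<partial>\<nu>)"
    proof (rule nn_integral_cong)
      fix t
      have "ennreal (1 / real k) * of_nat k = 1"
        using k by (simp add: ennreal_of_nat_eq_real_of_nat ennreal_mult[symmetric])
      thus "ennreal (1 / real k) * indicator {t. card (S t) = k} t * W UNIV t =
          indicator {t. card (S t) = k} t"
        by (auto simp: W_S indicator_def)
    qed
    also have "\<dots> = emeasure \<nu> {t. card (S t) = k}"
      by (rule nn_integral_indicator) (simp add: card_sets)
    finally show ?thesis .
  qed
  have \<tau>_sub: "\<tau> k \<in> subprob_measures" if k: "k \<ge> 1" for k
    using \<tau>_mass[OF k] \<nu>.emeasure_le_1 by (simp add: subprob_measures_def \<tau>_def)
  have sum_ind: "(\<Sum>k = 1..N. indicator {t. card (S t) = k} t :: ennreal) =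
      indicator {t. card (S t) \<noteq> 0} t" for t
    using card_S[of t] by (auto simp: indicator_def sum.delta)
  have adm: "admissible N \<rho> \<tau>"
    unfolding admissible_def
  proof (intro conjI ballI)
    show "\<tau> k \<in> subprob_measures" if "k \<in> {1..N}" for k using that \<tau>_sub by simp
    have "(\<Sum>k = 1..N. mass (\<tau> k)) = (\<Sum>k = 1..N. measure \<nu> {t. card (S t) = k})"
      by (intro sum.cong refl) (simp add: mass_def measure_def \<tau>_mass)
    also have "\<dots> = measure \<nu> (\<Union>k\<in>{1..N}. {t. card (S t) = k})"
      by (rule \<nu>.finite_measure_finite_Union[symmetric]) (auto simp: disjoint_family_on_def)
    \<comment> \<open>Configurations entirely at infinity belong to no stratum, so the total may be
      less than 1.\<close>
    also have "\<dots> \<le> 1" by simp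
    finally show "(\<Sum>k = 1..N. mass (\<tau> k)) \<le> 1" .
    fix A :: "(real ^ 'd) set" assume A[measurable]: "A \<in> sets borel"
    have fin: "emeasure (\<tau> k) A = ennreal (measure (\<tau> k) A)" if "k \<in> {1..N}" for k
    proof (rule emeasure_eq_ennreal_measure)
      have "emeasure (\<tau> k) A \<le> emeasure (\<tau> k) UNIV"
        using emeasure_mono[of A UNIV "\<tau> k"] by (simp add: \<tau>_def)
      thus "emeasure (\<tau> k) A \<noteq> top"
        using \<tau>_sub[of k] that by (auto simp: subprob_measures_def top_unique)
    qed
    let ?c = "ennreal (1 / real N)"
    have "ennreal (\<Sum>k = 1..N. real k / real N * measure (\<tau> k) A) =
        (\<Sum>k = 1..N. ennreal (real k / real N * measure (\<tau> k) A))"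
      by (rule sum_ennreal[symmetric]) simp
    also have "\<dots> = (\<Sum>k = 1..N. ennreal (real k / real N) * emeasure (\<tau> k) A)"
      by (intro sum.cong refl, subst ennreal_mult) (auto simp: fin)
    also have "\<dots> = (\<Sum>k = 1..N. \<integral>\<^sup>+t. ?c * indicator {t. card (S t) = k} t * W A t \<partial>\<nu>)"
    proof (intro sum.cong refl)
      fix k assume k: "k \<in> {1..N}"
      \<comment> \<open>The weight k / N of (S) cancels the 1 / k of the symmetrisation, so the
        strata add up to the average of the marginals on finite points.\<close>
      have "ennreal (real k / real N) * ennreal (1 / real k) = ?c"
        using k by (simp add: ennreal_mult[symmetric])
      moreover have "ennreal (real k / real N) * emeasure (\<tau> k) A =
        (\<integral>\<^sup>+t. ennreal (real k / real N) *
           (ennreal (1 / real k) * indicator {t. card (S t) = k} t * W A t) \<partial>\<nu>)"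
        using k by (subst nn_integral_cmult) (auto simp: \<tau>)
      ultimately show "ennreal (real k / real N) * emeasure (\<tau> k) A =
          (\<integral>\<^sup>+t. ?c * indicator {t. card (S t) = k} t * W A t \<partial>\<nu>)"
        by (simp add: mult.assoc[symmetric])
    qed
    also have "\<dots> = (\<integral>\<^sup>+t. (\<Sum>k = 1..N. ?c * indicator {t. card (S t) = k} t * W A t) \<partial>\<nu>)"
      by (rule nn_integral_sum[symmetric]) measurable
    also have "\<dots> = (\<integral>\<^sup>+t. ?c * W A t \<partial>\<nu>)"
    proof (rule nn_integral_cong)
      fix t
      have "(\<Sum>k = 1..N. ?c * indicator {t. card (S t) = k} t * W A t) =
          ?c * (\<Sum>k = 1..N. indicator {t. card (S t) = k} t) * W A t"
        by (simp only: sum_distrib_left sum_distrib_right)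
      also have "\<dots> = ?c * W A t"
        unfolding sum_ind using fin_S[of t] by (auto simp: W_S indicator_def)
      finally show "(\<Sum>k = 1..N. ?c * indicator {t. card (S t) = k} t * W A t) = ?c * W A t" .
    qed
    also have "\<dots> = ?c * (\<integral>\<^sup>+t. W A t \<partial>\<nu>)" by (rule nn_integral_cmult) measurable
    also have "(\<integral>\<^sup>+t. W A t \<partial>\<nu>) = (\<Sum>l = 1..N. emeasure \<nu> (Z l -` {z. snd z \<noteq> 0 \<and> unemb z \<in> A}))"
    proof -
      have "(\<integral>\<^sup>+t. indicator {z. snd z \<noteq> 0 \<and> unemb z \<in> A} (Z l t) \<partial>\<nu>) =
          emeasure \<nu> (Z l -` {z. snd z \<noteq> 0 \<and> unemb z \<in> A})" for l
      proof -
        have "(\<lambda>t. indicator {z. snd z \<noteq> 0 \<and> unemb z \<in> A} (Z l t) :: ennreal) =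
            indicator (Z l -` {z. snd z \<noteq> 0 \<and> unemb z \<in> A})"
          by (auto simp: indicator_def)
        moreover have "Z l -` {z. snd z \<noteq> 0 \<and> unemb z \<in> A} \<in> sets \<nu>"
          using measurable_sets[OF Z cell[OF A], of l] by simp
        ultimately show ?thesis by simp
      qed
      thus ?thesis unfolding W_def by (subst nn_integral_sum) auto
    qed
    also have "\<dots> = ennreal (\<Sum>l = 1..N. measure \<nu> (Z l -` {z. snd z \<noteq> 0 \<and> unemb z \<in> A}))"
      by (simp add: \<nu>.emeasure_eq_measure)
    also have "?c * \<dots> =
        ennreal ((\<Sum>l = 1..N. measure \<nu> (Z l -` {z. snd z \<noteq> 0 \<and> unemb z \<in> A})) / real N)"
      by (subst ennreal_mult[symmetric]) (auto intro!: sum_nonneg)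
    also have "\<dots> = ennreal (measure \<rho> A)"
      by (subst law[OF cell[OF A]]) (auto simp: snd_emb_pos[THEN less_imp_neq, symmetric] unemb_emb vimage_def)
    finally show "measure \<rho> A = (\<Sum>k = 1..N. real k / real N * measure (\<tau> k) A)"
      by (subst (asm) ennreal_inj) (auto intro!: sum_nonneg)
  qed
  define H where "H t = (SUP m. ennreal (regularized_cost N m (\<lambda>i. Z i t)))" for t
  have [measurable]: "(\<lambda>t. regularized_cost N m (\<lambda>i. Z i t)) \<in> borel_measurable borel" for m
    unfolding regularized_cost_def regularized_def split_beta by measurable
  have [measurable]: "H \<in> borel_measurable borel"
    unfolding H_def by measurable
  have cost: "partial_cost k (\<tau> k) \<le> (\<integral>\<^sup>+t. indicator {t. card (S t) = k} t * H t \<partial>\<nu>)"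
    if k: "k \<in> {1..N}" for k
  proof -
    have "partial_cost k (\<tau> k) \<le> (\<integral>\<^sup>+x. coulomb k x \<partial>P k)"
      using plan[of k] k by (auto simp: partial_cost_def intro: INF_lower)
    also have "\<dots> = (\<integral>\<^sup>+t. ennreal (1 / real k) * indicator {t. card (S t) = k} t *
        (\<Sum>s = 1..k. coulomb k (Y k s t)) \<partial>\<nu>)"
      by (rule nn_P) (rule measurable_coulomb)
    also have "\<dots> \<le> (\<integral>\<^sup>+t. indicator {t. card (S t) = k} t * H t \<partial>\<nu>)"
    proof (rule nn_integral_mono_AE, use compact in eventually_elim)
      fix t assume t: "\<forall>i\<in>{1..N}. Z i t \<in> compactified"
      show "ennreal (1 / real k) * indicator {t. card (S t) = k} t * (\<Sum>s = 1..k. coulomb k (Y k s t))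
          \<le> indicator {t. card (S t) = k} t * H t"
      proof (cases "card (S t) = k")
        case True
        \<comment> \<open>Every shift merely reorders the finite points, so one bound serves all
          shifts.\<close>
        have "coulomb k (Y k s t) \<le> H t" for s
        proof -
          have bij: "bij_betw (e (S t) \<circ> (\<lambda>i. (s + i) mod k + 1)) {1..k} (S t)"
            using k bij_betw_trans[OF bij_betw_rotate e[OF fin_S, of t, unfolded True]] by simp
          have "coulomb k (\<lambda>i. unemb (Z ((e (S t) \<circ> (\<lambda>i. (s + i) mod k + 1)) i) t)) \<le> H t"
            unfolding H_def using t
            by (intro coulomb_le_SUP_regularized_cost[OF bij S_sub, of "\<lambda>i. Z i t"])
               (auto simp: S_def)
          moreover have "coulomb k (Y k s t) =
              coulomb k (\<lambda>i. unemb (Z ((e (S t) \<circ> (\<lambda>i. (s + i) mod k + 1)) i) t))"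
            by (rule coulomb_cong) (simp add: Y_def add.commute)
          ultimately show ?thesis by simp
        qed
        hence "(\<Sum>s = 1..k. coulomb k (Y k s t)) \<le> of_nat k * H t"
          using sum_bounded_above[of "{1..k}" "\<lambda>s. coulomb k (Y k s t)" "H t"] by simp
        hence "ennreal (1 / real k) * (\<Sum>s = 1..k. coulomb k (Y k s t)) \<le>
            ennreal (1 / real k) * (of_nat k * H t)"
          by (rule mult_left_mono) simp
        also have "\<dots> = H t"
          using k by (simp add: mult.assoc[symmetric] ennreal_of_nat_eq_real_of_nat ennreal_mult[symmetric])
        finally show ?thesis using True by simp
      qed simp
    qed
    finally show ?thesis .
  qed
  have "stratified_cost N \<tau> \<le> (\<Sum>k = 1..N. \<integral>\<^sup>+t. indicator {t. card (S t) = k} t * H t \<partial>\<nu>)"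
    unfolding stratified_cost_def by (intro sum_mono cost)
  also have "\<dots> = (\<integral>\<^sup>+t. (\<Sum>k = 1..N. indicator {t. card (S t) = k} t * H t) \<partial>\<nu>)"
    by (rule nn_integral_sum[symmetric]) measurable
  also have "\<dots> \<le> (\<integral>\<^sup>+t. H t \<partial>\<nu>)"
    unfolding sum_distrib_right[symmetric] sum_ind
    by (intro nn_integral_mono) (auto simp: indicator_def)
  finally show thesis using that[OF adm] by (simp add: H_def)
qed

text \<open>The expected regularised cost is at most V at every level m. Monotone convergence
  carries the bound to the supremum over m, which dominates the cost of the strata.\<close>

lemma strong_duality:
  fixes \<rho> :: "(real ^ 'd) measure"
  assumes N: "N \<ge> 1" and \<rho>: "\<rho> \<in> subprob_measures"
    and dual: "\<And>\<phi>. \<phi> \<in> C0 \<Longrightarrow> dual N \<rho> \<phi> \<le> ereal V"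
  obtains \<tau> where "admissible N \<rho> \<tau>" "stratified_cost N \<tau> \<le> ennreal V"
proof -
  obtain \<nu> and Z :: "nat \<Rightarrow> real \<Rightarrow> (real ^ 'd) \<times> real" where
    \<nu>: "real_distribution \<nu>" and Z: "\<And>i. continuous_on UNIV (Z i)"
    and law: "\<And>A. A \<in> sets borel \<Longrightarrow> (\<Sum>i = 1..N. measure \<nu> (Z i -` A)) / real N =
       measure \<rho> (emb -` A) + (1 - mass \<rho>) * indicator A 0"
    and cost: "\<And>m. (\<integral>t. regularized_cost N m (\<lambda>i. Z i t) \<partial>\<nu>) \<le> V"
    by (rule dual_bound_imp_coupling[OF N \<rho> dual], assumption) (rule that)
  interpret \<nu>: real_distribution \<nu> by (rule \<nu>)
  have Z_meas: "Z i \<in> borel_measurable borel" for i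
    by (intro borel_measurable_continuous_onI Z)
  have reg_meas: "(\<lambda>t. regularized_cost N m (\<lambda>i. Z i t)) \<in> borel_measurable borel" for m
    by (intro borel_measurable_continuous_onI continuous_on_regularized_cost Z)
  have int: "integrable \<nu> (\<lambda>t. regularized_cost N m (\<lambda>i. Z i t))" for m
  proof -
    have "norm (regularized_cost N m (\<lambda>i. Z i t)) \<le> real (card (off_diag {1..N})) * real (Suc m) / 2" for t
      unfolding real_norm_def abs_of_nonneg[OF regularized_cost_nonneg] by (rule regularized_cost_le)
    from \<nu>.integrable_const_bound[OF AE_I2[OF this]] show ?thesis using reg_meas by simp
  qed
  have "(\<integral>\<^sup>+t. (SUP m. ennreal (regularized_cost N m (\<lambda>i. Z i t))) \<partial>\<nu>) =
      (SUP m. \<integral>\<^sup>+t. ennreal (regularized_cost N m (\<lambda>i. Z i t)) \<partial>\<nu>)"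
    using reg_meas incseqD[OF incseq_regularized_cost]
    by (intro nn_integral_monotone_convergence_SUP)
       (auto simp: incseq_def le_fun_def intro!: ennreal_leI)
  also have "\<dots> \<le> ennreal V"
    by (intro SUP_least, subst nn_integral_eq_integral[OF int])
       (auto intro: ennreal_leI cost regularized_cost_nonneg)
  finally have "(\<integral>\<^sup>+t. (SUP m. ennreal (regularized_cost N m (\<lambda>i. Z i t))) \<partial>\<nu>) \<le> ennreal V" .
  moreover obtain \<tau> where "admissible N \<rho> \<tau>"
    "stratified_cost N \<tau> \<le> (\<integral>\<^sup>+t. (SUP m. ennreal (regularized_cost N m (\<lambda>i. Z i t))) \<partial>\<nu>)"
    by (rule coupling_imp_admissible[OF N \<rho> \<nu> Z_meas law], assumption) (rule that)
  ultimately show thesis using that by (meson order_trans)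
qed

section \<open>Weak duality\<close>

lemma C0_measurable: "\<phi> \<in> C0 \<Longrightarrow> \<phi> \<in> borel_measurable borel"
  by (auto simp: C0_def intro: borel_measurable_continuous_onI)

lemma C0_bounded:
  assumes "\<phi> \<in> C0"
  obtains B where "0 \<le> B" "\<And>x. \<bar>\<phi> x\<bar> \<le> B"
proof -
  have cont: "continuous_on UNIV \<phi>" and lim: "(\<phi> \<longlongrightarrow> 0) at_infinity"
    using assms by (auto simp: C0_def)
  have "\<forall>\<^sub>F x in at_infinity. dist (\<phi> x) 0 < 1" using lim by (rule tendstoD) simp
  then obtain b where b: "\<And>x. b \<le> norm x \<Longrightarrow> \<bar>\<phi> x\<bar> < 1"
    by (auto simp: eventually_at_infinity)
  have "bounded (\<phi> ` cball 0 b)"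
    by (intro compact_imp_bounded compact_continuous_image continuous_on_subset[OF cont]) auto
  then obtain c where c: "\<forall>x\<in>cball 0 b. \<bar>\<phi> x\<bar> \<le> c"
    by (auto simp: bounded_iff)
  have "\<bar>\<phi> x\<bar> \<le> max 1 c" for x
    using b[of x] bspec[OF c, of x] by (cases "b \<le> norm x") (auto simp: le_max_iff_disj)
  thus thesis using that[of "max 1 c"] by simp
qed

lemma C0_scale:
  assumes "\<phi> \<in> C0"
  shows "(\<lambda>x. c * \<phi> x / d) \<in> C0"
proof -
  have "((\<lambda>x. c * \<phi> x / d) \<longlongrightarrow> c * 0 / d) at_infinity" if "d \<noteq> 0"
    using assms that by (intro tendsto_intros) (auto simp: C0_def)
  thus ?thesis using assms
    by (cases "d = 0") (auto simp: C0_def intro!: continuous_intros)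
qed

lemma zero_in_C0: "(\<lambda>_. 0) \<in> C0"
  by (simp add: C0_def)

lemma subprob_finite_measure:
  assumes "\<mu> \<in> subprob_measures"
  shows "finite_measure \<mu>"
proof (rule finite_measureI)
  have "space \<mu> = UNIV" using assms sets_eq_imp_space_eq[of \<mu> borel] by (simp add: subprob_measures_def)
  thus "emeasure \<mu> (space \<mu>) \<noteq> \<infinity>" using assms by (auto simp: subprob_measures_def top_unique)
qed

lemma integrable_C0:
  assumes "\<mu> \<in> subprob_measures" "\<phi> \<in> C0"
  shows "integrable \<mu> \<phi>"
proof -
  obtain B where "\<And>x. \<bar>\<phi> x\<bar> \<le> B" using C0_bounded[OF assms(2)] by blast
  moreover have "\<phi> \<in> borel_measurable \<mu>"
    using C0_measurable[OF assms(2)] assms(1)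
    by (simp add: subprob_measures_def cong: measurable_cong_sets)
  ultimately show ?thesis
    by (intro finite_measure.integrable_const_bound[OF subprob_finite_measure[OF assms(1)], of _ B]) auto
qed

lemma subprob_space: "\<mu> \<in> subprob_measures \<Longrightarrow> space \<mu> = UNIV"
  using sets_eq_imp_space_eq[of \<mu> borel] by (simp add: subprob_measures_def)

lemma mass_nonneg: "0 \<le> mass \<mu>"
  by (simp add: mass_def)

lemma mass_le_1: "\<mu> \<in> subprob_measures \<Longrightarrow> mass \<mu> \<le> 1"
  using finite_measure.emeasure_eq_measure[OF subprob_finite_measure, of \<mu> UNIV]
  by (simp add: subprob_measures_def mass_def)

section \<open>Comparison and finiteness of the values M_k\<close>

lemma coulomb_Suc:
  "coulomb (Suc k) x = coulomb k x + (\<Sum>i = 1..k. 1 / ennreal (norm (x i - x (Suc k))))"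
proof -
  let ?f = "\<lambda>(i, j). 1 / ennreal (norm (x i - x j))"
  have eq: "{(i, j). 1 \<le> i \<and> i < j \<and> j \<le> Suc k} =
      {(i, j). 1 \<le> i \<and> i < j \<and> j \<le> k} \<union> (\<lambda>i. (i, Suc k)) ` {1..k}"
    by (auto simp: le_Suc_eq)
  have fin: "finite {(i, j). 1 \<le> i \<and> i < j \<and> j \<le> k}"
    by (rule finite_subset[of _ "{1..k} \<times> {1..k}"]) auto
  have "sum ?f {(i, j). 1 \<le> i \<and> i < j \<and> j \<le> Suc k} =
      sum ?f {(i, j). 1 \<le> i \<and> i < j \<and> j \<le> k} + sum ?f ((\<lambda>i. (i, Suc k)) ` {1..k})"
    unfolding eq by (rule sum.union_disjoint) (use fin in auto)
  also have "sum ?f ((\<lambda>i. (i, Suc k)) ` {1..k}) = (\<Sum>i = 1..k. 1 / ennreal (norm (x i - x (Suc k))))"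
    by (subst sum.reindex) (auto simp: inj_on_def)
  finally show ?thesis by (simp add: coulomb_def)
qed

text \<open>The factor k cancels the average in \<open>M k\<close>, so every point has weight 1 / N
  for each k; this makes the values for different k comparable.\<close>

lemma M_scaled:
  "M k (\<lambda>x. real k * \<phi> x / real N) =
     (SUP x. ereal ((\<Sum>i = 1..k. \<phi> (x i)) / real N) - enn2ereal (coulomb k x))"
proof -
  have "1 / real k * (\<Sum>i = 1..k. real k * \<phi> (x i) / real N) = (\<Sum>i = 1..k. \<phi> (x i)) / real N" for x
    by (cases "k = 0") (simp_all add: sum_distrib_left[symmetric] sum_divide_distrib[symmetric])
  thus ?thesis by (simp add: M_def)
qed

text \<open>A further point may be sent to infinity, where it contributes neither potential nor cost.\<close>

lemma M_scaled_mono_Suc: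
  fixes \<phi> :: "real ^ 'd \<Rightarrow> real"
  assumes "\<phi> \<in> C0"
  shows "M k (\<lambda>x. real k * \<phi> x / real N) \<le> M (Suc k) (\<lambda>x. real (Suc k) * \<phi> x / real N)"
    (is "_ \<le> ?R")
  unfolding M_scaled[of k]
proof (rule SUP_least)
  fix x :: "nat \<Rightarrow> real ^ 'd"
  let ?s = "\<Sum>i = 1..k. \<phi> (x i)"
  show "ereal (?s / real N) - enn2ereal (coulomb k x) \<le> ?R"
  proof (cases "coulomb k x" rule: ennreal_cases)
    case (real c)
    \<comment> \<open>The value of the configuration enlarged by a point y, in real arithmetic; as y
      goes to infinity it tends to the value of the k points.\<close>
    define g where "g y = (?s + \<phi> y) / real N - (c + (\<Sum>i = 1..k. 1 / norm (x i - y)))" for y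
    have "(g \<longlongrightarrow> (?s + 0) / real N - (c + (\<Sum>i = 1..k. 0))) at_infinity"
    proof -
      have "((\<lambda>y. 1 / norm (x i - y)) \<longlongrightarrow> 0) at_infinity" for i
      proof (rule real_tendsto_divide_at_top[OF tendsto_const])
        have "filterlim (\<lambda>y :: real ^ 'd. - norm (x i) + norm y) at_top at_infinity"
          by (rule filterlim_tendsto_add_at_top[OF tendsto_const filterlim_norm_at_top])
        thus "filterlim (\<lambda>y. norm (x i - y)) at_top at_infinity"
        proof (rule filterlim_at_top_mono[OF _ always_eventually[OF allI]])
          fix y :: "real ^ 'd"
          show "- norm (x i) + norm y \<le> norm (x i - y)"
            using norm_triangle_ineq2[of y "x i"] by (simp add: norm_minus_commute)
        qed
      qed
      moreover have "(\<phi> \<longlongrightarrow> 0) at_infinity" using assms by (simp add: C0_def)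
      ultimately show ?thesis
        unfolding g_def divide_inverse[of _ "real N"] by (intro tendsto_intros)
    qed
    hence "((\<lambda>y. ereal (g y)) \<longlongrightarrow> ereal (?s / real N - c)) at_infinity" by simp
    moreover have "\<forall>\<^sub>F y in at_infinity. ereal (g y) \<le> ?R"
      unfolding eventually_at_infinity
    proof (intro exI[of _ "Max (insert 0 ((\<lambda>i. norm (x i)) ` {1..k})) + 1"] allI impI)
      fix y :: "real ^ 'd" assume y: "Max (insert 0 ((\<lambda>i. norm (x i)) ` {1..k})) + 1 \<le> norm y"
      \<comment> \<open>Far out y avoids all other points. This matters because 1 / 0 is 0 in the
        reals but \<infinity> in the cost.\<close>
      have ne: "x i \<noteq> y" if "i \<in> {1..k}" for i
      proof -
        have "norm (x i) \<le> Max (insert 0 ((\<lambda>i. norm (x i)) ` {1..k}))"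
          using that by (intro Max_ge) auto
        thus ?thesis using y by auto
      qed
      define x' where "x' = x(Suc k := y)"
      have "(\<Sum>i = 1..k. 1 / ennreal (norm (x i - y))) = (\<Sum>i = 1..k. ennreal (1 / norm (x i - y)))"
        using ne by (intro sum.cong refl) (simp add: divide_ennreal[of 1, simplified])
      also have "\<dots> = ennreal (\<Sum>i = 1..k. 1 / norm (x i - y))" by (rule sum_ennreal) simp
      finally have sm: "(\<Sum>i = 1..k. 1 / ennreal (norm (x i - y))) = ennreal (\<Sum>i = 1..k. 1 / norm (x i - y))" .
      have "coulomb (Suc k) x' = coulomb k x + (\<Sum>i = 1..k. 1 / ennreal (norm (x i - y)))"
        unfolding coulomb_Suc
        by (intro arg_cong2[of _ _ _ _ "(+)"] coulomb_cong sum.cong) (auto simp: x'_def)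
      also have "\<dots> = ennreal (c + (\<Sum>i = 1..k. 1 / norm (x i - y)))"
        unfolding sm using real by (simp add: ennreal_plus sum_nonneg)
      finally have co: "coulomb (Suc k) x' = ennreal (c + (\<Sum>i = 1..k. 1 / norm (x i - y)))" .
      have "enn2ereal (coulomb (Suc k) x') = ereal (c + (\<Sum>i = 1..k. 1 / norm (x i - y)))"
        unfolding co using real by (intro enn2ereal_ennreal add_nonneg_nonneg sum_nonneg) auto
      moreover have "(\<Sum>i = 1..Suc k. \<phi> (x' i)) = ?s + \<phi> y" by (simp add: x'_def)
      ultimately have "ereal (g y) =
          ereal ((\<Sum>i = 1..Suc k. \<phi> (x' i)) / real N) - enn2ereal (coulomb (Suc k) x')"
        by (simp add: g_def)
      also have "\<dots> \<le> ?R" unfolding M_scaled by (rule SUP_upper) simp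
      finally show "ereal (g y) \<le> ?R" .
    qed
    ultimately have "ereal (?s / real N - c) \<le> ?R"
      by (rule tendsto_upperbound) (rule trivial_limit_at_infinity)
    thus ?thesis using real by (simp add: enn2ereal_ennreal)
  qed simp
qed

lemma M_scaled_mono:
  assumes "\<phi> \<in> C0" "k \<le> l"
  shows "M k (\<lambda>x. real k * \<phi> x / real N) \<le> M l (\<lambda>x. real l * \<phi> x / real N)"
  using assms(2)
proof (induction l rule: dec_induct)
  case (step n)
  from step.IH M_scaled_mono_Suc[OF assms(1)] show ?case by (rule order_trans)
qed simp

lemma coulomb_0: "coulomb 0 x = 0"
  by (simp add: coulomb_def) (auto intro!: sum.neutral)

lemma coulomb_1: "coulomb (Suc 0) x = 0"
  by (simp add: coulomb_def) (auto intro!: sum.neutral)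

text \<open>Monotonicity starts from k = 0, where the sum and the cost are empty and the value is
  0.\<close>

lemma M_scaled_nonneg:
  assumes "\<phi> \<in> C0"
  shows "0 \<le> M k (\<lambda>x. real k * \<phi> x / real N)"
proof -
  have "M 0 (\<lambda>x. real 0 * \<phi> x / real N) = 0"
    unfolding M_scaled by (simp add: coulomb_0 zero_ereal_def[symmetric] zero_ennreal.rep_eq)
  thus ?thesis using M_scaled_mono[OF assms, of 0 k N] by simp
qed

lemma M_nonneg:
  assumes "\<phi> \<in> C0" "k \<ge> 1"
  shows "0 \<le> M k \<phi>"
  using M_scaled_nonneg[OF assms(1), of k k] assms(2) by simp

lemma M_le:
  assumes "\<And>x. \<phi> x \<le> B" "k \<ge> 1"
  shows "M k \<phi> \<le> ereal B"
  unfolding M_def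
proof (rule SUP_least)
  fix x
  have "(\<Sum>i = 1..k. \<phi> (x i)) \<le> real k * B"
    using sum_bounded_above[of "{1..k}" "\<lambda>i. \<phi> (x i)" B] assms by simp
  hence "1 / real k * (\<Sum>i = 1..k. \<phi> (x i)) \<le> B" using assms(2) by (simp add: field_simps)
  hence "ereal (1 / real k * (\<Sum>i = 1..k. \<phi> (x i))) - enn2ereal (coulomb k x) \<le> ereal B - 0"
    by (intro ereal_minus_mono) auto
  thus "ereal (1 / real k * (\<Sum>i = 1..k. \<phi> (x i))) - enn2ereal (coulomb k x) \<le> ereal B" by simp
qed

lemma M_real:
  assumes "\<phi> \<in> C0" "k \<ge> 1"
  shows "M k \<phi> = ereal (real_of_ereal (M k \<phi>))"
proof -
  obtain B where "\<And>x. \<bar>\<phi> x\<bar> \<le> B" using C0_bounded[OF assms(1)] by blast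
  hence "M k \<phi> \<le> ereal B" using assms(2) by (intro M_le) (auto simp: abs_le_iff)
  thus ?thesis using M_nonneg[OF assms] by (cases "M k \<phi>") auto
qed

lemma le_M_1: "ereal (\<phi> x) \<le> M 1 \<phi>"
  unfolding M_def by (rule SUP_upper2[of "\<lambda>_. x"]) (simp_all add: coulomb_1 zero_ennreal.rep_eq)

lemma M_upper:
  assumes "M k \<phi> = ereal m" "coulomb k x \<noteq> top"
  shows "1 / real k * (\<Sum>i = 1..k. \<phi> (x i)) \<le> m + enn2real (coulomb k x)"
proof -
  have "ereal (1 / real k * (\<Sum>i = 1..k. \<phi> (x i))) - enn2ereal (coulomb k x) \<le> ereal m"
    unfolding assms(1)[symmetric] M_def by (rule SUP_upper) simp
  thus ?thesis using assms(2)
    by (cases "coulomb k x" rule: ennreal_cases) (auto simp: enn2ereal_ennreal)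
qed

section \<open>Duality bounds for single plans\<close>

lemma ereal_le_enn2ereal: "ennreal r \<le> c \<Longrightarrow> ereal r \<le> enn2ereal c"
  by (cases "0 \<le> r")
     (auto simp: less_eq_ennreal.rep_eq enn2ereal_ennreal intro: order_trans[OF _ enn2ereal_nonneg])

lemma plan_finite:
  assumes "\<mu> \<in> subprob_measures" "P \<in> transport_plans k \<mu>" "k \<ge> 1"
  shows "finite_measure P" "measure P (space P) = mass \<mu>"
proof -
  have sets_P: "sets P = sets (PiM {1..k} (\<lambda>_. borel))" using assms by (simp add: transport_plans_def)
  have d: "distr P borel (\<lambda>x. x 1) = \<mu>" using assms by (auto simp: transport_plans_def)
  have comp: "(\<lambda>x. x 1) \<in> measurable P borel"
    using assms(3) unfolding measurable_cong_sets[OF sets_P refl]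
    by (intro measurable_component_singleton) auto
  have em: "emeasure P (space P) = emeasure \<mu> UNIV"
    unfolding d[symmetric] using comp by (simp add: emeasure_distr)
  show "finite_measure P"
    using em assms(1) by (intro finite_measureI) (auto simp: subprob_measures_def top_unique)
  show "measure P (space P) = mass \<mu>" using em by (simp add: measure_def mass_def)
qed

text \<open>The averaged potential is pointwise at most \<open>M k \<phi>\<close> plus the cost.
  Integrating this against the plan, the k equal marginals turn the average into the integral of
  \<phi> against \<mu>.\<close>

lemma plan_weak_duality:
  fixes \<mu> :: "(real ^ 'd) measure"
  assumes \<mu>: "\<mu> \<in> subprob_measures" and \<phi>: "\<phi> \<in> C0" and k: "k \<ge> 1"
    and P: "P \<in> transport_plans k \<mu>"
  shows "ennreal ((\<integral>x. \<phi> x \<partial>\<mu>) - real_of_ereal (M k \<phi>) * mass \<mu>) \<le> (\<integral>\<^sup>+x. coulomb k x \<partial>P)"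
proof (cases "(\<integral>\<^sup>+x. coulomb k x \<partial>P) = top")
  case False
  let ?m = "real_of_ereal (M k \<phi>)"
  interpret finite_measure P using plan_finite[OF \<mu> P k] by simp
  have sets_P[measurable_cong]: "sets P = sets (PiM {1..k} (\<lambda>_. borel))"
    using P by (simp add: transport_plans_def)
  have comp[measurable]: "(\<lambda>x. x i) \<in> measurable P borel" if "i \<in> {1..k}" for i
    using that unfolding measurable_cong_sets[OF sets_P refl] by (rule measurable_component_singleton)
  have c_meas[measurable]: "coulomb k \<in> borel_measurable P" by measurable
  have fin: "AE x in P. coulomb k x \<noteq> top"
    using nn_integral_noteq_infinite[OF c_meas] False by simp
  have c_eq: "(\<integral>\<^sup>+x. ennreal (enn2real (coulomb k x)) \<partial>P) = (\<integral>\<^sup>+x. coulomb k x \<partial>P)"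
    by (rule nn_integral_cong_AE) (use fin in eventually_elim, auto simp: less_top)
  have c_int: "integrable P (\<lambda>x. enn2real (coulomb k x))"
    by (rule integrableI_nonneg) (use False c_eq in \<open>auto simp: less_top\<close>)
  have distr_P: "distr P borel (\<lambda>x. x i) = \<mu>" if "i \<in> {1..k}" for i
    using that P by (simp add: transport_plans_def)
  have \<phi>_int: "integrable P (\<lambda>x. \<phi> (x i))" and \<phi>_eq: "(\<integral>x. \<phi> (x i) \<partial>P) = (\<integral>x. \<phi> x \<partial>\<mu>)"
    if i: "i \<in> {1..k}" for i
  proof -
    show "integrable P (\<lambda>x. \<phi> (x i))"
      using integrable_C0[OF \<mu> \<phi>] unfolding distr_P[OF i, symmetric]
      by (rule integrable_distr[OF comp[OF i]])
    show "(\<integral>x. \<phi> (x i) \<partial>P) = (\<integral>x. \<phi> x \<partial>\<mu>)"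
      unfolding distr_P[OF i, symmetric]
      by (rule integral_distr[symmetric, OF comp[OF i] C0_measurable[OF \<phi>]])
  qed
  have "(\<integral>x. 1 / real k * (\<Sum>i = 1..k. \<phi> (x i)) - ?m \<partial>P) \<le> (\<integral>x. enn2real (coulomb k x) \<partial>P)"
  proof (rule integral_mono_AE)
    show "integrable P (\<lambda>x. 1 / real k * (\<Sum>i = 1..k. \<phi> (x i)) - ?m)"
      by (intro Bochner_Integration.integrable_diff Bochner_Integration.integrable_mult_right
          Bochner_Integration.integrable_sum \<phi>_int) auto
    show "AE x in P. 1 / real k * (\<Sum>i = 1..k. \<phi> (x i)) - ?m \<le> enn2real (coulomb k x)"
      using fin by eventually_elim (use M_upper[OF M_real[OF \<phi> k]] in \<open>fastforce simp: algebra_simps\<close>)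
  qed (rule c_int)
  moreover have "(\<integral>x. 1 / real k * (\<Sum>i = 1..k. \<phi> (x i)) - ?m \<partial>P) = (\<integral>x. \<phi> x \<partial>\<mu>) - ?m * mass \<mu>"
  proof -
    have "(\<integral>x. 1 / real k * (\<Sum>i = 1..k. \<phi> (x i)) - ?m \<partial>P) =
        (\<integral>x. 1 / real k * (\<Sum>i = 1..k. \<phi> (x i)) \<partial>P) - (\<integral>x. ?m \<partial>P)"
      by (rule Bochner_Integration.integral_diff)
         (intro Bochner_Integration.integrable_mult_right Bochner_Integration.integrable_sum \<phi>_int, auto)
    also have "(\<integral>x. 1 / real k * (\<Sum>i = 1..k. \<phi> (x i)) \<partial>P) = 1 / real k * (\<Sum>i = 1..k. \<integral>x. \<phi> (x i) \<partial>P)"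
      by (subst integral_mult_right_zero, subst Bochner_Integration.integral_sum) (auto simp: \<phi>_int)
    also have "\<dots> = (\<integral>x. \<phi> x \<partial>\<mu>)" using k by (simp add: \<phi>_eq)
    also have "(\<integral>x. ?m \<partial>P) = ?m * mass \<mu>" using plan_finite[OF \<mu> P k] by simp
    finally show ?thesis .
  qed
  moreover have "ennreal (\<integral>x. enn2real (coulomb k x) \<partial>P) = (\<integral>\<^sup>+x. coulomb k x \<partial>P)"
    unfolding c_eq[symmetric] by (rule nn_integral_eq_integral[symmetric, OF c_int]) simp
  ultimately show ?thesis by (metis ennreal_leI)
qed simp

text \<open>For k = 1 the cost is zero by definition and not an infimum over plans, so the bound of
  \<phi> by \<open>M 1 \<phi>\<close> is integrated directly.\<close>

lemma weak_partial_duality: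
  fixes \<mu> :: "(real ^ 'd) measure"
  assumes \<mu>: "\<mu> \<in> subprob_measures" and \<phi>: "\<phi> \<in> C0" and k: "k \<ge> 1"
  shows "ennreal ((\<integral>x. \<phi> x \<partial>\<mu>) - real_of_ereal (M k \<phi>) * mass \<mu>) \<le> partial_cost k \<mu>"
proof (cases "k = 1")
  case True
  interpret finite_measure \<mu> by (rule subprob_finite_measure[OF \<mu>])
  have "\<phi> x \<le> real_of_ereal (M 1 \<phi>)" for x
    using le_M_1[of \<phi> x] by (subst (asm) M_real[OF \<phi>]) auto
  hence "(\<integral>x. \<phi> x \<partial>\<mu>) \<le> (\<integral>x. real_of_ereal (M 1 \<phi>) \<partial>\<mu>)"
    by (intro integral_mono integrable_C0[OF \<mu> \<phi>]) auto
  thus ?thesis using True subprob_space[OF \<mu>] by (simp add: mass_def mult.commute ennreal_neg)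
next
  case False
  thus ?thesis using plan_weak_duality[OF \<mu> \<phi> k] by (auto simp: partial_cost_def intro: INF_greatest)
qed

lemma partial_dual_real:
  assumes "\<phi> \<in> C0" "k \<ge> 1"
  shows "partial_dual k \<mu> \<phi> = ereal ((\<integral>x. \<phi> x \<partial>\<mu>) - real_of_ereal (M k \<phi>) * mass \<mu>)"
  unfolding partial_dual_def by (subst M_real[OF assms]) simp

lemma dual_real:
  assumes "\<phi> \<in> C0" "k \<ge> 1"
  shows "dual k \<mu> \<phi> = ereal ((\<integral>x. \<phi> x \<partial>\<mu>) - real_of_ereal (M k \<phi>))"
  unfolding dual_def by (subst M_real[OF assms]) simp

lemma partial_dual_le_cost:
  assumes "\<mu> \<in> subprob_measures" "\<phi> \<in> C0" "k \<ge> 1"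
  shows "partial_dual k \<mu> \<phi> \<le> enn2ereal (partial_cost k \<mu>)"
  unfolding partial_dual_real[OF assms(2,3)] by (rule ereal_le_enn2ereal[OF weak_partial_duality[OF assms]])

lemma M_zero: "M k (\<lambda>_. 0) \<le> 0"
  unfolding M_def by (rule SUP_least) (simp add: zero_ereal_def[symmetric] zero_ennreal.rep_eq)

lemma partial_dual_zero: "0 \<le> partial_dual k \<mu> (\<lambda>_. 0)"
proof -
  have "M k (\<lambda>_. 0) * ereal (mass \<mu>) \<le> 0 * ereal (mass \<mu>)"
    by (rule ereal_mult_right_mono[OF M_zero]) (simp add: mass_nonneg)
  thus ?thesis by (simp add: partial_dual_def zero_ereal_def[symmetric] zero_ennreal.rep_eq)
qed

lemma dual_zero: "0 \<le> dual k \<mu> (\<lambda>_. 0)"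
  using M_zero[of k] by (simp add: dual_def zero_ereal_def[symmetric] zero_ennreal.rep_eq)

section \<open>Integrals against admissible families\<close>

lemma nn_integral_admissible:
  assumes \<rho>: "\<rho> \<in> subprob_measures" and adm: "admissible N \<rho> \<sigma>" and f: "f \<in> borel_measurable borel"
  shows "(\<integral>\<^sup>+x. f x \<partial>\<rho>) = (\<Sum>k = 1..N. ennreal (real k / real N) * (\<integral>\<^sup>+x. f x \<partial>\<sigma> k))"
proof -
  have \<sigma>: "\<sigma> k \<in> subprob_measures" if "k \<in> {1..N}" for k using adm that by (simp add: admissible_def)
  have ms: "(borel_measurable \<rho> :: (_ \<Rightarrow> ennreal) set) = borel_measurable borel"
    using \<rho> by (intro measurable_cong_sets) (auto simp: subprob_measures_def)
  have mss: "(borel_measurable (\<sigma> k) :: (_ \<Rightarrow> ennreal) set) = borel_measurable borel" if "k \<in> {1..N}" for k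
    using \<sigma>[OF that] by (intro measurable_cong_sets) (auto simp: subprob_measures_def)
  from f show ?thesis
  proof (induction rule: borel_measurable_induct)
    case (cong f g)
    hence "f = g" by auto
    thus ?case using cong by simp
  next
    case (set A)
    have "emeasure \<rho> A = ennreal (\<Sum>k = 1..N. real k / real N * measure (\<sigma> k) A)"
      using set adm finite_measure.emeasure_eq_measure[OF subprob_finite_measure[OF \<rho>], of A]
      by (simp add: admissible_def)
    also have "\<dots> = (\<Sum>k = 1..N. ennreal (real k / real N * measure (\<sigma> k) A))"
      by (rule sum_ennreal[symmetric]) simp
    also have "\<dots> = (\<Sum>k = 1..N. ennreal (real k / real N) * emeasure (\<sigma> k) A)"
      by (intro sum.cong refl, subst ennreal_mult)
         (auto simp: finite_measure.emeasure_eq_measure[OF subprob_finite_measure[OF \<sigma>]])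
    also have "\<dots> = (\<Sum>k = 1..N. ennreal (real k / real N) * (\<integral>\<^sup>+x. indicator A x \<partial>\<sigma> k))"
      using set \<sigma> by (intro sum.cong refl) (simp add: subprob_measures_def)
    finally show ?case using set \<rho> by (simp add: subprob_measures_def)
  next
    case (mult u c)
    have "(\<Sum>k = 1..N. ennreal (real k / real N) * (\<integral>\<^sup>+x. c * u x \<partial>\<sigma> k)) =
        (\<Sum>k = 1..N. c * (ennreal (real k / real N) * (\<integral>\<^sup>+x. u x \<partial>\<sigma> k)))"
    proof (intro sum.cong refl)
      fix k assume "k \<in> {1..N}"
      hence "u \<in> borel_measurable (\<sigma> k)" using mult mss by simp
      thus "ennreal (real k / real N) * (\<integral>\<^sup>+x. c * u x \<partial>\<sigma> k) =
          c * (ennreal (real k / real N) * (\<integral>\<^sup>+x. u x \<partial>\<sigma> k))"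
        by (simp add: nn_integral_cmult mult_ac)
    qed
    thus ?case using mult ms by (simp add: nn_integral_cmult sum_distrib_left)
  next
    case (add u v)
    have "(\<Sum>k = 1..N. ennreal (real k / real N) * (\<integral>\<^sup>+x. v x + u x \<partial>\<sigma> k)) =
        (\<Sum>k = 1..N. ennreal (real k / real N) * (\<integral>\<^sup>+x. v x \<partial>\<sigma> k) +
          ennreal (real k / real N) * (\<integral>\<^sup>+x. u x \<partial>\<sigma> k))"
      using add mss by (intro sum.cong refl) (simp add: nn_integral_add distrib_left)
    thus ?case using add ms by (simp add: nn_integral_add sum.distrib)
  next
    case (seq U)
    have "(\<integral>\<^sup>+x. (SUP i. U i) x \<partial>\<rho>) = (SUP i. \<integral>\<^sup>+x. U i x \<partial>\<rho>)"
      unfolding SUP_apply using seq ms by (intro nn_integral_monotone_convergence_SUP) auto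
    also have "\<dots> = (SUP i. \<Sum>k = 1..N. ennreal (real k / real N) * (\<integral>\<^sup>+x. U i x \<partial>\<sigma> k))"
      using seq by simp
    also have "\<dots> = (\<Sum>k = 1..N. SUP i. ennreal (real k / real N) * (\<integral>\<^sup>+x. U i x \<partial>\<sigma> k))"
    proof (rule ennreal_SUP_sum)
      show "incseq (\<lambda>i. ennreal (real k / real N) * (\<integral>\<^sup>+x. U i x \<partial>\<sigma> k))" for k
        using \<open>incseq U\<close> by (auto simp: incseq_def le_fun_def intro!: mult_left_mono nn_integral_mono)
    qed
    also have "\<dots> = (\<Sum>k = 1..N. ennreal (real k / real N) * (\<integral>\<^sup>+x. (SUP i. U i) x \<partial>\<sigma> k))"
    proof (intro sum.cong refl)
      fix k assume k: "k \<in> {1..N}"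
      have "(\<integral>\<^sup>+x. (SUP i. U i) x \<partial>\<sigma> k) = (SUP i. \<integral>\<^sup>+x. U i x \<partial>\<sigma> k)"
        unfolding SUP_apply using seq mss[OF k] by (intro nn_integral_monotone_convergence_SUP) auto
      thus "(SUP i. ennreal (real k / real N) * (\<integral>\<^sup>+x. U i x \<partial>\<sigma> k)) =
          ennreal (real k / real N) * (\<integral>\<^sup>+x. (SUP i. U i) x \<partial>\<sigma> k)"
        by (simp add: SUP_mult_left_ennreal)
    qed
    finally show ?case .
  qed
qed

lemma integral_admissible:
  fixes \<phi> :: "real ^ 'd \<Rightarrow> real"
  assumes \<rho>: "\<rho> \<in> subprob_measures" and adm: "admissible N \<rho> \<sigma>" and \<phi>: "\<phi> \<in> C0"
  shows "(\<integral>x. \<phi> x \<partial>\<rho>) = (\<Sum>k = 1..N. \<integral>x. real k * \<phi> x / real N \<partial>\<sigma> k)"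
proof -
  \<comment> \<open>Adding B makes the integrand nonnegative, as the identity for nonnegative
    integrals requires; the extra terms cancel because the masses satisfy the same linear
    relation.\<close>
  obtain B where B: "0 \<le> B" "\<And>x. \<bar>\<phi> x\<bar> \<le> B" using C0_bounded[OF \<phi>] by blast
  have \<sigma>: "\<sigma> k \<in> subprob_measures" if "k \<in> {1..N}" for k using adm that by (simp add: admissible_def)
  have pos: "0 \<le> \<phi> x + B" for x using B(2)[of x] by (simp add: abs_le_iff)
  have int: "integrable \<mu> (\<lambda>x. \<phi> x + B)" and
    eq: "(\<integral>x. \<phi> x + B \<partial>\<mu>) = (\<integral>x. \<phi> x \<partial>\<mu>) + B * mass \<mu>" if "\<mu> \<in> subprob_measures" for \<mu>
  proof -
    interpret finite_measure \<mu> by (rule subprob_finite_measure[OF that])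
    show "integrable \<mu> (\<lambda>x. \<phi> x + B)" using integrable_C0[OF that \<phi>] by simp
    show "(\<integral>x. \<phi> x + B \<partial>\<mu>) = (\<integral>x. \<phi> x \<partial>\<mu>) + B * mass \<mu>"
      using integrable_C0[OF that \<phi>] subprob_space[OF that] by (simp add: mass_def)
  qed
  have "ennreal (\<integral>x. \<phi> x + B \<partial>\<rho>) = (\<integral>\<^sup>+x. ennreal (\<phi> x + B) \<partial>\<rho>)"
    by (rule nn_integral_eq_integral[symmetric, OF int[OF \<rho>]]) (simp add: pos)
  also have "\<dots> = (\<Sum>k = 1..N. ennreal (real k / real N) * (\<integral>\<^sup>+x. ennreal (\<phi> x + B) \<partial>\<sigma> k))"
    using C0_measurable[OF \<phi>] by (intro nn_integral_admissible[OF \<rho> adm]) simp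
  also have "\<dots> = (\<Sum>k = 1..N. ennreal (real k / real N * (\<integral>x. \<phi> x + B \<partial>\<sigma> k)))"
  proof (intro sum.cong refl)
    fix k assume k: "k \<in> {1..N}"
    have "(\<integral>\<^sup>+x. ennreal (\<phi> x + B) \<partial>\<sigma> k) = ennreal (\<integral>x. \<phi> x + B \<partial>\<sigma> k)"
      by (rule nn_integral_eq_integral[OF int[OF \<sigma>[OF k]]]) (simp add: pos)
    moreover have "ennreal (real k / real N) * ennreal (\<integral>x. \<phi> x + B \<partial>\<sigma> k) =
        ennreal (real k / real N * (\<integral>x. \<phi> x + B \<partial>\<sigma> k))"
      by (rule ennreal_mult[symmetric]) (auto intro!: integral_nonneg_AE simp: pos)
    ultimately show "ennreal (real k / real N) * (\<integral>\<^sup>+x. ennreal (\<phi> x + B) \<partial>\<sigma> k) =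
        ennreal (real k / real N * (\<integral>x. \<phi> x + B \<partial>\<sigma> k))"
      by (simp only:)
  qed
  also have "\<dots> = ennreal (\<Sum>k = 1..N. real k / real N * (\<integral>x. \<phi> x + B \<partial>\<sigma> k))"
    by (rule sum_ennreal) (simp add: pos)
  finally have "(\<integral>x. \<phi> x + B \<partial>\<rho>) = (\<Sum>k = 1..N. real k / real N * (\<integral>x. \<phi> x + B \<partial>\<sigma> k))"
    by (subst (asm) ennreal_inj) (auto intro!: sum_nonneg mult_nonneg_nonneg integral_nonneg_AE simp: pos)
  also have "\<dots> = (\<Sum>k = 1..N. real k / real N * (\<integral>x. \<phi> x \<partial>\<sigma> k)) +
      B * (\<Sum>k = 1..N. real k / real N * mass (\<sigma> k))"
    unfolding sum_distrib_left sum.distrib[symmetric]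
    by (intro sum.cong refl, subst eq[OF \<sigma>], assumption)
       (simp add: algebra_simps add_divide_distrib)
  also have "(\<Sum>k = 1..N. real k / real N * mass (\<sigma> k)) = mass \<rho>"
    using adm by (simp add: admissible_def mass_def)
  finally show ?thesis
    by (simp add: eq[OF \<rho>])
qed

section \<open>Partial problems\<close>

lemma partial_cost_le:
  "P \<in> transport_plans k \<mu> \<Longrightarrow> partial_cost k \<mu> \<le> (\<integral>\<^sup>+x. coulomb k x \<partial>P)"
  by (auto simp: partial_cost_def intro: INF_lower)

text \<open>The zero plan is feasible. This case stands apart because a measure of mass 0 cannot be
  normalised.\<close>

lemma partial_cost_null:
  fixes \<mu> :: "(real ^ 'd) measure"
  assumes \<mu>: "\<mu> \<in> subprob_measures" and mass: "mass \<mu> = 0"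
  shows "partial_cost k \<mu> = 0"
proof -
  have sets_\<mu>: "sets \<mu> = sets borel" using \<mu> by (simp add: subprob_measures_def)
  interpret finite_measure \<mu> by (rule subprob_finite_measure[OF \<mu>])
  have UN: "emeasure \<mu> UNIV = 0" using mass by (simp add: emeasure_eq_measure mass_def)
  have zero: "emeasure \<mu> A = 0" for A
    using emeasure_space[of \<mu> A] UN subprob_space[OF \<mu>] by simp
  define P :: "(nat \<Rightarrow> real ^ 'd) measure" where "P = null_measure (PiM {1..k} (\<lambda>_. borel))"
  have sets_P: "sets P = sets (PiM {1..k} (\<lambda>_. borel))" by (simp add: P_def)
  have "P \<in> transport_plans k \<mu>"
    unfolding transport_plans_def
  proof (intro CollectI conjI ballI sets_P)
    fix i assume i: "i \<in> {1..k}"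
    have "(\<lambda>x. x i) \<in> measurable P borel"
      unfolding measurable_cong_sets[OF sets_P refl] using i by (rule measurable_component_singleton)
    thus "distr P borel (\<lambda>x. x i) = \<mu>"
      by (intro measure_eqI) (auto simp: sets_\<mu> zero emeasure_distr P_def)
  qed
  hence "partial_cost k \<mu> \<le> (\<integral>\<^sup>+x. coulomb k x \<partial>P)" by (rule partial_cost_le)
  also have "\<dots> = (\<integral>\<^sup>+x. 0 \<partial>P)"
    by (rule nn_integral_cong_AE) (rule AE_I[of _ _ "space P"], auto simp: P_def)
  finally show ?thesis by simp
qed

lemma partial_strong_duality:
  fixes \<mu> :: "(real ^ 'd) measure"
  assumes \<mu>: "\<mu> \<in> subprob_measures" and k: "k \<ge> 1"
    and dual: "\<And>\<phi>. \<phi> \<in> C0 \<Longrightarrow> partial_dual k \<mu> \<phi> \<le> ereal v"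
  shows "partial_cost k \<mu> \<le> ennreal v"
proof (cases "mass \<mu> = 0")
  case True
  thus ?thesis using partial_cost_null[OF \<mu>] by simp
next
  case False
  define m where "m = mass \<mu>"
  have m: "m > 0" using False mass_nonneg[of \<mu>] by (simp add: m_def)
  have sets_\<mu>: "sets \<mu> = sets borel" using \<mu> by (simp add: subprob_measures_def)
  interpret finite_measure \<mu> by (rule subprob_finite_measure[OF \<mu>])
  \<comment> \<open>The penalty in \<open>partial_dual\<close> is weighted by the mass, so dividing
    by m gives the dual functional of a probability measure.\<close>
  define \<mu>' where "\<mu>' = density \<mu> (\<lambda>_. ennreal (1 / m))"
  have sets_\<mu>': "sets \<mu>' = sets borel" by (simp add: \<mu>'_def sets_\<mu>)
  have em: "emeasure \<mu>' A = ennreal (measure \<mu> A / m)" if "A \<in> sets borel" for A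
    using that m unfolding \<mu>'_def
    by (subst emeasure_density_const) (auto simp: sets_\<mu> emeasure_eq_measure ennreal_mult[symmetric])
  have meas: "measure \<mu>' A = measure \<mu> A / m" if "A \<in> sets borel" for A
    using m by (simp add: measure_def[of \<mu>'] em[OF that])
  have mass': "mass \<mu>' = 1" using m meas[of UNIV] by (simp add: mass_def m_def)
  have \<mu>': "\<mu>' \<in> subprob_measures"
    using em[of UNIV] m by (simp add: subprob_measures_def sets_\<mu>' m_def mass_def)
  have "dual k \<mu>' \<phi> \<le> ereal (v / m)" if \<phi>: "\<phi> \<in> C0" for \<phi>
  proof -
    have "\<phi> \<in> borel_measurable \<mu>"
      using C0_measurable[OF \<phi>] by (simp add: sets_\<mu> cong: measurable_cong_sets)
    hence "(\<integral>x. \<phi> x \<partial>\<mu>') = (\<integral>x. \<phi> x \<partial>\<mu>) / m"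
      unfolding \<mu>'_def using m by (subst integral_real_density) auto
    moreover have "(\<integral>x. \<phi> x \<partial>\<mu>) - real_of_ereal (M k \<phi>) * m \<le> v"
      using dual[OF \<phi>] unfolding partial_dual_real[OF \<phi> k] by (simp add: m_def)
    hence "((\<integral>x. \<phi> x \<partial>\<mu>) - real_of_ereal (M k \<phi>) * m) / m \<le> v / m"
      using m by (intro divide_right_mono) auto
    ultimately show ?thesis unfolding dual_real[OF \<phi> k] using m by (simp add: diff_divide_distrib)
  qed
  then obtain \<tau> where adm: "admissible k \<mu>' \<tau>" and cost: "stratified_cost k \<tau> \<le> ennreal (v / m)"
    using strong_duality[OF k \<mu>'] by blast
  have \<tau>: "\<tau> j \<in> subprob_measures" if "j \<in> {1..k}" for j using adm that by (simp add: admissible_def)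
  have comb: "measure \<mu>' A = (\<Sum>j = 1..k. real j / real k * measure (\<tau> j) A)" if "A \<in> sets borel" for A
    using adm that by (simp add: admissible_def)
  \<comment> \<open>The sum is the total mass of the strata, at most 1, minus the mass 1 of the
    normalised measure; as its terms are nonnegative, every stratum with j < k is null.\<close>
  have "(\<Sum>j = 1..k. (1 - real j / real k) * mass (\<tau> j)) = 0"
  proof (rule antisym)
    have "(\<Sum>j = 1..k. (1 - real j / real k) * mass (\<tau> j)) =
        (\<Sum>j = 1..k. mass (\<tau> j)) - (\<Sum>j = 1..k. real j / real k * mass (\<tau> j))"
      by (simp add: left_diff_distrib sum_subtractf)
    thus "(\<Sum>j = 1..k. (1 - real j / real k) * mass (\<tau> j)) \<le> 0"
      using adm comb[of UNIV] mass' by (simp add: admissible_def mass_def)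
    show "0 \<le> (\<Sum>j = 1..k. (1 - real j / real k) * mass (\<tau> j))"
      by (intro sum_nonneg mult_nonneg_nonneg mass_nonneg) auto
  qed
  hence "\<forall>j\<in>{1..k}. (1 - real j / real k) * mass (\<tau> j) = 0"
    by (subst (asm) sum_nonneg_eq_0_iff) (auto intro!: mult_nonneg_nonneg mass_nonneg)
  hence low: "mass (\<tau> j) = 0" if "j \<in> {1..k}" "j \<noteq> k" for j
    using that by fastforce
  have "\<mu>' = \<tau> k"
  proof (rule measure_eqI)
    show "sets \<mu>' = sets (\<tau> k)" using \<tau>[of k] k by (simp add: sets_\<mu>' subprob_measures_def)
    fix A assume "A \<in> sets \<mu>'"
    hence A: "A \<in> sets borel" by (simp add: sets_\<mu>')
    have "measure (\<tau> j) A = 0" if j: "j \<in> {1..k}" "j \<noteq> k" for j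
    proof -
      interpret t: finite_measure "\<tau> j" by (rule subprob_finite_measure[OF \<tau>[OF j(1)]])
      have "measure (\<tau> j) A \<le> measure (\<tau> j) UNIV"
        using \<tau>[OF j(1)] by (intro t.finite_measure_mono) (auto simp: subprob_measures_def)
      thus ?thesis using low[OF j] measure_nonneg[of "\<tau> j" A] unfolding mass_def by linarith
    qed
    hence "(\<Sum>j = 1..k. real j / real k * measure (\<tau> j) A) = (\<Sum>j\<in>{k}. real j / real k * measure (\<tau> j) A)"
      using k by (intro sum.mono_neutral_right) auto
    hence "measure \<mu>' A = measure (\<tau> k) A" using comb[OF A] k by simp
    thus "emeasure \<mu>' A = emeasure (\<tau> k) A"
      using k by (simp add: finite_measure.emeasure_eq_measure[OF subprob_finite_measure[OF \<mu>']]
          finite_measure.emeasure_eq_measure[OF subprob_finite_measure[OF \<tau>]])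
  qed
  hence "partial_cost k \<mu>' \<le> stratified_cost k \<tau>"
    unfolding stratified_cost_def using k member_le_sum[of k "{1..k}" "\<lambda>j. partial_cost j (\<tau> j)"]
    by simp
  hence le: "partial_cost k \<mu>' \<le> ennreal (v / m)" using cost by simp
  have m1: "ennreal m * ennreal (1 / m) = 1" using m by (simp add: ennreal_mult[symmetric])
  \<comment> \<open>Multiplying a plan by m leads from the normalised measure back to \<mu>, and the
    cost scales linearly.\<close>
  have scale: "partial_cost k \<mu> \<le> ennreal m * (\<integral>\<^sup>+x. coulomb k x \<partial>P)" if P: "P \<in> transport_plans k \<mu>'" for P
  proof -
    have sets_P: "sets P = sets (PiM {1..k} (\<lambda>_. borel))" using P by (simp add: transport_plans_def)
    define Q where "Q = density P (\<lambda>_. ennreal m)"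
    have sets_Q: "sets Q = sets (PiM {1..k} (\<lambda>_. borel))" by (simp add: Q_def sets_P)
    have "Q \<in> transport_plans k \<mu>"
      unfolding transport_plans_def
    proof (intro CollectI conjI ballI sets_Q)
      fix i assume i: "i \<in> {1..k}"
      have comp: "(\<lambda>x. x i) \<in> measurable P borel"
        unfolding measurable_cong_sets[OF sets_P refl] using i by (rule measurable_component_singleton)
      have compQ: "(\<lambda>x. x i) \<in> measurable Q borel"
        unfolding measurable_cong_sets[OF sets_Q refl] using i by (rule measurable_component_singleton)
      show "distr Q borel (\<lambda>x. x i) = \<mu>"
      proof (rule measure_eqI)
        fix A :: "(real ^ 'd) set" assume "A \<in> sets (distr Q borel (\<lambda>x. x i))"
        hence A: "A \<in> sets borel" by simp
        have "emeasure (distr Q borel (\<lambda>x. x i)) A = emeasure Q ((\<lambda>x. x i) -` A \<inter> space P)"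
          using emeasure_distr[OF compQ A] by (simp add: Q_def)
        also have "\<dots> = ennreal m * emeasure P ((\<lambda>x. x i) -` A \<inter> space P)"
          unfolding Q_def by (rule emeasure_density_const) (rule measurable_sets[OF comp A])
        also have "emeasure P ((\<lambda>x. x i) -` A \<inter> space P) = emeasure \<mu>' A"
          using P i emeasure_distr[OF comp A] by (auto simp: transport_plans_def)
        also have "ennreal m * emeasure \<mu>' A = emeasure \<mu> A"
          using m by (simp add: em[OF A] ennreal_mult[symmetric] emeasure_eq_measure)
        finally show "emeasure (distr Q borel (\<lambda>x. x i)) A = emeasure \<mu> A" .
      qed (simp add: sets_\<mu>)
    qed
    hence "partial_cost k \<mu> \<le> (\<integral>\<^sup>+x. coulomb k x \<partial>Q)" by (rule partial_cost_le)
    also have "\<dots> = ennreal m * (\<integral>\<^sup>+x. coulomb k x \<partial>P)"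
    proof -
      have c: "coulomb k \<in> borel_measurable P"
        unfolding measurable_cong_sets[OF sets_P refl] by (rule measurable_coulomb)
      show ?thesis unfolding Q_def
        by (subst nn_integral_density) (auto simp: c nn_integral_cmult)
    qed
    finally show ?thesis .
  qed
  have "ennreal (1 / m) * partial_cost k \<mu> \<le> partial_cost k \<mu>'"
  proof (cases "k = 1")
    case False
    have "ennreal (1 / m) * partial_cost k \<mu> \<le> (\<integral>\<^sup>+x. coulomb k x \<partial>P)"
      if "P \<in> transport_plans k \<mu>'" for P
    proof -
      have "ennreal (1 / m) * partial_cost k \<mu> \<le> ennreal (1 / m) * (ennreal m * (\<integral>\<^sup>+x. coulomb k x \<partial>P))"
        by (rule mult_left_mono[OF scale[OF that]]) simp
      thus ?thesis using m1 by (simp add: mult.assoc[symmetric] mult.commute)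
    qed
    thus ?thesis using False
      by (auto simp: partial_cost_def[of k \<mu>'] intro: INF_greatest)
  qed (simp add: partial_cost_def)
  hence "ennreal m * (ennreal (1 / m) * partial_cost k \<mu>) \<le> ennreal m * ennreal (v / m)"
    using le by (intro mult_left_mono) auto
  thus ?thesis
    using m m1 by (simp add: mult.assoc[symmetric] ennreal_mult'[symmetric])
qed

text \<open>Choose a ball of radius n that misses less than a quarter of the mass m. Up to a part of
  the plan of mass at most m / 2 the first two points both lie in it, and there their interaction is
  at least 1 / (2 n).\<close>

lemma partial_cost_pos:
  fixes \<mu> :: "(real ^ 'd) measure"
  assumes \<mu>: "\<mu> \<in> subprob_measures" and k: "k \<ge> 2" and mass: "mass \<mu> > 0"
  shows "0 < partial_cost k \<mu>"
proof -
  have sets_\<mu>: "sets \<mu> = sets borel" using \<mu> by (simp add: subprob_measures_def)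
  interpret finite_measure \<mu> by (rule subprob_finite_measure[OF \<mu>])
  define m where "m = mass \<mu>"
  have "(\<lambda>n. measure \<mu> (- cball 0 (real n))) \<longlonglongrightarrow> measure \<mu> (\<Inter>n. - cball 0 (real n))"
  proof (rule finite_Lim_measure_decseq)
    show "range (\<lambda>n. - cball 0 (real n)) \<subseteq> sets \<mu>" by (auto simp: sets_\<mu>)
    show "decseq (\<lambda>n. - cball (0 :: real ^ 'd) (real n))"
      by (auto simp: decseq_def intro: order_trans)
  qed
  moreover have "\<exists>n. x \<in> cball 0 (real n)" for x :: "real ^ 'd"
    using real_arch_simple[of "norm x"] by auto
  hence "(\<Inter>n. - cball (0 :: real ^ 'd) (real n)) = {}" by blast
  ultimately have "(\<lambda>n. measure \<mu> (- cball 0 (real n))) \<longlonglongrightarrow> 0" by simp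
  hence "\<forall>\<^sub>F n in sequentially. measure \<mu> (- cball 0 (real n)) < m / 4"
    using mass by (intro order_tendstoD) (auto simp: m_def)
  then obtain n where n: "n \<ge> 1" and tail: "measure \<mu> (- cball 0 (real n)) < m / 4"
    using eventually_happens'[OF sequentially_bot eventually_conj[OF eventually_ge_at_top[of 1]]] by blast
  define r where "r = 1 / (2 * real n)"
  have r: "r > 0" using n by (simp add: r_def)
  have "ennreal (r * m / 2) \<le> (\<integral>\<^sup>+x. coulomb k x \<partial>P)" if P: "P \<in> transport_plans k \<mu>" for P
  proof (cases "\<integral>\<^sup>+x. coulomb k x \<partial>P" rule: ennreal_cases)
    case (real c)
    have sets_P: "sets P = sets (PiM {1..k} (\<lambda>_. borel))" using P by (simp add: transport_plans_def)
    have comp: "(\<lambda>x. x i) \<in> measurable P borel" if "i \<in> {1..k}" for i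
      unfolding measurable_cong_sets[OF sets_P refl] using that by (rule measurable_component_singleton)
    have c_meas: "coulomb k \<in> borel_measurable P"
      unfolding measurable_cong_sets[OF sets_P refl] by (rule measurable_coulomb)
    define far :: "real ^ 'd \<Rightarrow> ennreal" where "far = indicator (- cball 0 (real n))"
    have far_meas: "far \<in> borel_measurable borel" by (simp add: far_def)
    have far: "(\<lambda>x. far (x i)) \<in> borel_measurable P"
      "(\<integral>\<^sup>+x. far (x i) \<partial>P) = ennreal (measure \<mu> (- cball 0 (real n)))" if i: "i \<in> {1..k}" for i
    proof -
      show "(\<lambda>x. far (x i)) \<in> borel_measurable P" by (rule measurable_compose[OF comp[OF i] far_meas])
      have "(\<integral>\<^sup>+x. far (x i) \<partial>P) = (\<integral>\<^sup>+y. far y \<partial>distr P borel (\<lambda>x. x i))"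
        by (rule nn_integral_distr[symmetric, OF comp[OF i]]) (simp add: far_meas)
      also have "distr P borel (\<lambda>x. x i) = \<mu>" using P i by (simp add: transport_plans_def)
      also have "(\<integral>\<^sup>+y. far y \<partial>\<mu>) = ennreal (measure \<mu> (- cball 0 (real n)))"
        by (simp add: far_def sets_\<mu> emeasure_eq_measure)
      finally show "(\<integral>\<^sup>+x. far (x i) \<partial>P) = ennreal (measure \<mu> (- cball 0 (real n)))" .
    qed
    have i12: "1 \<in> {1..k}" "2 \<in> {1..k}" using k by auto
    \<comment> \<open>Either both points are in the ball or one of the two indicators equals 1.
      Integrated, the bound gives \<open>r * m\<close> at most c plus half of
      \<open>r * m\<close>.\<close>
    have pt: "ennreal r \<le> coulomb k x + ennreal r * (far (x 1) + far (x 2))" for x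
    proof (cases "x 1 \<in> cball 0 (real n) \<and> x 2 \<in> cball 0 (real n)")
      case True
      hence d: "norm (x 1 - x 2) \<le> 2 * real n"
        using norm_triangle_ineq4[of "x 1" "x 2"] by simp
      have "ennreal r \<le> 1 / ennreal (norm (x 1 - x 2))"
      proof (cases "x 1 = x 2")
        case False
        hence "1 / ennreal (norm (x 1 - x 2)) = ennreal (1 / norm (x 1 - x 2))"
          using divide_ennreal[of 1 "norm (x 1 - x 2)"] by simp
        moreover have "r \<le> 1 / norm (x 1 - x 2)"
          unfolding r_def using False d n by (intro divide_left_mono mult_pos_pos) auto
        ultimately show ?thesis by (simp only: ennreal_leI)
      qed (simp add: ennreal_divide_zero)
      moreover have "(case (1, 2) of (i, j) \<Rightarrow> 1 / ennreal (norm (x i - x j))) \<le> coulomb k x"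
        unfolding coulomb_def
      proof (rule member_le_sum)
        show "(1, 2) \<in> {(i, j). 1 \<le> i \<and> i < j \<and> j \<le> k}" using k by simp
        show "finite {(i, j). 1 \<le> i \<and> i < j \<and> j \<le> k}"
          by (rule finite_subset[of _ "{1..k} \<times> {1..k}"]) auto
      qed simp
      ultimately have "ennreal r \<le> coulomb k x" by simp
      thus ?thesis by (simp add: add_increasing2)
    next
      case False
      hence "1 \<le> far (x 1) + far (x 2)" by (auto simp: far_def indicator_def)
      hence "ennreal r * 1 \<le> ennreal r * (far (x 1) + far (x 2))" by (intro mult_left_mono) auto
      thus ?thesis by (simp add: add_increasing)
    qed
    have "ennreal (r * m) = (\<integral>\<^sup>+x. ennreal r \<partial>P)"
      using plan_finite[OF \<mu> P] k r
      by (simp add: finite_measure.emeasure_eq_measure ennreal_mult m_def mass_nonneg)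
    also have "\<dots> \<le> (\<integral>\<^sup>+x. coulomb k x + ennreal r * (far (x 1) + far (x 2)) \<partial>P)"
      by (intro nn_integral_mono pt)
    also have "\<dots> = (\<integral>\<^sup>+x. coulomb k x \<partial>P) + ennreal r * ((\<integral>\<^sup>+x. far (x 1) \<partial>P) + (\<integral>\<^sup>+x. far (x 2) \<partial>P))"
      using c_meas far(1)[OF i12(1)] far(1)[OF i12(2)] by (simp add: nn_integral_add nn_integral_cmult)
    also have "\<dots> = ennreal (c + r * (measure \<mu> (- cball 0 (real n)) + measure \<mu> (- cball 0 (real n))))"
      using real r unfolding far(2)[OF i12(1)] far(2)[OF i12(2)]
      by (simp only: ennreal_plus ennreal_mult add_nonneg_nonneg mult_nonneg_nonneg measure_nonneg
          less_imp_le)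
    finally have "r * m \<le> c + r * (measure \<mu> (- cball 0 (real n)) + measure \<mu> (- cball 0 (real n)))"
      using real r by (subst (asm) ennreal_le_iff) (auto intro!: add_nonneg_nonneg)
    also have "r * (measure \<mu> (- cball 0 (real n)) + measure \<mu> (- cball 0 (real n))) \<le> r * (m / 2)"
      using tail r by (intro mult_left_mono) auto
    finally show ?thesis using real by (auto intro!: ennreal_leI)
  qed simp
  hence "ennreal (r * m / 2) \<le> partial_cost k \<mu>"
    using k by (auto simp: partial_cost_def intro: INF_greatest)
  moreover have "0 < ennreal (r * m / 2)" using r mass by (simp add: m_def)
  ultimately show ?thesis by (rule less_le_trans[rotated])
qed

section \<open>Rescaled potentials and the slack identity\<close>

definition scaled_M :: "nat \<Rightarrow> nat \<Rightarrow> (real ^ 'd \<Rightarrow> real) \<Rightarrow> real" where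
  "scaled_M N k \<phi> = real_of_ereal (M k (\<lambda>x. real k * \<phi> x / real N))"

definition scaled_dual :: "nat \<Rightarrow> nat \<Rightarrow> (real ^ 'd) measure \<Rightarrow> (real ^ 'd \<Rightarrow> real) \<Rightarrow> real" where
  "scaled_dual N k \<mu> \<phi> = (\<integral>x. real k * \<phi> x / real N \<partial>\<mu>) - scaled_M N k \<phi> * mass \<mu>"

lemma M_eq_scaled_M:
  assumes "\<phi> \<in> C0" "k \<ge> 1"
  shows "M k (\<lambda>x. real k * \<phi> x / real N) = ereal (scaled_M N k \<phi>)"
  unfolding scaled_M_def by (rule M_real[OF C0_scale[OF assms(1)] assms(2)])

lemma scaled_M_mono:
  assumes "\<phi> \<in> C0" "1 \<le> k" "k \<le> l"
  shows "scaled_M N k \<phi> \<le> scaled_M N l \<phi>"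
  using M_scaled_mono[OF assms(1,3), of N] M_eq_scaled_M[OF assms(1,2)] M_eq_scaled_M[OF assms(1), of l] assms
  by simp

lemma scaled_M_nonneg:
  assumes "\<phi> \<in> C0" "1 \<le> k"
  shows "0 \<le> scaled_M N k \<phi>"
  using M_scaled_nonneg[OF assms(1), of k N] M_eq_scaled_M[OF assms] by simp

lemma M_eq_scaled_M_top:
  assumes "\<phi> \<in> C0" "N \<ge> 1"
  shows "M N \<phi> = ereal (scaled_M N N \<phi>)"
  using M_eq_scaled_M[OF assms, of N] assms(2) by simp

lemma partial_dual_eq_scaled_dual:
  assumes "\<phi> \<in> C0" "k \<ge> 1"
  shows "partial_dual k \<mu> (\<lambda>x. real k * \<phi> x / real N) = ereal (scaled_dual N k \<mu> \<phi>)"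
  unfolding scaled_dual_def scaled_M_def by (rule partial_dual_real[OF C0_scale[OF assms(1)] assms(2)])

text \<open>The two subtracted terms are nonnegative; optimality of both problems makes them vanish.\<close>

lemma dual_decomposition:
  assumes \<rho>: "\<rho> \<in> subprob_measures" and adm: "admissible N \<rho> \<sigma>" and \<phi>: "\<phi> \<in> C0" and N: "N \<ge> 1"
  shows "dual N \<rho> \<phi> = ereal ((\<Sum>k = 1..N. scaled_dual N k (\<sigma> k) \<phi>) -
    (\<Sum>k = 1..N. (scaled_M N N \<phi> - scaled_M N k \<phi>) * mass (\<sigma> k)) -
    scaled_M N N \<phi> * (1 - (\<Sum>k = 1..N. mass (\<sigma> k))))"
proof -
  have "dual N \<rho> \<phi> = ereal ((\<integral>x. \<phi> x \<partial>\<rho>) - scaled_M N N \<phi>)"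
    unfolding dual_def M_eq_scaled_M_top[OF \<phi> N] by simp
  also have "(\<integral>x. \<phi> x \<partial>\<rho>) = (\<Sum>k = 1..N. \<integral>x. real k * \<phi> x / real N \<partial>\<sigma> k)"
    by (rule integral_admissible[OF \<rho> adm \<phi>])
  finally show ?thesis
    by (simp add: scaled_dual_def sum_subtractf left_diff_distrib right_diff_distrib sum_distrib_left)
qed

lemma stratified_cost_finite:
  assumes "stratified_cost N \<sigma> \<noteq> top"
  obtains \<gamma> where "\<And>k. 0 \<le> \<gamma> k" "\<And>k. k \<in> {1..N} \<Longrightarrow> partial_cost k (\<sigma> k) = ennreal (\<gamma> k)"
    "stratified_cost N \<sigma> = ennreal (\<Sum>k = 1..N. \<gamma> k)"
proof (rule that)
  let ?\<gamma> = "\<lambda>k. enn2real (partial_cost k (\<sigma> k))"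
  show "0 \<le> ?\<gamma> k" for k by simp
  show eq: "partial_cost k (\<sigma> k) = ennreal (?\<gamma> k)" if "k \<in> {1..N}" for k
  proof -
    have "partial_cost k (\<sigma> k) \<le> stratified_cost N \<sigma>"
      unfolding stratified_cost_def
      using that by (intro member_le_sum[of k "{1..N}" "\<lambda>k. partial_cost k (\<sigma> k)"]) auto
    hence "partial_cost k (\<sigma> k) < top" using assms by (auto simp: top_unique less_top)
    thus ?thesis by simp
  qed
  have "stratified_cost N \<sigma> = (\<Sum>k = 1..N. ennreal (?\<gamma> k))"
    unfolding stratified_cost_def by (intro sum.cong refl eq)
  also have "\<dots> = ennreal (\<Sum>k = 1..N. ?\<gamma> k)" by (rule sum_ennreal) simp
  finally show "stratified_cost N \<sigma> = ennreal (\<Sum>k = 1..N. ?\<gamma> k)" .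
qed

lemma scaled_dual_le:
  assumes "\<mu> \<in> subprob_measures" "\<phi> \<in> C0" "k \<ge> 1" "partial_cost k \<mu> = ennreal \<gamma>" "0 \<le> \<gamma>"
  shows "scaled_dual N k \<mu> \<phi> \<le> \<gamma>"
  using weak_partial_duality[OF assms(1) C0_scale[OF assms(2)] assms(3), of "real k" "real N"] assms(4,5)
  by (simp add: scaled_dual_def scaled_M_def ennreal_le_iff)

lemma weak_duality:
  assumes \<rho>: "\<rho> \<in> subprob_measures" and adm: "admissible N \<rho> \<sigma>" and \<phi>: "\<phi> \<in> C0" and N: "N \<ge> 1"
  shows "dual N \<rho> \<phi> \<le> enn2ereal (stratified_cost N \<sigma>)"
proof (cases "stratified_cost N \<sigma> = top")
  case False
  then obtain \<gamma> where \<gamma>: "\<And>k. 0 \<le> \<gamma> k" "\<And>k. k \<in> {1..N} \<Longrightarrow> partial_cost k (\<sigma> k) = ennreal (\<gamma> k)"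
    "stratified_cost N \<sigma> = ennreal (\<Sum>k = 1..N. \<gamma> k)"
    by (rule stratified_cost_finite) (rule that)
  have \<sigma>: "\<sigma> k \<in> subprob_measures" if "k \<in> {1..N}" for k using adm that by (simp add: admissible_def)
  have "(\<Sum>k = 1..N. scaled_dual N k (\<sigma> k) \<phi>) \<le> (\<Sum>k = 1..N. \<gamma> k)"
    by (intro sum_mono scaled_dual_le[OF \<sigma> \<phi> _ \<gamma>(2,1)]) auto
  moreover have "0 \<le> (\<Sum>k = 1..N. (scaled_M N N \<phi> - scaled_M N k \<phi>) * mass (\<sigma> k))"
    using scaled_M_mono[OF \<phi>] by (intro sum_nonneg mult_nonneg_nonneg mass_nonneg) auto
  moreover have "0 \<le> scaled_M N N \<phi> * (1 - (\<Sum>k = 1..N. mass (\<sigma> k)))"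
    using adm by (intro mult_nonneg_nonneg scaled_M_nonneg \<phi> N) (simp add: admissible_def)
  ultimately show ?thesis
    unfolding dual_decomposition[OF assms] using \<gamma>(1,3) by (simp add: enn2ereal_ennreal sum_nonneg)
qed simp

section \<open>Optimality conditions\<close>

text \<open>The value at x has to be a real number: a maximizer with infinite value gives no
  maximizing sequence, because the supremum must be finite.\<close>

lemma maximizing_seq_const:
  assumes "F x = ereal r"
  shows "maximizing_seq F S (\<lambda>_. x) \<longleftrightarrow> maximizer F S x"
  using assms by (auto simp: maximizing_seq_def maximizer_def LIMSEQ_const_iff)

lemma SUP_eq_limit:
  fixes F :: "'b \<Rightarrow> ereal"
  assumes "\<And>n. x n \<in> S" "\<And>y. y \<in> S \<Longrightarrow> F y \<le> l" "(\<lambda>n. F (x n)) \<longlonglongrightarrow> l"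
  shows "(SUP y\<in>S. F y) = l"
proof (rule antisym)
  show "(SUP y\<in>S. F y) \<le> l" using assms(2) by (rule SUP_least)
  show "l \<le> (SUP y\<in>S. F y)"
    by (rule LIMSEQ_le_const2[OF assms(3)]) (auto intro!: SUP_upper assms(1))
qed

text \<open>An upper bound that is approached by values is the supremum, which is thereby finite as
  well.\<close>

lemma maximizing_seqI:
  fixes F :: "'b \<Rightarrow> ereal"
  assumes "\<And>n. x n \<in> S" "\<And>y. y \<in> S \<Longrightarrow> F y \<le> ereal v" "(\<lambda>n. F (x n)) \<longlonglongrightarrow> ereal v"
  shows "maximizing_seq F S x"
  using assms SUP_eq_limit[of x S F "ereal v"] by (simp add: maximizing_seq_def)

lemma optimal_sequence_imp_conditions:
  fixes \<rho> :: "(real ^ 'd) measure" and \<phi> :: "nat \<Rightarrow> real ^ 'd \<Rightarrow> real"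
  assumes N: "N \<ge> 2" and \<rho>: "\<rho> \<in> subprob_measures" and mass: "mass \<rho> > 1 / real N"
    and opt: "optimal_S N \<rho> \<sigma>" and max: "maximizing_seq (dual N \<rho>) C0 \<phi>"
  shows "(\<Sum>k = 1..N. mass (\<sigma> k)) = 1" (is "?total = 1")
    and "k \<in> {1..N} \<Longrightarrow>
      maximizing_seq (partial_dual k (\<sigma> k)) C0 (\<lambda>n x. real k * \<phi> n x / real N)"
    and "\<lbrakk>k \<in> {1..N}; l \<in> {1..k}; mass (\<sigma> l) > 0\<rbrakk> \<Longrightarrow>
      (\<lambda>n. M N (\<phi> n) - M k (\<lambda>x. real k * \<phi> n x / real N)) \<longlonglongrightarrow> 0"
proof -
  have N1: "N \<ge> 1" using N by simp
  have \<phi>: "\<phi> n \<in> C0" for n using max by (simp add: maximizing_seq_def)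
  have adm: "admissible N \<rho> \<sigma>"
    and inf: "stratified_cost N \<sigma> = (INF \<tau> \<in> {\<tau>. admissible N \<rho> \<tau>}. stratified_cost N \<tau>)"
    using opt by (auto simp: optimal_S_def)
  have \<sigma>: "\<sigma> k \<in> subprob_measures" if "k \<in> {1..N}" for k using adm that by (simp add: admissible_def)
  have total: "?total \<le> 1" using adm by (simp add: admissible_def)
  obtain V where V: "(SUP y\<in>C0. dual N \<rho> y) = ereal V" and lim: "(\<lambda>n. dual N \<rho> (\<phi> n)) \<longlonglongrightarrow> ereal V"
    using max unfolding maximizing_seq_def by (cases "SUP y\<in>C0. dual N \<rho> y") auto
  have upper: "dual N \<rho> y \<le> ereal V" if "y \<in> C0" for y
    unfolding V[symmetric] using that by (rule SUP_upper)
  have V0: "0 \<le> V" using order_trans[OF dual_zero upper[OF zero_in_C0]] by simp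
  obtain \<tau> where "admissible N \<rho> \<tau>" "stratified_cost N \<tau> \<le> ennreal V"
    using strong_duality[OF N1 \<rho> upper] by blast
  hence cost: "stratified_cost N \<sigma> \<le> ennreal V"
    unfolding inf by (intro INF_lower2[of \<tau>]) auto
  hence "stratified_cost N \<sigma> \<noteq> top" by (auto simp: top_unique)
  then obtain \<gamma> where \<gamma>: "\<And>k. 0 \<le> \<gamma> k" "\<And>k. k \<in> {1..N} \<Longrightarrow> partial_cost k (\<sigma> k) = ennreal (\<gamma> k)"
    "stratified_cost N \<sigma> = ennreal (\<Sum>k = 1..N. \<gamma> k)"
    by (rule stratified_cost_finite) (rule that)
  \<comment> \<open>Strong duality enters here: the optimal cost does not exceed the dual
    supremum.\<close>
  have sum_\<gamma>: "(\<Sum>k = 1..N. \<gamma> k) \<le> V" using cost V0 by (simp add: \<gamma>(3) ennreal_le_iff)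
  define t where "t n k = scaled_dual N k (\<sigma> k) (\<phi> n)" for n k
  define m where "m n k = scaled_M N k (\<phi> n)" for n k
  define d where "d n = (\<Sum>k = 1..N. t n k) - (\<Sum>k = 1..N. (m n N - m n k) * mass (\<sigma> k)) -
    m n N * (1 - ?total)" for n
  have d: "dual N \<rho> (\<phi> n) = ereal (d n)" for n
    unfolding d_def t_def m_def by (rule dual_decomposition[OF \<rho> adm \<phi> N1])
  have "d \<longlonglongrightarrow> V" using lim by (simp add: d)
  hence gap: "(\<lambda>n. V - d n) \<longlonglongrightarrow> 0" using tendsto_diff[OF tendsto_const, of d V _ V] by simp
  have s1: "0 \<le> \<gamma> k - t n k" if "k \<in> {1..N}" for n k
    using scaled_dual_le[OF \<sigma>[OF that] \<phi> _ \<gamma>(2)[OF that] \<gamma>(1)] that by (simp add: t_def)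
  have m_mono: "m n k \<le> m n l" if "1 \<le> k" "k \<le> l" for n k l
    unfolding m_def by (rule scaled_M_mono[OF \<phi> that])
  have m_nonneg: "0 \<le> m n k" if "1 \<le> k" for n k
    unfolding m_def by (rule scaled_M_nonneg[OF \<phi> that])
  have s2: "0 \<le> (m n N - m n k) * mass (\<sigma> k)" if "k \<in> {1..N}" for n k
    using that m_mono[of k N n] by (intro mult_nonneg_nonneg mass_nonneg) auto
  have s3: "0 \<le> m n N * (1 - ?total)" for n
    using total N1 by (intro mult_nonneg_nonneg m_nonneg) auto
  \<comment> \<open>Every term on the left is nonnegative, so each of them is squeezed between 0 and
    \<open>V - d n\<close>.\<close>
  have slack: "(\<Sum>k = 1..N. \<gamma> k - t n k) + (\<Sum>k = 1..N. (m n N - m n k) * mass (\<sigma> k)) +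
      m n N * (1 - ?total) \<le> V - d n" for n
    using sum_\<gamma> unfolding d_def by (simp add: sum_subtractf)
  have S1: "0 \<le> (\<Sum>k = 1..N. \<gamma> k - t n k)" for n by (intro sum_nonneg s1)
  have S2: "0 \<le> (\<Sum>k = 1..N. (m n N - m n k) * mass (\<sigma> k))" for n by (intro sum_nonneg s2)
  have squeeze: "f \<longlonglongrightarrow> 0" if "\<And>n. 0 \<le> f n" "\<And>n. f n \<le> V - d n" for f
    by (rule tendsto_sandwich[OF _ _ tendsto_const gap]) (use that in auto)
  have t_lim: "(\<lambda>n. t n k) \<longlonglongrightarrow> \<gamma> k" if k: "k \<in> {1..N}" for k
  proof -
    have term_le: "\<gamma> k - t n k \<le> (\<Sum>k = 1..N. \<gamma> k - t n k)" for n
      by (rule member_le_sum[where f = "\<lambda>k. \<gamma> k - t n k", OF k]) (rule s1, blast, simp)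
    have "\<gamma> k - t n k \<le> V - d n" for n
      using term_le[of n] slack[of n] S2[of n] s3[of n] by linarith
    hence "(\<lambda>n. \<gamma> k - t n k) \<longlonglongrightarrow> 0" by (intro squeeze s1[OF k])
    from tendsto_diff[OF tendsto_const[of "\<gamma> k"] this] show ?thesis by simp
  qed
  have m_lim: "(\<lambda>n. (m n N - m n k) * mass (\<sigma> k)) \<longlonglongrightarrow> 0" if k: "k \<in> {1..N}" for k
  proof -
    have term_le: "(m n N - m n k) * mass (\<sigma> k) \<le> (\<Sum>k = 1..N. (m n N - m n k) * mass (\<sigma> k))" for n
      by (rule member_le_sum[where f = "\<lambda>k. (m n N - m n k) * mass (\<sigma> k)", OF k]) (rule s2, blast, simp)
    have "(m n N - m n k) * mass (\<sigma> k) \<le> V - d n" for n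
      using term_le[of n] slack[of n] S1[of n] s3[of n] by linarith
    thus ?thesis by (intro squeeze s2[OF k])
  qed
  have top_lim: "(\<lambda>n. m n N * (1 - ?total)) \<longlonglongrightarrow> 0"
  proof (rule squeeze[OF s3])
    show "m n N * (1 - ?total) \<le> V - d n" for n
      using slack[of n] S1[of n] S2[of n] by linarith
  qed
  show "maximizing_seq (partial_dual k (\<sigma> k)) C0 (\<lambda>n x. real k * \<phi> n x / real N)"
    if k: "k \<in> {1..N}" for k
  proof (rule maximizing_seqI)
    show "(\<lambda>x. real k * \<phi> n x / real N) \<in> C0" for n by (rule C0_scale[OF \<phi>])
    show "partial_dual k (\<sigma> k) y \<le> ereal (\<gamma> k)" if "y \<in> C0" for y
      unfolding enn2ereal_ennreal[OF \<gamma>(1), symmetric] \<gamma>(2)[OF k, symmetric]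
      by (rule partial_dual_le_cost[OF \<sigma>[OF k] that]) (use k in simp)
    show "(\<lambda>n. partial_dual k (\<sigma> k) (\<lambda>x. real k * \<phi> n x / real N)) \<longlonglongrightarrow> ereal (\<gamma> k)"
      using t_lim[OF k] k by (simp add: partial_dual_eq_scaled_dual[OF \<phi>] t_def)
  qed
  show "(\<lambda>n. M N (\<phi> n) - M k (\<lambda>x. real k * \<phi> n x / real N)) \<longlonglongrightarrow> 0"
    if k: "k \<in> {1..N}" and l: "l \<in> {1..k}" and pos: "mass (\<sigma> l) > 0" for k l
  proof -
    have "(\<lambda>n. (m n N - m n l) * mass (\<sigma> l) / mass (\<sigma> l)) \<longlonglongrightarrow> 0 / mass (\<sigma> l)"
      using k l pos by (intro tendsto_divide m_lim tendsto_const) auto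
    hence "(\<lambda>n. m n N - m n l) \<longlonglongrightarrow> 0" using pos by simp
    \<comment> \<open>The limit passes from l to every larger k, since \<open>m n k\<close> lies
      between \<open>m n l\<close> and \<open>m n N\<close>.\<close>
    hence "(\<lambda>n. m n N - m n k) \<longlonglongrightarrow> 0"
      by (rule tendsto_sandwich[OF _ _ tendsto_const, rotated 2])
         (use k l m_mono in auto)
    moreover have "M N (\<phi> n) - M k (\<lambda>x. real k * \<phi> n x / real N) = ereal (m n N - m n k)" for n
      using k by (simp add: M_eq_scaled_M_top[OF \<phi> N1] M_eq_scaled_M[OF \<phi>] m_def)
    ultimately show ?thesis by (simp add: zero_ereal_def)
  qed
  show "?total = 1"
  proof (rule ccontr)
    assume "?total \<noteq> 1"
    hence pos: "1 - ?total > 0" using total by simp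
    have "(\<lambda>n. m n N * (1 - ?total) / (1 - ?total)) \<longlonglongrightarrow> 0 / (1 - ?total)"
      using pos by (intro tendsto_divide top_lim tendsto_const) auto
    hence top0: "(\<lambda>n. m n N) \<longlonglongrightarrow> 0" using pos by simp
    \<comment> \<open>The first measure alone contributes at most mass 1 / N, so the assumption on
      \<rho> forces mass on a higher stratum.\<close>
    have "\<exists>k\<in>{2..N}. mass (\<sigma> k) > 0"
    proof (rule ccontr)
      assume "\<not> ?thesis"
      hence "\<not> mass (\<sigma> k) > 0" if "k \<in> {2..N}" for k using that by blast
      hence zero: "mass (\<sigma> k) = 0" if "k \<in> {2..N}" for k
        using that mass_nonneg[of "\<sigma> k"] by (simp add: order.antisym not_less)
      have "mass \<rho> = (\<Sum>k = 1..N. real k / real N * mass (\<sigma> k))"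
        using adm by (simp add: admissible_def mass_def)
      also have "\<dots> = (\<Sum>k\<in>{1}. real k / real N * mass (\<sigma> k))"
        using N by (intro sum.mono_neutral_right) (auto intro!: zero)
      also have "\<dots> \<le> 1 / real N"
        using mass_le_1[OF \<sigma>, of 1] N by (simp add: divide_right_mono)
      finally show False using mass by simp
    qed
    then obtain k where k: "k \<in> {2..N}" "mass (\<sigma> k) > 0" by blast
    hence k1: "k \<in> {1..N}" by auto
    have "0 < partial_cost k (\<sigma> k)" using k by (intro partial_cost_pos \<sigma>[OF k1]) auto
    hence "0 < \<gamma> k" by (simp add: \<gamma>(2)[OF k1])
    \<comment> \<open>The potential divided by N is bounded by the one-point value, hence by
      \<open>m n N\<close>. The dual values of stratum k would then have a limit at most 0, against
      its positive cost.\<close>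
    moreover have "t n k \<le> real k * m n N" for n
    proof -
      interpret finite_measure "\<sigma> k" by (rule subprob_finite_measure[OF \<sigma>[OF k1]])
      have "\<phi> n x / real N \<le> m n N" for x
      proof -
        have "ereal (1 * \<phi> n x / real N) \<le> M 1 (\<lambda>x. real 1 * \<phi> n x / real N)"
          using le_M_1[of "\<lambda>x. real 1 * \<phi> n x / real N" x] by simp
        also have "\<dots> = ereal (m n 1)" unfolding m_def by (rule M_eq_scaled_M[OF \<phi>]) simp
        finally show ?thesis using m_mono[of 1 N n] N1 by simp
      qed
      hence "real k * (\<phi> n x / real N) \<le> real k * m n N" for x by (intro mult_left_mono) auto
      hence "(\<integral>x. real k * \<phi> n x / real N \<partial>\<sigma> k) \<le> (\<integral>x. real k * m n N \<partial>\<sigma> k)"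
        by (intro integral_mono integrable_C0[OF \<sigma>[OF k1] C0_scale[OF \<phi>]]) auto
      also have "\<dots> = real k * m n N * mass (\<sigma> k)"
        using subprob_space[OF \<sigma>[OF k1]] by (simp add: mass_def)
      also have "\<dots> \<le> real k * m n N * 1"
        using mass_le_1[OF \<sigma>[OF k1]] m_nonneg[OF N1, of n] by (intro mult_left_mono) auto
      finally have "(\<integral>x. real k * \<phi> n x / real N \<partial>\<sigma> k) \<le> real k * m n N" by simp
      moreover have "0 \<le> m n k * mass (\<sigma> k)"
        using k1 by (intro mult_nonneg_nonneg m_nonneg mass_nonneg) auto
      ultimately show ?thesis by (simp add: t_def scaled_dual_def m_def)
    qed
    hence "\<gamma> k \<le> real k * 0"
      by (intro LIMSEQ_le[OF t_lim[OF k1] tendsto_mult[OF tendsto_const top0]]) auto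
    ultimately show False by simp
  qed
qed

text \<open>The dual values tend to V, the sum of the partial suprema, since all slack disappears.
  Partial strong duality bounds the cost of \<sigma> by V, while weak duality bounds every
  admissible cost from below by V; both optimality claims follow.\<close>

lemma conditions_imp_optimal_sequence:
  fixes \<rho> :: "(real ^ 'd) measure" and \<phi> :: "nat \<Rightarrow> real ^ 'd \<Rightarrow> real"
  assumes N: "N \<ge> 1" and \<rho>: "\<rho> \<in> subprob_measures" and adm: "admissible N \<rho> \<sigma>"
    and \<phi>: "\<And>n. \<phi> n \<in> C0"
    and total: "(\<Sum>k = 1..N. mass (\<sigma> k)) = 1"
    and max: "\<And>k. k \<in> {1..N} \<Longrightarrow>
      maximizing_seq (partial_dual k (\<sigma> k)) C0 (\<lambda>n x. real k * \<phi> n x / real N)"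
    and M_lim: "\<And>k. \<lbrakk>k \<in> {1..N}; mass (\<sigma> k) > 0\<rbrakk> \<Longrightarrow>
      (\<lambda>n. M N (\<phi> n) - M k (\<lambda>x. real k * \<phi> n x / real N)) \<longlonglongrightarrow> 0"
  shows "optimal_S N \<rho> \<sigma>" "maximizing_seq (dual N \<rho>) C0 \<phi>"
proof -
  have \<sigma>: "\<sigma> k \<in> subprob_measures" if "k \<in> {1..N}" for k using adm that by (simp add: admissible_def)
  define v where "v k = real_of_ereal (SUP y\<in>C0. partial_dual k (\<sigma> k) y)" for k
  define t where "t n k = scaled_dual N k (\<sigma> k) (\<phi> n)" for n k
  define m where "m n k = scaled_M N k (\<phi> n)" for n k
  have v: "(SUP y\<in>C0. partial_dual k (\<sigma> k) y) = ereal (v k)" if "k \<in> {1..N}" for k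
    using max[OF that] unfolding maximizing_seq_def v_def by (simp add: ereal_real)
  have v_upper: "partial_dual k (\<sigma> k) y \<le> ereal (v k)" if "k \<in> {1..N}" "y \<in> C0" for k y
    unfolding v[OF that(1), symmetric] using that(2) by (rule SUP_upper)
  have v_nonneg: "0 \<le> v k" if "k \<in> {1..N}" for k
    using order_trans[OF partial_dual_zero v_upper[OF that zero_in_C0]] by simp
  have t_lim: "(\<lambda>n. t n k) \<longlonglongrightarrow> v k" if k: "k \<in> {1..N}" for k
    using max[OF k] k unfolding maximizing_seq_def v[OF k]
    by (simp add: partial_dual_eq_scaled_dual[OF \<phi>] t_def)
  have slack_lim: "(\<lambda>n. (m n N - m n k) * mass (\<sigma> k)) \<longlonglongrightarrow> 0" if k: "k \<in> {1..N}" for k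
  proof (cases "mass (\<sigma> k) > 0")
    case True
    have "M N (\<phi> n) - M k (\<lambda>x. real k * \<phi> n x / real N) = ereal (m n N - m n k)" for n
      using k by (simp add: M_eq_scaled_M_top[OF \<phi> N] M_eq_scaled_M[OF \<phi>] m_def)
    hence "(\<lambda>n. m n N - m n k) \<longlonglongrightarrow> 0" using M_lim[OF k True] by (simp add: zero_ereal_def)
    from tendsto_mult[OF this tendsto_const] show ?thesis by simp
  next
    case False
    \<comment> \<open>Without mass on stratum k the limit hypothesis is silent, but the slack
      carries the factor 0.\<close>
    hence "mass (\<sigma> k) = 0" using mass_nonneg[of "\<sigma> k"] by linarith
    thus ?thesis by simp
  qed
  define V where "V = (\<Sum>k = 1..N. v k)"
  have V0: "0 \<le> V" unfolding V_def by (intro sum_nonneg v_nonneg)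
  have "dual N \<rho> (\<phi> n) = ereal ((\<Sum>k = 1..N. t n k) - (\<Sum>k = 1..N. (m n N - m n k) * mass (\<sigma> k)))" for n
    unfolding dual_decomposition[OF \<rho> adm \<phi> N] total t_def m_def by simp
  moreover have "(\<lambda>n. (\<Sum>k = 1..N. t n k) - (\<Sum>k = 1..N. (m n N - m n k) * mass (\<sigma> k)))
      \<longlonglongrightarrow> V - (\<Sum>k = 1..N. 0)"
    unfolding V_def by (intro tendsto_diff tendsto_sum t_lim slack_lim)
  ultimately have lim: "(\<lambda>n. dual N \<rho> (\<phi> n)) \<longlonglongrightarrow> ereal V" by simp
  have "stratified_cost N \<sigma> \<le> (\<Sum>k = 1..N. ennreal (v k))"
    unfolding stratified_cost_def
    by (intro sum_mono partial_strong_duality \<sigma> v_upper) auto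
  also have "\<dots> = ennreal V" unfolding V_def by (intro sum_ennreal v_nonneg)
  finally have cost: "stratified_cost N \<sigma> \<le> ennreal V" .
  have lower: "ennreal V \<le> stratified_cost N \<tau>" if "admissible N \<rho> \<tau>" for \<tau>
  proof -
    have "ereal V \<le> enn2ereal (stratified_cost N \<tau>)"
      by (rule LIMSEQ_le_const2[OF lim]) (auto intro!: weak_duality[OF \<rho> that \<phi> N])
    thus ?thesis using V0 by (simp add: less_eq_ennreal.rep_eq enn2ereal_ennreal)
  qed
  show "optimal_S N \<rho> \<sigma>"
    unfolding optimal_S_def
  proof (intro conjI adm antisym)
    show "stratified_cost N \<sigma> \<le> (INF \<tau> \<in> {\<tau>. admissible N \<rho> \<tau>}. stratified_cost N \<tau>)"
      using order_trans[OF cost lower] by (auto intro!: INF_greatest)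
    show "(INF \<tau> \<in> {\<tau>. admissible N \<rho> \<tau>}. stratified_cost N \<tau>) \<le> stratified_cost N \<sigma>"
      using adm by (auto intro!: INF_lower)
  qed
  show "maximizing_seq (dual N \<rho>) C0 \<phi>"
  proof (rule maximizing_seqI)
    show "\<phi> n \<in> C0" for n by (rule \<phi>)
    show "(\<lambda>n. dual N \<rho> (\<phi> n)) \<longlonglongrightarrow> ereal V" by (rule lim)
    fix y :: "real ^ 'd \<Rightarrow> real" assume "y \<in> C0"
    hence "dual N \<rho> y \<le> enn2ereal (stratified_cost N \<sigma>)" by (rule weak_duality[OF \<rho> adm _ N])
    also have "\<dots> \<le> enn2ereal (ennreal V)" using cost by (simp add: less_eq_ennreal.rep_eq)
    also have "\<dots> = ereal V" using V0 by (rule enn2ereal_ennreal)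
    finally show "dual N \<rho> y \<le> ereal V" .
  qed
qed

theorem theorem3p12:
  fixes N :: nat
    and \<rho> :: "(real ^ 'd) measure"
    and \<rho>s :: "nat \<Rightarrow> (real ^ 'd) measure"
  assumes "N \<ge> 2"
    and "\<rho> \<in> subprob_measures"
    and "mass \<rho> > 1 / real N"
    and "\<forall>k\<in>{1..N}. \<rho>s k \<in> subprob_measures"
    and "\<forall>A\<in>sets borel. measure \<rho> A = (\<Sum>k = 1..N. real k / real N * measure (\<rho>s k) A)"
    and "(\<Sum>k = 1..N. mass (\<rho>s k)) \<le> 1"
  shows
    "(\<forall>\<phi>\<in>C0.
        optimal_S N \<rho> \<rho>s \<and> maximizer (dual N \<rho>) C0 \<phi> \<longleftrightarrow>
          (\<Sum>k = 1..N. mass (\<rho>s k)) = 1 \<and>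
          (\<forall>k\<in>{1..N}. maximizer (partial_dual k (\<rho>s k)) C0 (\<lambda>x. real k * \<phi> x / real N)) \<and>
          (\<forall>k\<in>{1..N}. (\<exists>l\<in>{1..k}. mass (\<rho>s l) > 0) \<longrightarrow>
             M k (\<lambda>x. real k * \<phi> x / real N) = M N \<phi>)) \<and>
     (\<forall>\<phi> :: nat \<Rightarrow> real ^ 'd \<Rightarrow> real. (\<forall>n. \<phi> n \<in> C0) \<longrightarrow>
        (optimal_S N \<rho> \<rho>s \<and> maximizing_seq (dual N \<rho>) C0 \<phi> \<longleftrightarrow>
          (\<Sum>k = 1..N. mass (\<rho>s k)) = 1 \<and>
          (\<forall>k\<in>{1..N}. maximizing_seq (partial_dual k (\<rho>s k)) C0 (\<lambda>n x. real k * \<phi> n x / real N)) \<and>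
          (\<forall>k\<in>{1..N}. (\<exists>l\<in>{1..k}. mass (\<rho>s l) > 0) \<longrightarrow>
             (\<lambda>n. M N (\<phi> n) - M k (\<lambda>x. real k * \<phi> n x / real N)) \<longlonglongrightarrow> 0)))"
proof -
  have N1: "N \<ge> 1" using assms(1) by simp
  have adm: "admissible N \<rho> \<rho>s" using assms(4-6) by (simp add: admissible_def)
  have seq: "optimal_S N \<rho> \<rho>s \<and> maximizing_seq (dual N \<rho>) C0 \<phi> \<longleftrightarrow>
      (\<Sum>k = 1..N. mass (\<rho>s k)) = 1 \<and>
      (\<forall>k\<in>{1..N}. maximizing_seq (partial_dual k (\<rho>s k)) C0 (\<lambda>n x. real k * \<phi> n x / real N)) \<and>
      (\<forall>k\<in>{1..N}. (\<exists>l\<in>{1..k}. mass (\<rho>s l) > 0) \<longrightarrow>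
         (\<lambda>n. M N (\<phi> n) - M k (\<lambda>x. real k * \<phi> n x / real N)) \<longlonglongrightarrow> 0)"
    (is "?L \<longleftrightarrow> ?R") if \<phi>: "\<And>n. \<phi> n \<in> C0" for \<phi>
  proof
    assume ?L
    hence "optimal_S N \<rho> \<rho>s" "maximizing_seq (dual N \<rho>) C0 \<phi>" by auto
    note conds = optimal_sequence_imp_conditions[OF assms(1-3) this]
    show ?R using conds(1) conds(2) conds(3) by blast
  next
    assume R: ?R
    \<comment> \<open>The third condition is applied with l = k.\<close>
    have lim: "(\<lambda>n. M N (\<phi> n) - M k (\<lambda>x. real k * \<phi> n x / real N)) \<longlonglongrightarrow> 0"
      if "k \<in> {1..N}" "mass (\<rho>s k) > 0" for k
    proof -
      have "\<exists>l\<in>{1..k}. mass (\<rho>s l) > 0" using that by (intro bexI[of _ k]) auto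
      thus ?thesis using R that(1) by blast
    qed
    have total: "(\<Sum>k = 1..N. mass (\<rho>s k)) = 1"
      and max: "\<And>k. k \<in> {1..N} \<Longrightarrow>
        maximizing_seq (partial_dual k (\<rho>s k)) C0 (\<lambda>n x. real k * \<phi> n x / real N)"
      using R by blast+
    show ?L
      using conditions_imp_optimal_sequence[where \<phi> = \<phi>, OF N1 assms(2) adm \<phi> total max lim] by blast
  qed
  have const: "optimal_S N \<rho> \<rho>s \<and> maximizer (dual N \<rho>) C0 \<phi> \<longleftrightarrow>
      (\<Sum>k = 1..N. mass (\<rho>s k)) = 1 \<and>
      (\<forall>k\<in>{1..N}. maximizer (partial_dual k (\<rho>s k)) C0 (\<lambda>x. real k * \<phi> x / real N)) \<and>
      (\<forall>k\<in>{1..N}. (\<exists>l\<in>{1..k}. mass (\<rho>s l) > 0) \<longrightarrow>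
         M k (\<lambda>x. real k * \<phi> x / real N) = M N \<phi>)" if \<phi>: "\<phi> \<in> C0" for \<phi>
  proof -
    have "maximizing_seq (dual N \<rho>) C0 (\<lambda>_. \<phi>) \<longleftrightarrow> maximizer (dual N \<rho>) C0 \<phi>"
      by (rule maximizing_seq_const[where F = "dual N \<rho>"]) (rule dual_real[OF \<phi> N1])
    moreover have "maximizing_seq (partial_dual k (\<rho>s k)) C0 (\<lambda>_ x. real k * \<phi> x / real N) \<longleftrightarrow>
        maximizer (partial_dual k (\<rho>s k)) C0 (\<lambda>x. real k * \<phi> x / real N)" if "k \<in> {1..N}" for k
      by (rule maximizing_seq_const[where F = "partial_dual k (\<rho>s k)"],
          rule partial_dual_eq_scaled_dual[OF \<phi>]) (use that in simp)
    \<comment> \<open>Finiteness of both values excludes \<infinity> - \<infinity>, so a vanishing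
      difference means equality.\<close>
    moreover have "(\<lambda>_::nat. M N \<phi> - M k (\<lambda>x. real k * \<phi> x / real N)) \<longlonglongrightarrow> 0 \<longleftrightarrow>
        M k (\<lambda>x. real k * \<phi> x / real N) = M N \<phi>" if "k \<in> {1..N}" for k
      using that by (auto simp: LIMSEQ_const_iff M_eq_scaled_M_top[OF \<phi> N1] M_eq_scaled_M[OF \<phi>])
    ultimately show ?thesis using seq[of "\<lambda>_. \<phi>", OF \<phi>] by simp
  qed
  show ?thesis using const seq by blast
qed

end
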